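(* For every integer $q\ge2$ and all integers $1\le d\le N$, $$\left(\mathrm{BH}^{\mathrm{int}}_{d,q}\right)^{-1/d}\binom Nd^{-\frac{d-1}{2d^2}}(q-1)^{-\frac{d-1}{2d}}\le R_{N,q}^{(d)}\le\left(2\sqrt{N\log q+\log 8}\right)^{1/d}\binom Nd^{-\frac1{2d}}(q-1)^{-1/2}.$$ Moreover, for fixed $q$, if $d=d(N)\to\infty$ and $d=o(N)$ as $N\to\infty$, then $$R_{N,q}^{(d)}=(1+o(1))\,N^{1/(2d)}\sqrt{\frac{d}{e(q-1)N}}.$$
   Context: Let $C_q=\{1,\omega,\dots,\omega^{q-1}\}\subset\mathbb C$, $\omega=e^{2\pi i/q}$. Every $f:C_q^N\to\mathbb C$ has a unique Fourier expansion $f(x)=\sum_{\alpha\in\{0,\dots,q-1\}^N}\widehat f(\alpha)x^\alpha$, where $x^\alpha=x_1^{\alpha_1}\cdots x_N^{\alpha_N}$ and $\widehat f(\alpha)=q^{-N}\sum_{x\in C_q^N}f(x)\overline{x^\alpha}$. Put $\|f\|_\infty=\max_{x\in C_q^N}|f(x)|$, $\operatorname{supp}(\alpha)=\{j\in\{1,\dots,N\}:\alpha_j\ne0\}$ and $s(\alpha)=|\operatorname{supp}(\alpha)|$. For an integer $d\ge1$ let $p_d=\frac{2d}{d+1}$. $\mathrm{BH}^{\mathrm{int}}_{d,q}$ denotes the least constant, independent of $N$, such that $\left(\sum_{s(\alpha)\le d}|\widehat f(\alpha)|^{p_d}\right)^{1/p_d}\le \mathrm{BH}^{\mathrm{int}}_{d,q}\|f\|_\infty$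 for every $N\ge1$ and every $f:C_q^N\to\mathbb C$ with $\widehat f(\alpha)=0$ whenever $s(\alpha)>d$. For $1\le d\le N$ let $\mathcal H_{N,q}^{(d)}$ be the set of $f:C_q^N\to\mathbb C$ with $\widehat f(\alpha)=0$ whenever $|\operatorname{supp}(\alpha)|\ne d$. The interaction Bohr radius of the $d$th layer is $$R_{N,q}^{(d)}=\sup\left\{0\le r\le1:\ r^d\sum_{|\operatorname{supp}(\alpha)|=d}|\widehat f(\alpha)|\le\|f\|_\infty\ \text{for every } f\in\mathcal H_{N,q}^{(d)}\right\}.$$ *)

theory Defs
  imports "HOL-Analysis.Analysis" "HOL-Library.FuncSet" "HOL-Library.Landau_Symbols"
begin

unbundle asymp_equiv_syntax

definition roots_C :: "nat \<Rightarrow> complex set" where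
  "roots_C q = {exp (2 * of_real pi * \<i> / of_nat q) ^ k | k. k < q}"

text \<open>
  Points of \<open>C\<^sub>q\<^sup>N\<close> and multi-indices are extensional functions on \<open>{1..N}\<close>.  A function
  \<open>f : C\<^sub>q\<^sup>N \<rightarrow> \<complex>\<close> is a total function \<open>(nat \<Rightarrow> complex) \<Rightarrow> complex\<close>; everything below
  depends only on its values on \<open>cube q N\<close>.
\<close>

definition cube :: "nat \<Rightarrow> nat \<Rightarrow> (nat \<Rightarrow> complex) set" where
  "cube q N = {1..N} \<rightarrow>\<^sub>E roots_C q"

definition multi_indices :: "nat \<Rightarrow> nat \<Rightarrow> (nat \<Rightarrow> nat) set" where
  "multi_indices q N = {1..N} \<rightarrow>\<^sub>E {0..<q}"

definition monomial :: "nat \<Rightarrow> (nat \<Rightarrow> nat) \<Rightarrow> (nat \<Rightarrow> complex) \<Rightarrow> complex" where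
  "monomial N \<alpha> x = (\<Prod>j\<in>{1..N}. x j ^ \<alpha> j)"

definition fourier_coeff ::
    "nat \<Rightarrow> nat \<Rightarrow> ((nat \<Rightarrow> complex) \<Rightarrow> complex) \<Rightarrow> (nat \<Rightarrow> nat) \<Rightarrow> complex" where
  "fourier_coeff q N f \<alpha> = (\<Sum>x\<in>cube q N. f x * cnj (monomial N \<alpha> x)) / of_nat (q ^ N)"

definition sup_norm :: "nat \<Rightarrow> nat \<Rightarrow> ((nat \<Rightarrow> complex) \<Rightarrow> complex) \<Rightarrow> real" where
  "sup_norm q N f = Max ((\<lambda>x. norm (f x)) ` cube q N)"

definition supp :: "nat \<Rightarrow> (nat \<Rightarrow> nat) \<Rightarrow> nat set" where
  "supp N \<alpha> = {j\<in>{1..N}. \<alpha> j \<noteq> 0}"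

definition BH_exponent :: "nat \<Rightarrow> real" where
  "BH_exponent d = 2 * real d / (real d + 1)"

definition BH_bound :: "nat \<Rightarrow> nat \<Rightarrow> real \<Rightarrow> bool" where
  "BH_bound d q C \<longleftrightarrow>
    (\<forall>N\<ge>1. \<forall>f. (\<forall>\<alpha>\<in>multi_indices q N. card (supp N \<alpha>) > d \<longrightarrow> fourier_coeff q N f \<alpha> = 0) \<longrightarrow>
      (\<Sum>\<alpha> | \<alpha> \<in> multi_indices q N \<and> card (supp N \<alpha>) \<le> d.
          norm (fourier_coeff q N f \<alpha>) powr BH_exponent d) powr (1 / BH_exponent d)
        \<le> C * sup_norm q N f)"

definition BH_int :: "nat \<Rightarrow> nat \<Rightarrow> real" where
  "BH_int d q = (LEAST C. BH_bound d q C)"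

definition layer :: "nat \<Rightarrow> nat \<Rightarrow> nat \<Rightarrow> ((nat \<Rightarrow> complex) \<Rightarrow> complex) set" where
  "layer N q d =
    {f. \<forall>\<alpha>\<in>multi_indices q N. card (supp N \<alpha>) \<noteq> d \<longrightarrow> fourier_coeff q N f \<alpha> = 0}"

definition bohr_radius :: "nat \<Rightarrow> nat \<Rightarrow> nat \<Rightarrow> real" where
  "bohr_radius N q d =
    Sup {r. 0 \<le> r \<and> r \<le> 1 \<and>
      (\<forall>f\<in>layer N q d.
        r ^ d * (\<Sum>\<alpha> | \<alpha> \<in> multi_indices q N \<and> card (supp N \<alpha>) = d.
            norm (fourier_coeff q N f \<alpha>))
          \<le> sup_norm q N f)}"

end

theory Submission
  imports Defs "HOL-Real_Asymp.Real_Asymp"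
begin

text \<open>
  The upper bound for the radius tests it on a random polynomial with coefficients \<open>\<plusminus>1\<close> on the whole
  layer. The lower bound is Hoelder's inequality combined with a Bohnenblust--Hille inequality, so
  the asymptotics need a Bohnenblust--Hille constant on the \<open>d\<close>th layer that grows subexponentially.

  That constant is obtained in the manner of Bayart, Pellegrino and Seoane-Sepulveda. Fix
  \<open>k\<close> and split the support of every index \<open>\<alpha>\<close> with \<open>|supp \<alpha>| = m\<close> into blocks of sizes between \<open>k\<close> and \<open>2k\<close>. A Blei-type inequality
  bounds the \<open>\<ell>\<^sup>p\<close> norm of the coefficients, for the critical exponent \<open>p\<close> of \<open>m\<close>, by mixed norms
  in which a block \<open>\<beta>\<close> of size \<open>s\<close> carries the critical exponent of \<open>s\<close> and its complement
  carries \<open>\<ell>\<^sup>2\<close>. The \<open>\<ell>\<^sup>2\<close> norm is turned into an \<open>L\<^sup>p\<close> norm by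
  hypercontractivity, whose constant tends to \<open>1\<close> as \<open>k \<rightarrow> \<infinity>\<close>; the Bohnenblust--Hille
  inequality for the fixed degree \<open>s\<close> then applies to the \<open>s\<close>-homogeneous part of
  \<open>f\<close> in the block variables. That part is a coefficient of the polynomial in \<open>t\<close> obtained by averaging
  \<open>f\<close> over points that mix \<open>y\<close> and \<open>z\<close> with probabilities \<open>1 - t\<close> and \<open>t\<close>, so its norm is
  at most polynomially larger in \<open>m\<close>. Blocks of size \<open>1\<close> yield a finite constant for every degree.
\<close>

section \<open>Coefficients of polynomials bounded on an interval\<close>

text \<open>Choosing each coordinate at random from y or z is the substitute; it keeps every point
  in the cube. The price is that the parameter t is confined to [0, 1], so coefficients in t have to
  be recovered from values on an interval, which is what the Bernstein-Walsh estimate is for.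

  With blocks of about k elements, the constant of degree m consists of finitely many constants of
  degrees in [k, 2k), a polynomial in m whose degree depends on k, and a power of the square root of
  1 + 2q/(s - 1) with s \<ge> k. Only the last grows exponentially. The constant enters the radius
  with exponent -1/d, so a growth (1 + \<epsilon>)^m for every \<epsilon> > 0 suffices.

  The factor N^(1/(2d)) arises differently on the two sides: above, from the logarithm of the number
  q^N of points in a union bound; below, from the surplus 1/(2 d^2) in the exponent of the binomial
  coefficient.\<close>

lemma sum_cis_power:
  assumes "n > 0"
  shows "(\<Sum>l<n. cis (2 * pi * real l / real n) ^ i * cnj (cis (2 * pi * real l / real n)) ^ k)
    = (if i mod n = k mod n then of_nat n else 0)"
proof -
  define w where "w = cis (2 * pi * (real i - real k) / real n)"
  have eq: "cis (2 * pi * real l / real n) ^ i * cnj (cis (2 * pi * real l / real n)) ^ k = w ^ l" for l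
    using assms
    by (simp add: w_def cis_cnj Complex.DeMoivre cis_mult field_simps)
  have wn: "w ^ n = 1"
  proof -
    have "w ^ n = cis (2 * pi * of_int (int i - int k))"
      using assms by (simp add: w_def Complex.DeMoivre)
    also have "\<dots> = 1" by (rule cis_multiple_2pi) auto
    finally show ?thesis .
  qed
  have w1: "w = 1 \<longleftrightarrow> i mod n = k mod n"
  proof -
    have "w = 1 \<longleftrightarrow> (\<exists>m::int. 2 * pi * (real i - real k) / real n = of_int (2 * m) * pi)"
      unfolding w_def by (simp add: cis_conv_exp exp_eq_1) 
    also have "\<dots> \<longleftrightarrow> (\<exists>m::int. int i - int k = m * int n)"
    proof (intro ex_cong1)
      fix m :: int
      have "2 * pi * (real i - real k) / real n = of_int (2 * m) * pi \<longleftrightarrow>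
          (2 * pi) * ((real i - real k) / real n) = (2 * pi) * of_int m"
        by (simp add: mult_ac)
      also have "\<dots> \<longleftrightarrow> real_of_int (int i - int k) = of_int (m * int n)"
        unfolding mult_cancel_left using assms by (simp add: divide_eq_eq)
      finally have "2 * pi * (real i - real k) / real n = of_int (2 * m) * pi \<longleftrightarrow>
          real_of_int (int i - int k) = of_int (m * int n)" .
      then show "2 * pi * (real i - real k) / real n = of_int (2 * m) * pi \<longleftrightarrow> int i - int k = m * int n"
        by (simp only: of_int_eq_iff)
    qed
    also have "\<dots> \<longleftrightarrow> int n dvd int i - int k"
      by (auto simp: dvd_def mult.commute)
    also have "\<dots> \<longleftrightarrow> int i mod int n = int k mod int n"
      by (simp add: mod_eq_dvd_iff)
    also have "\<dots> \<longleftrightarrow> i mod n = k mod n"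
      by (metis of_nat_eq_iff zmod_int)
    finally show ?thesis .
  qed
  show ?thesis
  proof (cases "w = 1")
    case True
    then show ?thesis using w1 by (simp add: eq)
  next
    case False
    then show ?thesis using w1 wn by (simp add: eq geometric_sum)
  qed
qed

text \<open>A Cauchy estimate with the contour integral replaced by a mean over n + 1 equally spaced
  nodes: no two exponents up to n agree modulo the number of nodes, so a single coefficient
  survives.\<close>

lemma coeff_le_on_circle:
  fixes c :: "nat \<Rightarrow> complex"
  assumes r: "r \<ge> 0" and k: "k \<le> n"
    and B: "\<And>w. norm w = r \<Longrightarrow> norm (\<Sum>i\<le>n. c i * w ^ i) \<le> B"
  shows "norm (c k) * r ^ k \<le> B"
proof -
  define M where "M = Suc n"
  have M: "M > 0" by (simp add: M_def)
  define z where "z = (\<lambda>l. cis (2 * pi * real l / real M))"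
  define p where "p = (\<lambda>w. \<Sum>i\<le>n. c i * w ^ i)"
  have "(\<Sum>l<M. p (of_real r * z l) * cnj (z l) ^ k)
      = (\<Sum>i\<le>n. c i * of_real r ^ i * (\<Sum>l<M. z l ^ i * cnj (z l) ^ k))"
    unfolding p_def sum_distrib_right sum_distrib_left
    by (subst sum.swap) (simp add: power_mult_distrib mult_ac)
  also have "\<dots> = (\<Sum>i\<le>n. if i = k then c i * of_real r ^ i * of_nat M else 0)"
  proof (intro sum.cong refl)
    fix i assume "i \<in> {..n}"
    then show "c i * of_real r ^ i * (\<Sum>l<M. z l ^ i * cnj (z l) ^ k)
        = (if i = k then c i * of_real r ^ i * of_nat M else 0)"
      using sum_cis_power[OF M, of i k] k by (auto simp: z_def M_def)
  qed
  also have "\<dots> = c k * of_real r ^ k * of_nat M"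
    using k by simp
  finally have "norm (c k) * r ^ k * M = norm (\<Sum>l<M. p (of_real r * z l) * cnj (z l) ^ k)"
    using r by (simp add: norm_mult norm_power)
  also have "\<dots> \<le> (\<Sum>l<M. B)"
  proof (rule sum_norm_le)
    fix l
    have "norm (p (of_real r * z l)) \<le> B"
      unfolding p_def using r by (intro B) (simp add: norm_mult z_def)
    then show "norm (p (of_real r * z l) * cnj (z l) ^ k) \<le> B"
      by (simp add: norm_mult norm_power z_def)
  qed
  finally show ?thesis using M by (simp add: mult.commute)
qed

text \<open>
  A Bernstein--Walsh estimate: the Joukowski substitution \<open>z = (w + 1/w) / 2\<close> turns the
  polynomial into a Laurent polynomial that is bounded on the unit circle.
\<close>
lemma poly_bound_off_interval:
  fixes c :: "nat \<Rightarrow> complex"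
  assumes B: "\<And>u::real. \<bar>u\<bar> \<le> 1 \<Longrightarrow> norm (\<Sum>i\<le>n. c i * of_real u ^ i) \<le> B"
  shows "norm (\<Sum>i\<le>n. c i * z ^ i) \<le> B * (2 * n + 1) * (1 + 2 * norm z) ^ n"
proof -
  define p where "p = (\<lambda>w. \<Sum>i\<le>n. c i * w ^ i)"
  \<comment> \<open>E is w^n p((w + 1/w)/2), a polynomial of degree at most 2n. For |w| = 1 the
    argument of p is Re w, so E is bounded by B there and the Cauchy estimate bounds each of its
    coefficients.\<close>
  define E where "E = (\<Sum>i\<le>n. smult (c i) ([:1/2, 0, 1/2:] ^ i * monom 1 (n - i)))"
  have E: "poly E w = p ((w + 1 / w) / 2) * w ^ n" if "w \<noteq> 0" for w
  proof -
    have "((1 + w * w) / 2) ^ i * w ^ (n - i) = ((w + 1 / w) / 2) ^ i * w ^ n" if "i \<le> n" for i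
    proof -
      have "w ^ n = w ^ i * w ^ (n - i)" using that by (simp flip: power_add)
      moreover have "(1 + w * w) / 2 = (w + 1 / w) / 2 * w"
        using \<open>w \<noteq> 0\<close> by (simp add: field_simps)
      ultimately show ?thesis by (simp only: power_mult_distrib mult_ac)
    qed
    then show ?thesis
      by (simp add: E_def p_def poly_sum poly_monom poly_power sum_distrib_right mult.assoc
          add_divide_distrib)
  qed
  have "degree E \<le> 2 * n"
    unfolding E_def
  proof (intro degree_sum_le)
    fix i assume "i \<in> {..n}"
    have "degree ([:1/2, 0, 1/2::complex:] ^ i) \<le> 2 * i"
      using degree_power_le[of "[:1/2, 0, 1/2::complex:]" i] by simp
    moreover have "degree (monom (1::complex) (n - i)) = n - i"
      by (simp add: degree_monom_eq)
    ultimately show "degree (smult (c i) ([:1/2, 0, 1/2:] ^ i * monom 1 (n - i))) \<le> 2 * n"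
      using \<open>i \<in> {..n}\<close> degree_mult_le[of "[:1/2, 0, 1/2::complex:] ^ i" "monom 1 (n - i)"]
        degree_smult_le[of "c i" "[:1/2, 0, 1/2::complex:] ^ i * monom 1 (n - i)"] by simp
  qed simp
  then have polyE: "poly E w = (\<Sum>j\<le>2*n. coeff E j * w ^ j)" for w
    unfolding poly_altdef
    by (intro sum.mono_neutral_left) (auto simp: coeff_eq_0)
  have coeff: "norm (coeff E j) \<le> B" if "j \<le> 2 * n" for j
  proof -
    have "norm (coeff E j) * 1 ^ j \<le> B"
    proof (rule coeff_le_on_circle[OF _ that])
      fix w :: complex assume w: "norm w = 1"
      then have "w \<noteq> 0" by auto
      have "1 / w = cnj w"
        using w by (simp add: divide_eq_eq complex_norm_square[symmetric] mult.commute \<open>w \<noteq> 0\<close> )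
      then have "(w + 1 / w) / 2 = of_real (Re w)"
        by (simp add: complex_add_cnj)
      moreover have "\<bar>Re w\<bar> \<le> 1" using abs_Re_le_cmod[of w] w by simp
      ultimately have "norm (poly E w) \<le> B"
        using B[of "Re w"] w \<open>w \<noteq> 0\<close> by (simp add: E p_def norm_mult norm_power)
      then show "norm (\<Sum>i\<le>2*n. coeff E i * w ^ i) \<le> B" by (simp add: polyE)
    qed simp
    then show ?thesis by simp
  qed
  have B0: "B \<ge> 0" using order_trans[OF norm_ge_zero B[of 0]] by simp
  \<comment> \<open>The two preimages of z under the Joukowski map have product 1, so one of them
    satisfies |w| \<ge> 1. There E is at most B (2n + 1) |w|^(2n), and dividing by |w|^n leaves
    |w|^n.\<close>
  obtain w where w: "(w + 1 / w) / 2 = z" "norm w \<ge> 1"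
  proof -
    define v where "v = z + csqrt (z\<^sup>2 - 1)"
    define v' where "v' = z - csqrt (z\<^sup>2 - 1)"
    have "v * v' = z\<^sup>2 - (csqrt (z\<^sup>2 - 1))\<^sup>2"
      by (simp add: v_def v'_def power2_eq_square algebra_simps)
    then have vv: "v * v' = 1" by simp
    then have "1 / v = v'" "1 / v' = v"
      using inverse_unique[of v v'] inverse_unique[of v' v]
      unfolding inverse_eq_divide mult.commute[of v' v] by blast+
    moreover have "norm v * norm v' = 1" using vv by (metis norm_mult norm_one)
    then have "norm v \<ge> 1 \<or> norm v' \<ge> 1"
      using mult_strict_mono'[of "norm v" 1 "norm v'" 1] norm_ge_zero[of v] norm_ge_zero[of v']
      unfolding mult_1 not_less[symmetric] by (metis less_irrefl)
    moreover have "(v + v') / 2 = z" "(v' + v) / 2 = z" by (simp_all add: v_def v'_def)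
    ultimately show ?thesis using that[of v] that[of v'] by metis
  qed
  then have w0: "w \<noteq> 0" by auto
  have "norm w \<le> norm (w + 1 / w) + norm (1 / w)"
    by (metis add_diff_cancel_right' norm_triangle_ineq4)
  also have "norm (w + 1 / w) = 2 * norm z" unfolding w(1)[symmetric] by (simp add: norm_divide)
  also have "norm (1 / w) \<le> 1" using w(2) by (simp add: norm_divide divide_le_eq)
  finally have wle: "norm w \<le> 1 + 2 * norm z" by simp
  have "norm (p z) * norm w ^ n = norm (poly E w)"
    using w w0 by (simp add: E norm_mult norm_power)
  also have "\<dots> \<le> (\<Sum>j\<le>2*n. B * norm w ^ (2 * n))"
    unfolding polyE
  proof (rule sum_norm_le)
    fix j assume "j \<in> {..2*n}"
    then show "norm (coeff E j * w ^ j) \<le> B * norm w ^ (2 * n)"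
      unfolding norm_mult norm_power using w(2) B0
      by (intro mult_mono coeff power_increasing) auto
  qed
  also have "\<dots> = B * (2 * n + 1) * norm w ^ n * norm w ^ n"
    unfolding mult_2[of n] power_add by (simp add: add.commute)
  finally have "norm (p z) \<le> B * (2 * n + 1) * norm w ^ n"
    using w0 by simp
  also have "\<dots> \<le> B * (2 * n + 1) * (1 + 2 * norm z) ^ n"
    using wle B0 by (intro mult_left_mono power_mono) auto
  finally show ?thesis by (simp add: p_def)
qed

text \<open>The substitution s = \<sigma> u^2 maps [-1, 1] onto [0, \<sigma>] and gives an even
  polynomial of degree 2m; this explains the exponents 2m and 2k. The free parameter r is the radius
  of the circle on which the Cauchy estimate is applied.\<close>

lemma coeff_le_of_interval_bound:
  fixes c :: "nat \<Rightarrow> complex"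
  assumes B: "\<And>s::real. 0 \<le> s \<Longrightarrow> s \<le> \<sigma> \<Longrightarrow> norm (\<Sum>i\<le>m. c i * of_real s ^ i) \<le> B"
    and \<sigma>: "\<sigma> \<ge> 0" and r: "r \<ge> 0" and k: "k \<le> m"
  shows "norm (c k) * \<sigma> ^ k * r ^ (2 * k) \<le> B * (4 * m + 1) * (1 + 2 * r) ^ (2 * m)"
proof -
  define d where "d = (\<lambda>i. if even i then c (i div 2) * of_real \<sigma> ^ (i div 2) else 0)"
  have d: "(\<Sum>i\<le>2*m. d i * z ^ i) = (\<Sum>i\<le>m. c i * (of_real \<sigma> * z\<^sup>2) ^ i)" for z
  proof -
    have "(\<Sum>i\<le>2*m. d i * z ^ i) = (\<Sum>i\<in>(*) 2 ` {..m}. d i * z ^ i)"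
      by (rule sum.mono_neutral_right) (auto simp: d_def image_iff elim!: evenE)
    also have "\<dots> = (\<Sum>i\<le>m. d (2 * i) * z ^ (2 * i))"
      by (subst sum.reindex) (auto simp: inj_on_def)
    finally show ?thesis
      by (simp add: d_def power_mult_distrib power_mult mult.assoc)
  qed
  have "norm (d (2 * k)) * r ^ (2 * k) \<le> B * (2 * real (2 * m) + 1) * (1 + 2 * r) ^ (2 * m)"
  proof (rule coeff_le_on_circle[OF r, where c = d and n = "2 * m"])
    fix w :: complex assume w: "norm w = r"
    show "norm (\<Sum>i\<le>2*m. d i * w ^ i) \<le> B * (2 * real (2 * m) + 1) * (1 + 2 * r) ^ (2 * m)"
      unfolding w[symmetric]
    proof (rule order_trans[OF poly_bound_off_interval[where n = "2 * m" and c = d and B = B]])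
      fix u :: real assume "\<bar>u\<bar> \<le> 1"
      then have "\<sigma> * u\<^sup>2 \<le> \<sigma>" using \<sigma> by (simp add: mult_left_le abs_square_le_1)
      then have "norm (\<Sum>i\<le>m. c i * of_real (\<sigma> * u\<^sup>2) ^ i) \<le> B"
        using \<sigma> by (intro B) auto
      then show "norm (\<Sum>i\<le>2*m. d i * of_real u ^ i) \<le> B" by (simp add: d)
    qed (simp add: add.commute)
  qed (use k in auto)
  then show ?thesis using \<sigma> by (simp add: d_def norm_mult norm_power add.commute)
qed

section \<open>Inequalities for finite sums\<close>

lemma sum_PiE_insert:
  assumes "j \<notin> J"
  shows "(\<Sum>f\<in>PiE (insert j J) T. h f) = (\<Sum>y\<in>T j. \<Sum>g\<in>PiE J T. h (g(j := y)))"
proof -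
  have "inj_on (\<lambda>(y, g). g(j := y)) (T j \<times> PiE J T)"
    using assms inj_combinator[of j J T] by simp
  then show ?thesis
    unfolding PiE_insert_eq by (simp add: sum.reindex sum.cartesian_product case_prod_unfold)
qed

lemma sum_prod_PiE:
  fixes h :: "'a \<Rightarrow> 'b \<Rightarrow> 'c::comm_semiring_1"
  assumes "finite J"
  shows "(\<Sum>f\<in>PiE J T. \<Prod>j\<in>J. h j (f j)) = (\<Prod>j\<in>J. \<Sum>y\<in>T j. h j y)"
  using assms
proof (induction J rule: finite_induct)
  case (insert j J)
  have "(\<Prod>i\<in>J. h i ((g(j := y)) i)) = (\<Prod>i\<in>J. h i (g i))" for g y
    using insert(2) by (intro prod.cong) auto
  then have "(\<Sum>f\<in>PiE (insert j J) T. \<Prod>i\<in>insert j J. h i (f i))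
      = (\<Sum>y\<in>T j. \<Sum>g\<in>PiE J T. h j y * (\<Prod>i\<in>J. h i (g i)))"
    unfolding sum_PiE_insert[OF insert(2)]
    using insert(1,2) by (simp del: fun_upd_apply add: fun_upd_same)
  also have "\<dots> = (\<Prod>i\<in>insert j J. \<Sum>y\<in>T i. h i y)"
    unfolding prod.insert[OF insert(1,2)] insert.IH[symmetric] sum_product ..
  finally show ?case .
qed simp

lemma young_powr:
  fixes a b :: real
  assumes "0 \<le> t" "t \<le> 1" "a \<ge> 0" "b \<ge> 0"
  shows "a powr t * b powr (1 - t) \<le> t * a + (1 - t) * b"
proof (cases "a = 0 \<or> b = 0")
  case False
  then show ?thesis using Youngs_inequality_0[of t "1 - t" a b] assms by simp
next
  case True
  then show ?thesis using assms by auto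
qed

lemma holder_sum:
  fixes f g :: "'a \<Rightarrow> real"
  assumes "finite I" "0 < t" "t < 1"
    and f: "\<And>i. i \<in> I \<Longrightarrow> f i \<ge> 0" and g: "\<And>i. i \<in> I \<Longrightarrow> g i \<ge> 0"
  shows "(\<Sum>i\<in>I. f i powr t * g i powr (1 - t)) \<le> (\<Sum>i\<in>I. f i) powr t * (\<Sum>i\<in>I. g i) powr (1 - t)"
proof (cases "sum f I = 0 \<or> sum g I = 0")
  case True
  then have "(\<forall>i\<in>I. f i = 0) \<or> (\<forall>i\<in>I. g i = 0)"
    using assms by (simp add: sum_nonneg_eq_0_iff)
  then show ?thesis by auto
next
  case False
  define F where "F = sum f I"
  define G where "G = sum g I"
  have F: "F > 0" and G: "G > 0"
    using False f g by (auto simp: F_def G_def less_le sum_nonneg)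
  have "(\<Sum>i\<in>I. f i powr t * g i powr (1 - t)) / (F powr t * G powr (1 - t))
      = (\<Sum>i\<in>I. (f i / F) powr t * (g i / G) powr (1 - t))"
    unfolding sum_divide_distrib using f g F G by (intro sum.cong refl) (simp add: powr_divide)
  also have "\<dots> \<le> (\<Sum>i\<in>I. t * (f i / F) + (1 - t) * (g i / G))"
    using assms F G by (intro sum_mono young_powr) auto
  also have "\<dots> = t * (\<Sum>i\<in>I. f i / F) + (1 - t) * (\<Sum>i\<in>I. g i / G)"
    by (simp only: sum.distrib sum_distrib_left)
  also have "\<dots> = 1"
    using F G by (simp add: F_def G_def flip: sum_divide_distrib)
  finally show ?thesis using F G by (simp add: F_def G_def divide_le_eq)
qed

lemma arith_geom_mean_weighted:
  fixes s x :: "'a \<Rightarrow> real"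
  assumes "finite I" "\<And>i. i \<in> I \<Longrightarrow> s i \<ge> 0" "(\<Sum>i\<in>I. s i) = 1" "\<And>i. i \<in> I \<Longrightarrow> x i > 0"
  shows "(\<Prod>i\<in>I. x i powr s i) \<le> (\<Sum>i\<in>I. s i * x i)"
proof -
  have "I \<noteq> {}" using assms(3) by auto
  have "(\<Prod>i\<in>I. x i powr s i) = exp (\<Sum>i\<in>I. s i *\<^sub>R ln (x i))"
    using assms by (simp add: exp_sum powr_def less_imp_neq[THEN not_sym] cong: prod.cong)
  also have "\<dots> \<le> (\<Sum>i\<in>I. s i * exp (ln (x i)))"
    by (rule convex_on_sum[OF _ \<open>I \<noteq> {}\<close> exp_convex]) (use assms in auto)
  finally show ?thesis using assms by simp
qed

text \<open>The finite form of Minkowski's integral inequality, in which the sum over x is pulled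
  out of the r-norm in i. It carries hypercontractivity from one variable to products.\<close>

lemma minkowski_sum:
  fixes V :: "'a \<Rightarrow> 'b \<Rightarrow> real"
  assumes "finite X" "finite I" "r \<ge> 1" and V: "\<And>x i. x \<in> X \<Longrightarrow> i \<in> I \<Longrightarrow> V x i \<ge> 0"
  shows "(\<Sum>i\<in>I. (\<Sum>x\<in>X. V x i) powr r) powr (1 / r) \<le> (\<Sum>x\<in>X. (\<Sum>i\<in>I. V x i powr r) powr (1 / r))"
proof (cases "r = 1 \<or> (\<Sum>i\<in>I. (\<Sum>x\<in>X. V x i) powr r) = 0")
  case True
  then show ?thesis
  proof
    assume "r = 1"
    then show ?thesis
      using assms by (simp add: sum_nonneg) (subst sum.swap, simp)
  qed (simp add: sum_nonneg)
next
  case False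
  define W where "W = (\<lambda>i. \<Sum>x\<in>X. V x i)"
  define S where "S = (\<Sum>i\<in>I. W i powr r)"
  have r: "r > 1" using False assms by simp
  have W: "W i \<ge> 0" if "i \<in> I" for i using V that by (simp add: W_def sum_nonneg)
  have S: "S > 0" using False by (simp add: S_def W_def less_le sum_nonneg)
  have "S = (\<Sum>i\<in>I. W i * W i powr (r - 1))"
    unfolding S_def using W r by (intro sum.cong refl) (simp add: powr_mult_base)
  also have "\<dots> = (\<Sum>x\<in>X. \<Sum>i\<in>I. V x i * W i powr (r - 1))"
    unfolding sum.swap[of _ I X] sum_distrib_right[symmetric] by (simp add: W_def)
  also have "\<dots> \<le> (\<Sum>x\<in>X. (\<Sum>i\<in>I. V x i powr r) powr (1 / r) * S powr (1 - 1 / r))"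
  proof (rule sum_mono)
    fix x assume x: "x \<in> X"
    have "(\<Sum>i\<in>I. V x i * W i powr (r - 1))
        = (\<Sum>i\<in>I. (V x i powr r) powr (1 / r) * (W i powr r) powr (1 - 1 / r))"
      using V x W r by (intro sum.cong refl) (simp add: powr_powr right_diff_distrib)
    also have "\<dots> \<le> (\<Sum>i\<in>I. V x i powr r) powr (1 / r) * S powr (1 - 1 / r)"
      unfolding S_def using r assms by (intro holder_sum) auto
    finally show "(\<Sum>i\<in>I. V x i * W i powr (r - 1)) \<le> \<dots>" .
  qed
  also have "\<dots> = (\<Sum>x\<in>X. (\<Sum>i\<in>I. V x i powr r) powr (1 / r)) * S powr (1 - 1 / r)"
    by (simp add: sum_distrib_right)
  finally have "S / S powr (1 - 1 / r) \<le> (\<Sum>x\<in>X. (\<Sum>i\<in>I. V x i powr r) powr (1 / r))"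
    using S by (simp add: divide_le_eq)
  moreover have "S / S powr (1 - 1 / r) = S powr (1 / r)"
    using S by (simp add: powr_diff)
  ultimately show ?thesis by (simp add: S_def W_def)
qed

lemma BH_exponent_half: "BH_exponent d / 2 = real d / (real d + 1)"
  by (simp add: BH_exponent_def divide_simps)

text \<open>
  A form of Blei's inequality. The weights \<open>w\<close> distribute the mass of \<open>a\<close> over the
  blocks: \<open>a powr p\<close> is split by Young's inequality into \<open>a\<^sup>2 w\<close>, which is summed fibrewise, and
  \<open>w powr - m\<close>, which is summed by the joint injectivity of the \<open>P i\<close>.
\<close>
lemma blei_blocks:
  fixes a :: "'a \<Rightarrow> real" and P :: "nat \<Rightarrow> 'a \<Rightarrow> 'b" and s :: "nat \<Rightarrow> nat"
  assumes fin: "finite U" and a: "\<And>\<alpha>. \<alpha> \<in> U \<Longrightarrow> a \<alpha> > 0"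
    and s: "\<And>i. i < r \<Longrightarrow> s i > 0" "(\<Sum>i<r. s i) = m" and m: "m > 0"
    and finV: "\<And>i. i < r \<Longrightarrow> finite (V i)" and P: "\<And>i \<alpha>. i < r \<Longrightarrow> \<alpha> \<in> U \<Longrightarrow> P i \<alpha> \<in> V i"
    and inj: "\<And>\<alpha> \<alpha>'. \<alpha> \<in> U \<Longrightarrow> \<alpha>' \<in> U \<Longrightarrow> (\<And>i. i < r \<Longrightarrow> P i \<alpha> = P i \<alpha>') \<Longrightarrow> \<alpha> = \<alpha>'"
    and M: "\<And>i. i < r \<Longrightarrow>
      (\<Sum>\<beta>\<in>V i. (\<Sum>\<alpha> | \<alpha> \<in> U \<and> P i \<alpha> = \<beta>. (a \<alpha>)\<^sup>2) powr (BH_exponent (s i) / 2)) \<le> 1"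
  shows "(\<Sum>\<alpha>\<in>U. a \<alpha> powr BH_exponent m) \<le> 1"
proof -
  define A where "A = (\<lambda>i \<beta>. \<Sum>\<alpha> | \<alpha> \<in> U \<and> P i \<alpha> = \<beta>. (a \<alpha>)\<^sup>2)"
  define G where "G = (\<lambda>i \<beta>. A i \<beta> powr (BH_exponent (s i) / 2))"
  \<comment> \<open>The exponent -1/m makes \<open>w \<alpha> powr (- m)\<close> the product of the
    values \<open>G i (P i \<alpha>)\<close>, whose sum over U is dominated by the product of the
    block sums.\<close>
  define w where "w = (\<lambda>\<alpha>. (\<Prod>i<r. G i (P i \<alpha>)) powr (- 1 / m))"
  have A0: "A i \<beta> \<ge> 0" for i \<beta> by (simp add: A_def sum_nonneg)
  have A: "A i (P i \<alpha>) > 0" if "\<alpha> \<in> U" for i \<alpha>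
  proof -
    have "(a \<alpha>)\<^sup>2 \<le> A i (P i \<alpha>)"
      unfolding A_def using fin that by (intro member_le_sum) auto
    then show ?thesis using zero_less_power[OF a[OF that], of 2] by linarith
  qed
  have G: "G i (P i \<alpha>) > 0" if "\<alpha> \<in> U" for i \<alpha>
    using A[OF that, of i] by (simp add: G_def)
  have w: "w \<alpha> > 0" if "\<alpha> \<in> U" for \<alpha>
    using G[OF that] unfolding w_def by (simp add: prod_pos less_imp_neq[THEN not_sym])
  have "(\<Sum>\<alpha>\<in>U. w \<alpha> powr (- m)) = (\<Sum>\<alpha>\<in>U. \<Prod>i<r. G i (P i \<alpha>))"
    unfolding w_def powr_powr using m G
    by (intro sum.cong refl) (simp add: prod_nonneg less_imp_le)
  also have "\<dots> = (\<Sum>\<alpha>\<in>U. \<Prod>i<r. G i (restrict (\<lambda>i. P i \<alpha>) {..<r} i))" by simp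
  also have "\<dots> = (\<Sum>h\<in>(\<lambda>\<alpha>. restrict (\<lambda>i. P i \<alpha>) {..<r}) ` U. \<Prod>i<r. G i (h i))"
  proof (rule sum.reindex[symmetric, unfolded comp_def])
    show "inj_on (\<lambda>\<alpha>. restrict (\<lambda>i. P i \<alpha>) {..<r}) U"
    proof (rule inj_onI)
      fix \<alpha> \<alpha>' assume "\<alpha> \<in> U" "\<alpha>' \<in> U"
        and "restrict (\<lambda>i. P i \<alpha>) {..<r} = restrict (\<lambda>i. P i \<alpha>') {..<r}"
      then show "\<alpha> = \<alpha>'" by (intro inj) (metis lessThan_iff restrict_apply')+
    qed
  qed
  also have "\<dots> \<le> (\<Sum>h\<in>PiE {..<r} V. \<Prod>i<r. G i (h i))"
    using finV P by (intro sum_mono2 finite_PiE) (auto simp: G_def prod_nonneg split: if_splits)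
  also have "\<dots> = (\<Prod>i<r. \<Sum>\<beta>\<in>V i. G i \<beta>)"
    by (rule sum_prod_PiE) simp
  also have "\<dots> \<le> 1"
    using M by (intro prod_le_1) (auto simp: G_def A_def sum_nonneg)
  finally have wm: "(\<Sum>\<alpha>\<in>U. w \<alpha> powr (- m)) \<le> 1" .
  have "(\<Sum>\<alpha>\<in>U. (a \<alpha>)\<^sup>2 * w \<alpha>)
      \<le> (\<Sum>\<alpha>\<in>U. (a \<alpha>)\<^sup>2 * (\<Sum>i<r. s i / m * A i (P i \<alpha>) powr (- 1 / (s i + 1))))"
  proof (intro sum_mono mult_left_mono)
    fix \<alpha> assume \<alpha>: "\<alpha> \<in> U"
    \<comment> \<open>As the sizes s i add up to m, w is a weighted geometric mean of the
      A_i^(-1/(s_i + 1)) with weights s_i/m. Bounding it by the arithmetic mean separates the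
      blocks.\<close>
    have "w \<alpha> = (\<Prod>i<r. G i (P i \<alpha>) powr (- 1 / m))"
      unfolding w_def by (rule prod_powr_distrib)
    also have "\<dots> = (\<Prod>i<r. (A i (P i \<alpha>) powr (- 1 / (s i + 1))) powr (s i / m))"
      unfolding G_def powr_powr BH_exponent_half by (simp add: mult.commute add.commute)
    also have "\<dots> \<le> (\<Sum>i<r. s i / m * A i (P i \<alpha>) powr (- 1 / (s i + 1)))"
    proof (intro arith_geom_mean_weighted)
      show "(\<Sum>i<r. real (s i) / real m) = 1"
        using s(2) m by (simp flip: sum_divide_distrib of_nat_sum)
    qed (use A[OF \<alpha>] in \<open>auto simp: less_imp_neq[THEN not_sym]\<close>)
    finally show "w \<alpha> \<le> \<dots>" .
  qed simp
  also have "\<dots> = (\<Sum>i<r. s i / m * (\<Sum>\<alpha>\<in>U. (a \<alpha>)\<^sup>2 * A i (P i \<alpha>) powr (- 1 / (s i + 1))))"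
    unfolding sum_distrib_left by (subst sum.swap) (simp add: mult_ac)
  also have "\<dots> \<le> (\<Sum>i<r. s i / m * 1)"
  proof (intro sum_mono mult_left_mono)
    fix i assume i: "i \<in> {..<r}"
    have "(\<Sum>\<alpha>\<in>U. (a \<alpha>)\<^sup>2 * A i (P i \<alpha>) powr (- 1 / (s i + 1)))
        = (\<Sum>\<beta>\<in>V i. \<Sum>\<alpha> | \<alpha> \<in> U \<and> P i \<alpha> = \<beta>. (a \<alpha>)\<^sup>2 * A i (P i \<alpha>) powr (- 1 / (s i + 1)))"
      using fin finV P i by (intro sum.group[symmetric]) auto
    also have "\<dots> = (\<Sum>\<beta>\<in>V i. A i \<beta> * A i \<beta> powr (- 1 / (s i + 1)))"
      by (subst (2) A_def) (simp add: sum_distrib_right)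
    \<comment> \<open>1 - 1/(s_i + 1) is half the critical exponent of s_i, so each block reproduces
      exactly its hypothesis.\<close>
    also have "\<dots> = (\<Sum>\<beta>\<in>V i. G i \<beta>)"
      unfolding G_def using A0
      by (intro sum.cong refl) (simp add: powr_mult_base BH_exponent_half, simp add: divide_simps add.commute)
    also have "\<dots> \<le> 1" using M i by (simp add: G_def A_def)
    finally show "(\<Sum>\<alpha>\<in>U. (a \<alpha>)\<^sup>2 * A i (P i \<alpha>) powr (- 1 / (s i + 1))) \<le> 1" .
  qed simp
  also have "\<dots> = 1"
    using s(2) m by (simp flip: sum_divide_distrib of_nat_sum)
  finally have aw: "(\<Sum>\<alpha>\<in>U. (a \<alpha>)\<^sup>2 * w \<alpha>) \<le> 1" .
  \<comment> \<open>This t satisfies 2t = \<open>BH_exponent m\<close> and t = m (1 - t), so the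
    powers of w cancel.\<close>
  define t where "t = m / (m + 1)"
  have "(\<Sum>\<alpha>\<in>U. a \<alpha> powr BH_exponent m)
      = (\<Sum>\<alpha>\<in>U. ((a \<alpha>)\<^sup>2 * w \<alpha>) powr t * (w \<alpha> powr (- m)) powr (1 - t))"
  proof (intro sum.cong refl)
    fix \<alpha> assume \<alpha>: "\<alpha> \<in> U"
    have "((a \<alpha>)\<^sup>2 * w \<alpha>) powr t * (w \<alpha> powr (- m)) powr (1 - t)
        = (a \<alpha> powr 2) powr t * (w \<alpha> powr t * w \<alpha> powr (- m * (1 - t)))"
      using a[OF \<alpha>] w[OF \<alpha>] by (simp add: powr_mult powr_powr)
    also have "\<dots> = a \<alpha> powr (2 * t) * w \<alpha> powr (t - m * (1 - t))"
      by (simp add: powr_powr flip: powr_add)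
    also have "t - m * (1 - t) = 0" by (simp add: t_def field_simps)
    finally show "a \<alpha> powr BH_exponent m = ((a \<alpha>)\<^sup>2 * w \<alpha>) powr t * (w \<alpha> powr (- m)) powr (1 - t)"
      using w[OF \<alpha>] by (simp add: t_def BH_exponent_def add.commute)
  qed
  also have "\<dots> \<le> (\<Sum>\<alpha>\<in>U. t * ((a \<alpha>)\<^sup>2 * w \<alpha>) + (1 - t) * w \<alpha> powr (- m))"
    using w by (intro sum_mono young_powr) (auto simp: t_def less_imp_le)
  also have "\<dots> = t * (\<Sum>\<alpha>\<in>U. (a \<alpha>)\<^sup>2 * w \<alpha>) + (1 - t) * (\<Sum>\<alpha>\<in>U. w \<alpha> powr (- m))"
    by (simp add: sum.distrib sum_distrib_left)
  also have "\<dots> \<le> t * 1 + (1 - t) * 1"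
    using aw wm by (intro add_mono mult_left_mono) (auto simp: t_def)
  finally show ?thesis by simp
qed

section \<open>Hypercontractivity\<close>

text \<open>Equality holds at x = 1. In the induction the left side grows by the sum S itself and by
  k x^k, which is at most S because the powers of x decrease.\<close>

lemma geometric_double_sum_ge:
  fixes x :: real
  assumes "0 \<le> x" "x \<le> 1"
  shows "(real k - 1) * (\<Sum>i<k. x ^ i) \<le> 2 * (\<Sum>i<k. \<Sum>l<i. x ^ l)"
proof (induction k)
  case (Suc k)
  have "real k * x ^ k = (\<Sum>i<k. x ^ k)" by simp
  also have "\<dots> \<le> (\<Sum>i<k. x ^ i)"
    using assms by (intro sum_mono power_decreasing) auto
  finally show ?case using Suc by (simp add: algebra_simps)
qed simp

text \<open>Bernoulli's inequality with a quantitative remainder. Both sides contain the factor (x -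
  1)^2, the left with the geometric sum S and the right with the double sum W, so it is enough that
  (k - 1) S \<le> 2 b W. For x > 1 the bound b enters through S \<le> k b and W \<ge> k (k -
  1)/2.\<close>

lemma power_gap:
  fixes x b :: real
  assumes x: "0 \<le> x" and b: "b \<ge> 1" "x ^ k \<le> b" and k: "k \<ge> 1"
  shows "(real k - 1) / (2 * b) * (x ^ k - 1) * (x - 1) \<le> (x ^ k - 1) - k * (x - 1)"
proof -
  define S where "S = (\<Sum>i<k. x ^ i)"
  define W where "W = (\<Sum>i<k. \<Sum>l<i. x ^ l)"
  have S: "x ^ k - 1 = (x - 1) * S" unfolding S_def by (rule power_diff_1_eq)
  have "S - k = (\<Sum>i<k. x ^ i - 1)" by (simp add: S_def sum_subtractf)
  also have "\<dots> = (x - 1) * W"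
    unfolding W_def sum_distrib_left by (intro sum.cong refl) (simp add: power_diff_1_eq sum_distrib_left)
  finally have W: "S - k = (x - 1) * W" .
  have "(real k - 1) / (2 * b) * S \<le> W"
  proof (cases "x \<le> 1")
    case True
    have "W \<ge> 0" using x by (simp add: W_def sum_nonneg)
    then have "W \<le> b * W" using b by (simp add: mult_le_cancel_right1)
    moreover have "(real k - 1) * S \<le> 2 * W"
      using geometric_double_sum_ge[OF x True] by (simp add: S_def W_def)
    ultimately have "(real k - 1) * S \<le> W * (2 * b)" by (simp add: mult_ac)
    then show ?thesis using b by (simp add: divide_le_eq)
  next
    case False
    have "S \<le> (\<Sum>i<k. b)"
      unfolding S_def
    proof (rule sum_mono)
      fix i assume "i \<in> {..<k}"
      then have "x ^ i \<le> x ^ k" using False by (intro power_increasing) auto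
      then show "x ^ i \<le> b" using b by simp
    qed
    then have "(real k - 1) * S \<le> (real k - 1) * (k * b)"
      using k by (intro mult_left_mono) auto
    moreover have "(\<Sum>i<k. real i) \<le> W"
      unfolding W_def
    proof (rule sum_mono)
      fix i
      have "(\<Sum>l<i. 1) \<le> (\<Sum>l<i. x ^ l)" using False by (intro sum_mono one_le_power) auto
      then show "real i \<le> (\<Sum>l<i. x ^ l)" by simp
    qed
    moreover have "2 * (\<Sum>i<k. real i) = k * (real k - 1)"
      by (induction k) (auto simp: algebra_simps)
    ultimately have "k * (real k - 1) \<le> 2 * W" by linarith
    then have "k * (real k - 1) * b \<le> 2 * W * b" using b by (intro mult_right_mono) auto
    with \<open>(real k - 1) * S \<le> (real k - 1) * (k * b)\<close> have "(real k - 1) * S \<le> (2 * W) * b"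
      by (simp add: mult_ac)
    then show ?thesis using b by (simp add: divide_le_eq mult_ac)
  qed
  then have "(x - 1) * (x - 1) * ((real k - 1) / (2 * b) * S) \<le> (x - 1) * (x - 1) * W"
    by (intro mult_left_mono) auto
  also have "\<dots> = (x ^ k - 1) - k * (x - 1)"
    unfolding mult.assoc W[symmetric] S by (simp add: algebra_simps)
  finally show ?thesis by (simp add: S mult_ac)
qed

lemma BH_exponent_pos: "d \<ge> 1 \<Longrightarrow> BH_exponent d > 0"
  by (simp add: BH_exponent_def)

text \<open>Equivalently 2/p = 1 + 1/d, so the mean of the p-th powers raised to 1 + 1/d is the
  squared L^p norm. The hypercontractive estimates are written in this form.\<close>

lemma BH_exponent_mult: "d \<ge> 1 \<Longrightarrow> BH_exponent d * (1 + 1 / real d) = 2"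
  by (simp add: BH_exponent_def add_divide_distrib[symmetric] divide_simps)

text \<open>
  The weights \<open>x i\<close>, the normalised powers
  \<open>\<bar>g i\<bar> powr (p / k)\<close>, satisfy \<open>E \<bar>g\<bar>\<^sup>2 / x = (E \<bar>g\<bar> powr p) powr (2 / p)\<close>; this reduces the
  claim to a Cauchy--Schwarz inequality and the pointwise bound \<open>power_gap\<close>.
\<close>
lemma hypercontractive_one_variable:
  fixes g :: "'a \<Rightarrow> complex"
  assumes X: "finite X" "card X = n" "n \<ge> 1" and k: "k \<ge> 2"
  defines "\<rho> \<equiv> (real k - 1) / (real k - 1 + 2 * n)"
  shows "(1 - \<rho>) * (norm ((\<Sum>i\<in>X. g i) / n))\<^sup>2 + \<rho> * ((\<Sum>i\<in>X. (norm (g i))\<^sup>2) / n)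
    \<le> ((\<Sum>i\<in>X. norm (g i) powr BH_exponent k) / n) powr (1 + 1 / k)"
proof -
  define p where "p = BH_exponent k"
  define S where "S = (\<Sum>i\<in>X. norm (g i) powr p) / n"
  have p: "p > 0" using k by (simp add: p_def BH_exponent_pos)
  have S0: "S \<ge> 0" by (simp add: S_def sum_nonneg)
  show ?thesis
  proof (cases "S = 0")
    case True
    then have "\<forall>i\<in>X. g i = 0"
      using X p by (simp add: S_def sum_nonneg_eq_0_iff)
    then show ?thesis by simp
  next
    case False
    then have S: "S > 0" using S0 by simp
    \<comment> \<open>The constant of \<open>power_gap\<close> with b = n: the k-th powers of the x
      i sum to n, so each is at most n.\<close>
    define A where "A = (real k - 1) / (2 * real n)"
    define x where "x = (\<lambda>i. (norm (g i) powr p / S) powr (1 / k))"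
    \<comment> \<open>Where g does not vanish, |g|^2 D/x equals (1 + A) |g|^2/x - A |g|^2. The first
      term sums to the L^p quantity; the second is carried to the other side and becomes the L^2
      term of the claim.\<close>
    define D where "D = (\<lambda>i. 1 - A * (x i - 1))"
    have A: "A > 0" using k X by (simp add: A_def)
    have x0: "x i \<ge> 0" for i by (simp add: x_def)
    have xk: "x i ^ k = norm (g i) powr p / S" for i
      using k S by (cases "g i = 0") (simp_all add: x_def powr_powr flip: powr_realpow')
    have sumx: "(\<Sum>i\<in>X. x i ^ k) = n"
    proof -
      have "(\<Sum>i\<in>X. norm (g i) powr p) = n * S" using X by (simp add: S_def)
      then show ?thesis using S by (simp add: xk flip: sum_divide_distrib)
    qed
    have gap: "A * (x i ^ k - 1) * (x i - 1) \<le> (x i ^ k - 1) - k * (x i - 1)" if "i \<in> X" for i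
    proof -
      have "x i ^ k \<le> n"
        using member_le_sum[OF that, of "\<lambda>i. x i ^ k"] X x0 sumx by simp
      then show ?thesis unfolding A_def using X k x0 by (intro power_gap) auto
    qed
    have D: "D i > 0" if "i \<in> X" for i
    proof (cases "x i \<le> 1")
      case True
      then have "A * (x i - 1) \<le> 0" using A by (simp add: mult_le_0_iff)
      then show ?thesis by (simp add: D_def)
    next
      case False
      then have "x i ^ k > 1" using k by (intro one_less_power) auto
      have "0 < real k * (x i - 1)" using False k by simp
      then have "A * (x i - 1) * (x i ^ k - 1) < 1 * (x i ^ k - 1)"
        using gap[OF that] by (simp add: mult_ac)
      then have "A * (x i - 1) < 1"
        using \<open>x i ^ k > 1\<close> by (subst (asm) mult_less_cancel_right) auto
      then show ?thesis by (simp add: D_def)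
    qed
    \<comment> \<open>\<open>power_gap\<close> says k (x - 1) \<le> (x^k - 1) D, and x - D = (1 +
      A)(x - 1), so x/D lies below an affine function of x^k. As the x^k have mean 1, the x/D have
      mean at most 1.\<close>
    have phi: "x i / D i \<le> 1 + (1 + A) * (x i ^ k - 1) / k" if "i \<in> X" for i
    proof -
      have "(1 + A) * (k * (x i - 1)) \<le> (1 + A) * ((x i ^ k - 1) * D i)"
        using gap[OF that] A by (intro mult_left_mono) (auto simp: D_def algebra_simps)
      then have "(1 + A) * (x i - 1) \<le> (1 + A) * (x i ^ k - 1) / k * D i"
        using k by (simp add: pos_le_divide_eq mult_ac)
      then show ?thesis
        using D[OF that] by (simp add: pos_divide_le_eq D_def algebra_simps)
    qed
    have "(\<Sum>i\<in>X. x i / D i) \<le> (\<Sum>i\<in>X. 1 + (1 + A) / k * (x i ^ k - 1))"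
      using phi by (intro sum_mono) simp
    also have "\<dots> = n + (1 + A) / k * ((\<Sum>i\<in>X. x i ^ k) - n)"
      unfolding sum.distrib sum_distrib_left[symmetric] sum_subtractf using X by simp
    also have "\<dots> = n" by (simp add: sumx)
    finally have sphi: "(\<Sum>i\<in>X. x i / D i) \<le> n" .
    have x_eq0: "x i = 0 \<longleftrightarrow> g i = 0" for i using S k by (auto simp: x_def)
    have ratio: "(norm (g i))\<^sup>2 / x i = norm (g i) powr p * S powr (1 / k)" for i
    proof (cases "g i = 0")
      case False
      then have "x i = norm (g i) powr (p / k) / S powr (1 / k)"
        using S by (simp add: x_def powr_divide powr_powr)
      moreover have "(norm (g i))\<^sup>2 = norm (g i) powr (p + p / k)"
        using False k BH_exponent_mult[of k] by (simp add: p_def distrib_left)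
      ultimately show ?thesis using False S by (simp add: powr_add)
    qed simp
    have "(norm (\<Sum>i\<in>X. g i))\<^sup>2 \<le> (\<Sum>i\<in>X. norm (g i))\<^sup>2"
      by (intro power_mono norm_sum) auto
    also have "(\<Sum>i\<in>X. norm (g i)) = (\<Sum>i\<in>X. (norm (g i) * sqrt (D i / x i)) * sqrt (x i / D i))"
    proof (intro sum.cong refl)
      fix i assume "i \<in> X"
      then show "norm (g i) = norm (g i) * sqrt (D i / x i) * sqrt (x i / D i)"
        using D[of i] x_eq0[of i] by (cases "g i = 0") (auto simp flip: real_sqrt_mult)
    qed
    also have "(\<dots>)\<^sup>2 \<le> (\<Sum>i\<in>X. (norm (g i) * sqrt (D i / x i))\<^sup>2) * (\<Sum>i\<in>X. (sqrt (x i / D i))\<^sup>2)"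
      by (rule Cauchy_Schwarz_ineq_sum)
    also have "\<dots> = (\<Sum>i\<in>X. (norm (g i))\<^sup>2 * (D i / x i)) * (\<Sum>i\<in>X. x i / D i)"
      using D x0 by (simp add: power_mult_distrib less_imp_le cong: sum.cong)
    also have "\<dots> \<le> (\<Sum>i\<in>X. (norm (g i))\<^sup>2 * (D i / x i)) * n"
      using D x0 by (intro mult_left_mono sphi sum_nonneg) (simp add: less_imp_le)
    also have "(\<Sum>i\<in>X. (norm (g i))\<^sup>2 * (D i / x i))
        = (\<Sum>i\<in>X. (1 + A) * (norm (g i) powr p * S powr (1 / k)) - A * (norm (g i))\<^sup>2)"
    proof (intro sum.cong refl)
      fix i assume "i \<in> X"
      show "(norm (g i))\<^sup>2 * (D i / x i)
          = (1 + A) * (norm (g i) powr p * S powr (1 / k)) - A * (norm (g i))\<^sup>2"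
        unfolding ratio[symmetric] using x_eq0[of i]
        by (cases "g i = 0") (auto simp: D_def field_simps)
    qed
    also have "\<dots> = (1 + A) * (n * S * S powr (1 / k)) - A * (\<Sum>i\<in>X. (norm (g i))\<^sup>2)"
      using X by (simp add: sum_subtractf S_def flip: sum_distrib_left sum_distrib_right)
    finally have "(norm (\<Sum>i\<in>X. g i))\<^sup>2 / n\<^sup>2
        \<le> ((1 + A) * (n * S * S powr (1 / k)) - A * (\<Sum>i\<in>X. (norm (g i))\<^sup>2)) * n / n\<^sup>2"
      by (intro divide_right_mono) auto
    also have "\<dots> = (1 + A) * S powr (1 + 1 / k) - A * ((\<Sum>i\<in>X. (norm (g i))\<^sup>2) / n)"
      using X S by (simp add: powr_add power2_eq_square diff_divide_distrib)
    finally have "(norm (\<Sum>i\<in>X. g i))\<^sup>2 / n\<^sup>2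
        \<le> (1 + A) * S powr (1 + 1 / k) - A * ((\<Sum>i\<in>X. (norm (g i))\<^sup>2) / n)" .
    \<comment> \<open>Division by 1 + A turns the two coefficients into the convex weights 1 -
      \<rho> and \<rho>.\<close>
    then have "(1 / (1 + A)) * ((norm (\<Sum>i\<in>X. g i))\<^sup>2 / n\<^sup>2)
        \<le> (1 / (1 + A)) * ((1 + A) * S powr (1 + 1 / k) - A * ((\<Sum>i\<in>X. (norm (g i))\<^sup>2) / n))"
      using A by (intro mult_left_mono) auto
    also have "\<dots> = S powr (1 + 1 / k) - A / (1 + A) * ((\<Sum>i\<in>X. (norm (g i))\<^sup>2) / n)"
      using A by (simp add: right_diff_distrib)
    finally have main: "(1 / (1 + A)) * ((norm (\<Sum>i\<in>X. g i))\<^sup>2 / n\<^sup>2) + A / (1 + A) * ((\<Sum>i\<in>X. (norm (g i))\<^sup>2) / n)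
        \<le> S powr (1 + 1 / k)" by simp
    have "1 + A = (real k - 1 + 2 * real n) / (2 * real n)"
      using X by (simp add: A_def add_divide_distrib)
    then have "\<rho> = A / (1 + A)" using X by (simp add: \<rho>_def A_def)
    moreover have "1 - A / (1 + A) = 1 / (1 + A)" using A by (simp add: divide_simps)
    ultimately show ?thesis
      using main by (simp add: norm_divide power_divide S_def p_def)
  qed
qed

section \<open>Fourier analysis on cyclic groups\<close>

text \<open>The coordinate set J is an arbitrary finite set rather than {1..N}, because
  hypercontractivity is proved by adjoining one coordinate at a time.\<close>

definition mon :: "nat set \<Rightarrow> (nat \<Rightarrow> nat) \<Rightarrow> (nat \<Rightarrow> complex) \<Rightarrow> complex" where
  "mon J \<alpha> x = (\<Prod>j\<in>J. x j ^ \<alpha> j)"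

definition sp :: "nat set \<Rightarrow> (nat \<Rightarrow> nat) \<Rightarrow> nat set" where
  "sp J \<alpha> = {j\<in>J. \<alpha> j \<noteq> 0}"

abbreviation indices :: "nat \<Rightarrow> nat set \<Rightarrow> (nat \<Rightarrow> nat) set" where
  "indices q J \<equiv> PiE J (\<lambda>_. {0..<q})"

abbreviation points :: "nat \<Rightarrow> nat set \<Rightarrow> (nat \<Rightarrow> complex) set" where
  "points q J \<equiv> PiE J (\<lambda>_. roots_C q)"

definition trig :: "nat \<Rightarrow> nat set \<Rightarrow> ((nat \<Rightarrow> nat) \<Rightarrow> complex) \<Rightarrow> (nat \<Rightarrow> complex) \<Rightarrow> complex" where
  "trig q J a x = (\<Sum>\<alpha>\<in>indices q J. a \<alpha> * mon J \<alpha> x)"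

lemma roots_C_eq: "roots_C q = (\<lambda>k. cis (2 * pi * real k / real q)) ` {..<q}"
proof -
  have "exp (2 * complex_of_real pi * \<i> / of_nat q) ^ k = cis (2 * pi * real k / real q)" for k
    by (simp add: cis_conv_exp mult_ac flip: exp_of_nat_mult)
  then show ?thesis by (auto simp: roots_C_def)
qed

lemma inj_on_roots: "q > 0 \<Longrightarrow> inj_on (\<lambda>k. cis (2 * pi * real k / real q)) {..<q}"
  by (rule bij_betw_imp_inj_on[OF Complex.bij_betw_roots_unity])

lemma finite_roots [simp]: "finite (roots_C q)"
  by (simp add: roots_C_eq)

lemma card_roots: "q > 0 \<Longrightarrow> card (roots_C q) = q"
  by (simp add: roots_C_eq card_image inj_on_roots)

lemma norm_roots: "x \<in> roots_C q \<Longrightarrow> norm x = 1"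
  by (auto simp: roots_C_eq)

lemma sum_roots_power:
  assumes "a < q" "b < q"
  shows "(\<Sum>x\<in>roots_C q. x ^ a * cnj x ^ b) = (if a = b then of_nat q else 0)"
  using assms sum_cis_power[of q a b] inj_on_roots[of q]
  by (simp add: roots_C_eq sum.reindex comp_def)

lemma sum_index_power:
  assumes "x \<in> roots_C q" "y \<in> roots_C q"
  shows "(\<Sum>b\<in>{0..<q}. x ^ b * cnj y ^ b) = (if x = y then of_nat q else 0)"
proof -
  obtain k l where kl: "k < q" "x = cis (2 * pi * real k / real q)" "l < q" "y = cis (2 * pi * real l / real q)"
    using assms by (auto simp: roots_C_eq)
  have "x ^ b = cis (2 * pi * real b / real q) ^ k"
       "cnj y ^ b = cnj (cis (2 * pi * real b / real q)) ^ l" for b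
    by (simp_all add: kl cis_cnj Complex.DeMoivre mult_ac)
  moreover have "x = y \<longleftrightarrow> k = l"
    using kl inj_onD[OF inj_on_roots, of q k l] by auto
  ultimately show ?thesis using sum_cis_power[of q k l] kl by (simp add: atLeast0LessThan)
qed

lemma finite_points [simp]: "finite J \<Longrightarrow> finite (points q J)"
  by (simp add: finite_PiE)

lemma finite_indices [simp]: "finite J \<Longrightarrow> finite (indices q J)"
  by (simp add: finite_PiE)

lemma card_points: "finite J \<Longrightarrow> q > 0 \<Longrightarrow> card (points q J) = q ^ card J"
  by (simp add: card_PiE card_roots)

lemma points_nonempty: "q > 0 \<Longrightarrow> points q J \<noteq> {}"
  using card_roots[of q] by (auto simp: PiE_eq_empty_iff)

lemma norm_mon: "x \<in> points q J \<Longrightarrow> norm (mon J \<alpha> x) = 1"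
  by (auto simp: mon_def norm_power PiE_iff norm_roots simp flip: prod_norm intro!: prod.neutral)

lemma mon_orthogonal:
  assumes "finite J" "\<alpha> \<in> indices q J" "\<beta> \<in> indices q J"
  shows "(\<Sum>x\<in>points q J. mon J \<alpha> x * cnj (mon J \<beta> x)) = (if \<alpha> = \<beta> then of_nat (q ^ card J) else 0)"
proof -
  have "(\<Sum>x\<in>points q J. mon J \<alpha> x * cnj (mon J \<beta> x))
      = (\<Sum>x\<in>points q J. \<Prod>j\<in>J. x j ^ \<alpha> j * cnj (x j) ^ \<beta> j)"
    by (simp add: mon_def prod.distrib)
  also have "\<dots> = (\<Prod>j\<in>J. \<Sum>y\<in>roots_C q. y ^ \<alpha> j * cnj y ^ \<beta> j)"
    by (rule sum_prod_PiE[OF assms(1)])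
  also have "\<dots> = (\<Prod>j\<in>J. if \<alpha> j = \<beta> j then of_nat q else 0)"
    using assms by (intro prod.cong refl sum_roots_power) (auto simp: PiE_iff)
  also have "\<dots> = (if \<alpha> = \<beta> then of_nat (q ^ card J) else 0)"
  proof (cases "\<alpha> = \<beta>")
    case False
    then obtain j where "j \<in> J" "\<alpha> j \<noteq> \<beta> j" using assms by (metis PiE_ext)
    then show ?thesis using False assms(1) by (auto simp: prod_zero_iff)
  qed simp
  finally show ?thesis .
qed

lemma trig_coeff:
  assumes "finite J" "\<beta> \<in> indices q J"
  shows "(\<Sum>x\<in>points q J. trig q J a x * cnj (mon J \<beta> x)) = of_nat (q ^ card J) * a \<beta>"
proof -
  have "(\<Sum>x\<in>points q J. trig q J a x * cnj (mon J \<beta> x))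
      = (\<Sum>\<alpha>\<in>indices q J. a \<alpha> * (\<Sum>x\<in>points q J. mon J \<alpha> x * cnj (mon J \<beta> x)))"
    unfolding trig_def sum_distrib_right sum_distrib_left
    by (subst sum.swap) (simp add: mult.assoc)
  also have "\<dots> = (\<Sum>\<alpha>\<in>indices q J. if \<alpha> = \<beta> then a \<alpha> * of_nat (q ^ card J) else 0)"
    using assms by (intro sum.cong refl) (simp add: mon_orthogonal)
  finally show ?thesis using assms by simp
qed

lemma norm_coeff_le:
  assumes "finite J" "q > 0" "\<beta> \<in> indices q J"
    and B: "\<And>x. x \<in> points q J \<Longrightarrow> norm (trig q J a x) \<le> B"
  shows "norm (a \<beta>) \<le> B"
proof -
  have "q ^ card J * norm (a \<beta>) = norm (\<Sum>x\<in>points q J. trig q J a x * cnj (mon J \<beta> x))"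
    using trig_coeff[OF assms(1,3), of a] by (simp add: norm_mult norm_power)
  also have "\<dots> \<le> (\<Sum>x\<in>points q J. B)"
    by (rule sum_norm_le) (simp add: norm_mult norm_mon B)
  finally show ?thesis using assms by (simp add: card_points)
qed

lemma parseval:
  assumes "finite J"
  shows "(\<Sum>x\<in>points q J. (norm (trig q J a x))\<^sup>2) = q ^ card J * (\<Sum>\<alpha>\<in>indices q J. (norm (a \<alpha>))\<^sup>2)"
proof -
  have sq: "complex_of_real ((norm z)\<^sup>2) = z * cnj z" for z by (rule complex_norm_square)
  have "complex_of_real (\<Sum>x\<in>points q J. (norm (trig q J a x))\<^sup>2)
      = (\<Sum>x\<in>points q J. \<Sum>\<beta>\<in>indices q J. cnj (a \<beta>) * (trig q J a x * cnj (mon J \<beta> x)))"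
  proof -
    have "cnj (trig q J a x) = (\<Sum>\<beta>\<in>indices q J. cnj (a \<beta>) * cnj (mon J \<beta> x))" for x
      by (simp add: trig_def)
    then show ?thesis by (simp add: sq sum_distrib_left mult_ac del: of_real_power)
  qed
  also have "\<dots> = (\<Sum>\<beta>\<in>indices q J. cnj (a \<beta>) * (of_nat (q ^ card J) * a \<beta>))"
    by (subst sum.swap) (simp add: trig_coeff[OF assms] flip: sum_distrib_left)
  also have "\<dots> = complex_of_real (q ^ card J * (\<Sum>\<alpha>\<in>indices q J. (norm (a \<alpha>))\<^sup>2))"
    unfolding of_real_mult of_real_sum sq by (simp add: sum_distrib_left mult_ac)
  finally show ?thesis by (simp only: of_real_eq_iff of_nat_power)
qed

lemma fourier_inversion:
  assumes "finite J" "q > 0" "x \<in> points q J"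
  shows "trig q J (\<lambda>\<alpha>. (\<Sum>y\<in>points q J. f y * cnj (mon J \<alpha> y)) / of_nat (q ^ card J)) x = f x"
proof -
  have dual: "(\<Sum>\<alpha>\<in>indices q J. mon J \<alpha> x * cnj (mon J \<alpha> y)) = (if x = y then of_nat (q ^ card J) else 0)"
    if y: "y \<in> points q J" for y
  proof -
    have "(\<Sum>\<alpha>\<in>indices q J. mon J \<alpha> x * cnj (mon J \<alpha> y))
        = (\<Sum>\<alpha>\<in>indices q J. \<Prod>j\<in>J. x j ^ \<alpha> j * cnj (y j) ^ \<alpha> j)"
      by (simp add: mon_def prod.distrib)
    also have "\<dots> = (\<Prod>j\<in>J. \<Sum>b\<in>{0..<q}. x j ^ b * cnj (y j) ^ b)"
      by (rule sum_prod_PiE[OF assms(1)])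
    also have "\<dots> = (\<Prod>j\<in>J. if x j = y j then of_nat q else 0)"
      using assms y by (intro prod.cong refl sum_index_power) (auto simp: PiE_iff)
    also have "\<dots> = (if x = y then of_nat (q ^ card J) else 0)"
    proof (cases "x = y")
      case False
      then obtain j where "j \<in> J" "x j \<noteq> y j" using assms y by (metis PiE_ext)
      then show ?thesis using False assms(1) by (auto simp: prod_zero_iff)
    qed simp
    finally show ?thesis .
  qed
  have "trig q J (\<lambda>\<alpha>. (\<Sum>y\<in>points q J. f y * cnj (mon J \<alpha> y)) / of_nat (q ^ card J)) x
      = (\<Sum>y\<in>points q J. f y * (\<Sum>\<alpha>\<in>indices q J. mon J \<alpha> x * cnj (mon J \<alpha> y))) / of_nat (q ^ card J)"
    unfolding trig_def sum_distrib_left sum_distrib_right sum_divide_distrib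
    by (subst sum.swap) (simp add: mult_ac)
  also have "\<dots> = (\<Sum>y\<in>points q J. if y = x then f y * of_nat (q ^ card J) else 0) / of_nat (q ^ card J)"
    by (intro arg_cong2[of _ _ _ _ "(/)"] sum.cong refl) (auto simp: dual)
  finally show ?thesis using assms by simp
qed

lemma mon_insert:
  assumes "finite J" "j \<notin> J"
  shows "mon (insert j J) (\<alpha>(j := b)) (x(j := t)) = t ^ b * mon J \<alpha> x"
proof -
  have "(\<Prod>i\<in>J. (x(j := t)) i ^ (\<alpha>(j := b)) i) = (\<Prod>i\<in>J. x i ^ \<alpha> i)"
    using assms by (intro prod.cong) auto
  then show ?thesis using assms by (simp add: mon_def del: fun_upd_apply) simp
qed

lemma trig_insert:
  assumes "finite J" "j \<notin> J"
  shows "trig q (insert j J) a (x(j := t)) = (\<Sum>b\<in>{0..<q}. trig q J (\<lambda>\<alpha>. a (\<alpha>(j := b))) x * t ^ b)"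
  unfolding trig_def sum_PiE_insert[OF assms(2)]
  by (simp add: mon_insert[OF assms] sum_distrib_right sum_distrib_left mult_ac)

lemma sp_insert:
  assumes "j \<notin> J"
  shows "sp (insert j J) (\<alpha>(j := b)) = (if b = 0 then sp J \<alpha> else insert j (sp J \<alpha>))"
  using assms by (auto simp: sp_def)

lemma finite_sp [simp]: "finite J \<Longrightarrow> finite (sp J \<alpha>)"
  by (simp add: sp_def)

section \<open>Hypercontractivity on products of cyclic groups\<close>

definition hc_ratio :: "nat \<Rightarrow> nat \<Rightarrow> real" where
  "hc_ratio q k = (real k - 1) / (real k - 1 + 2 * q)"

text \<open>The mean of the polynomial is its constant coefficient and the mean square is given by
  Parseval, so the terms with weights 1 - \<rho> and \<rho> combine to weight 1 at b = 0 and \<rho>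
  elsewhere. \<open>hc_ratio\<close> is the one-variable \<rho> for n = q.\<close>

lemma hypercontractive_roots:
  assumes q: "q \<ge> 1" and k: "k \<ge> 2"
  shows "(\<Sum>b\<in>{0..<q}. hc_ratio q k ^ (if b = 0 then 0 else 1) * (norm (c b))\<^sup>2)
    \<le> ((\<Sum>t\<in>roots_C q. norm (\<Sum>b\<in>{0..<q}. c b * t ^ b) powr BH_exponent k) / q) powr (1 + 1 / k)"
proof -
  define g where "g = (\<lambda>t. \<Sum>b\<in>{0..<q}. c b * t ^ b)"
  define J where "J = {0::nat}"
  define \<rho> where "\<rho> = hc_ratio q k"
  define a where "a = (\<lambda>\<alpha>::nat \<Rightarrow> nat. c (\<alpha> 0))"
  have J: "finite J" "card J = 1" "J = insert 0 {}" by (simp_all add: J_def)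
  have g: "trig q J a (x(0 := t)) = g t" for x t
    unfolding J(3) by (subst trig_insert) (simp_all add: g_def a_def trig_def mon_def)
  have "(\<Sum>t\<in>roots_C q. (norm (g t))\<^sup>2) = (\<Sum>x\<in>points q J. (norm (trig q J a x))\<^sup>2)"
    unfolding J(3) by (subst sum_PiE_insert) (simp_all add: g[unfolded J(3)])
  also have "\<dots> = q * (\<Sum>\<alpha>\<in>indices q J. (norm (a \<alpha>))\<^sup>2)"
    using parseval[OF J(1), of q a] J(2) by simp
  also have "(\<Sum>\<alpha>\<in>indices q J. (norm (a \<alpha>))\<^sup>2) = (\<Sum>b\<in>{0..<q}. (norm (c b))\<^sup>2)"
    unfolding J(3) by (subst sum_PiE_insert) (simp_all add: a_def)
  finally have pars: "(\<Sum>t\<in>roots_C q. (norm (g t))\<^sup>2) / q = (\<Sum>b\<in>{0..<q}. (norm (c b))\<^sup>2)"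
    using q by simp
  have "(\<Sum>t\<in>roots_C q. g t) = (\<Sum>b\<in>{0..<q}. c b * (\<Sum>t\<in>roots_C q. t ^ b * cnj t ^ 0))"
    unfolding g_def sum_distrib_left by (subst sum.swap) simp
  also have "\<dots> = (\<Sum>b\<in>{0..<q}. if b = 0 then c b * of_nat q else 0)"
    using q by (intro sum.cong refl) (subst sum_roots_power, auto)
  finally have mean: "(\<Sum>t\<in>roots_C q. g t) / q = c 0" using q by simp
  have "(\<Sum>b\<in>{0..<q}. \<rho> ^ (if b = 0 then 0 else 1) * (norm (c b))\<^sup>2)
      = (\<Sum>b\<in>{0..<q}. \<rho> * (norm (c b))\<^sup>2 + (if b = 0 then (1 - \<rho>) * (norm (c b))\<^sup>2 else 0))"
    by (intro sum.cong refl) (auto simp: algebra_simps)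
  also have "\<dots> = (1 - \<rho>) * (norm (c 0))\<^sup>2 + \<rho> * (\<Sum>b\<in>{0..<q}. (norm (c b))\<^sup>2)"
    using q by (simp add: sum.distrib sum_distrib_left)
  also have "\<dots> \<le> ((\<Sum>t\<in>roots_C q. norm (g t) powr BH_exponent k) / q) powr (1 + 1 / k)"
    using hypercontractive_one_variable[of "roots_C q" q k g] q k card_roots[of q]
    unfolding \<rho>_def hc_ratio_def by (simp add: mean pars)
  finally show ?thesis by (simp add: g_def \<rho>_def)
qed

text \<open>Tensorization: r = 1 + 1/k = 2/p is at least 1, so Minkowski's inequality moves the sum
  over the points of J outside the r-norm in the new index b. The weights factor because the support
  gains an element exactly when b is nonzero.\<close>

lemma hypercontractive:
  assumes J: "finite J" and q: "q \<ge> 1" and k: "k \<ge> 2"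
  shows "(\<Sum>\<alpha>\<in>indices q J. hc_ratio q k ^ card (sp J \<alpha>) * (norm (c \<alpha>))\<^sup>2)
    \<le> ((\<Sum>x\<in>points q J. norm (trig q J c x) powr BH_exponent k) / q ^ card J) powr (1 + 1 / k)"
  using J
proof (induction J arbitrary: c rule: finite_induct)
  case empty
  have "norm (c (\<lambda>x. undefined)) ^ 2 = norm (c (\<lambda>x. undefined)) powr (BH_exponent k * (1 + 1 / k))"
    using k by (cases "c (\<lambda>x. undefined) = 0") (simp_all add: BH_exponent_mult)
  then show ?case by (simp add: trig_def mon_def sp_def powr_powr)
next
  case (insert j J)
  define \<rho> where "\<rho> = hc_ratio q k"
  define p where "p = BH_exponent k"
  define n where "n = real q ^ card J"
  define e where "e = (\<lambda>b::nat. if b = 0 then 0 else 1::nat)"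
  define g where "g = (\<lambda>b x. trig q J (\<lambda>\<alpha>. c (\<alpha>(j := b))) x)"
  define r where "r = 1 + 1 / real k"
  have pr: "p * r = 2" and p: "p > 0" and r: "r \<ge> 1" using k by (simp_all add: p_def r_def BH_exponent_mult BH_exponent_pos)
  have \<rho>: "\<rho> \<ge> 0" using k by (simp add: \<rho>_def hc_ratio_def)
  have n: "n > 0" using q by (simp add: n_def)
  have "(\<Sum>\<alpha>\<in>indices q (insert j J). \<rho> ^ card (sp (insert j J) \<alpha>) * (norm (c \<alpha>))\<^sup>2)
      = (\<Sum>b\<in>{0..<q}. \<rho> ^ e b * (\<Sum>\<alpha>\<in>indices q J. \<rho> ^ card (sp J \<alpha>) * (norm (c (\<alpha>(j := b))))\<^sup>2))"
    unfolding sum_PiE_insert[OF insert(2)] sum_distrib_left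
    using insert(1,2) by (intro sum.cong refl) (auto simp: sp_insert e_def, simp_all add: sp_def)
  also have "\<dots> \<le> (\<Sum>b\<in>{0..<q}. \<rho> ^ e b * ((\<Sum>x\<in>points q J. norm (g b x) powr p) / n) powr r)"
    using insert.IH[of "\<lambda>\<alpha>. c (\<alpha>(j := _))"] \<rho>
    by (intro sum_mono mult_left_mono) (auto simp: \<rho>_def p_def n_def r_def g_def)
  also have "\<dots> = (\<Sum>b\<in>{0..<q}. (\<Sum>x\<in>points q J. (\<rho> ^ e b) powr (1 / r) * norm (g b x) powr p / n) powr r)"
  proof (intro sum.cong refl)
    fix b
    have "(\<Sum>x\<in>points q J. (\<rho> ^ e b) powr (1 / r) * norm (g b x) powr p / n)
        = (\<rho> ^ e b) powr (1 / r) * ((\<Sum>x\<in>points q J. norm (g b x) powr p) / n)"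
      by (simp add: sum_distrib_left sum_divide_distrib)
    moreover have "((\<rho> ^ e b) powr (1 / r) * Y) powr r = \<rho> ^ e b * Y powr r" if "Y \<ge> 0" for Y
      using \<rho> r that by (simp add: powr_mult powr_powr)
    moreover have "(\<Sum>x\<in>points q J. norm (g b x) powr p) / n \<ge> 0"
      using n by (simp add: sum_nonneg)
    ultimately show "\<rho> ^ e b * ((\<Sum>x\<in>points q J. norm (g b x) powr p) / n) powr r
        = (\<Sum>x\<in>points q J. (\<rho> ^ e b) powr (1 / r) * norm (g b x) powr p / n) powr r"
      by (simp only:)
  qed
  also have "\<dots> = ((\<Sum>b\<in>{0..<q}. (\<Sum>x\<in>points q J. (\<rho> ^ e b) powr (1 / r) * norm (g b x) powr p / n) powr r) powr (1 / r)) powr r"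
    using r by (simp add: powr_powr sum_nonneg)
  also have "\<dots> \<le> (\<Sum>x\<in>points q J. (\<Sum>b\<in>{0..<q}. ((\<rho> ^ e b) powr (1 / r) * norm (g b x) powr p / n) powr r) powr (1 / r)) powr r"
    using insert(1) r n by (intro powr_mono2 minkowski_sum) auto
  \<comment> \<open>For fixed x the numbers g b x are the coefficients of a polynomial in the new
    variable, so the one-variable inequality applies pointwise.\<close>
  also have "\<dots> \<le> (\<Sum>x\<in>points q J. ((\<Sum>t\<in>roots_C q. norm (trig q (insert j J) c (x(j := t))) powr p) / q) / n) powr r"
  proof (intro powr_mono2 sum_mono sum_nonneg)
    fix x
    have "(\<Sum>b\<in>{0..<q}. ((\<rho> ^ e b) powr (1 / r) * norm (g b x) powr p / n) powr r)
        = (\<Sum>b\<in>{0..<q}. \<rho> ^ e b * (norm (g b x))\<^sup>2) / n powr r"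
      unfolding sum_divide_distrib
    proof (intro sum.cong refl)
      fix b
      have "(norm (g b x) powr p) powr r = (norm (g b x))\<^sup>2"
        unfolding powr_powr pr by (cases "g b x = 0") auto
      then show "((\<rho> ^ e b) powr (1 / r) * norm (g b x) powr p / n) powr r = \<rho> ^ e b * (norm (g b x))\<^sup>2 / n powr r"
        using \<rho> r n by (simp add: powr_mult powr_divide powr_powr)
    qed
    also have "\<dots> \<le> ((\<Sum>t\<in>roots_C q. norm (\<Sum>b\<in>{0..<q}. g b x * t ^ b) powr p) / q) powr r / n powr r"
      using hypercontractive_roots[OF q k, of "\<lambda>b. g b x"]
      by (intro divide_right_mono) (auto simp: \<rho>_def p_def r_def e_def)
    also have "\<dots> = (((\<Sum>t\<in>roots_C q. norm (trig q (insert j J) c (x(j := t))) powr p) / q) / n) powr r"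
      using n by (simp add: trig_insert[OF insert(1,2)] g_def powr_divide powr_mult sum_nonneg)
    finally have "(\<Sum>b\<in>{0..<q}. ((\<rho> ^ e b) powr (1 / r) * norm (g b x) powr p / n) powr r) powr (1 / r)
        \<le> ((((\<Sum>t\<in>roots_C q. norm (trig q (insert j J) c (x(j := t))) powr p) / q) / n) powr r) powr (1 / r)"
      using r by (intro powr_mono2 sum_nonneg) auto
    also have "\<dots> = ((\<Sum>t\<in>roots_C q. norm (trig q (insert j J) c (x(j := t))) powr p) / q) / n"
      using r n by (simp add: powr_powr sum_nonneg)
    finally show "(\<Sum>b\<in>{0..<q}. ((\<rho> ^ e b) powr (1 / r) * norm (g b x) powr p / n) powr r) powr (1 / r) \<le> \<dots>" .
  qed (use r in auto)
  also have "(\<Sum>x\<in>points q J. ((\<Sum>t\<in>roots_C q. norm (trig q (insert j J) c (x(j := t))) powr p) / q) / n)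
      = (\<Sum>x\<in>points q (insert j J). norm (trig q (insert j J) c x) powr p) / q ^ card (insert j J)"
    unfolding sum_PiE_insert[OF insert(2)] using insert(1,2)
    by (simp add: sum.swap[of _ "roots_C q" "points q J"] n_def flip: sum_divide_distrib)
  finally show ?case by (simp add: \<rho>_def p_def r_def)
qed

text \<open>The reciprocal of \<open>hc_ratio q s\<close> for s \<ge> 2. That ratio vanishes at s =
  1, where the value is the square of the reciprocal of \<open>hc_ratio q 2\<close>.\<close>

definition hc_const :: "nat \<Rightarrow> nat \<Rightarrow> real" where
  "hc_const q s = (if s = 1 then (1 + 2 * real q)\<^sup>2 else 1 + 2 * real q / (real s - 1))"

lemma hc_const_ge_1: "s \<ge> 1 \<Longrightarrow> hc_const q s \<ge> 1"
  by (auto simp: hc_const_def)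

text \<open>
  For \<open>s = 1\<close> the operator form fails, but the estimate for a fixed degree follows from
  \<open>s = 2\<close>, that is from the exponent \<open>4/3\<close>, by interpolating between \<open>L\<^sup>1\<close> and \<open>L\<^sup>2\<close>.
\<close>
lemma hypercontractive_level:
  assumes J: "finite J" and q: "q \<ge> 1" and s: "s \<ge> 1"
    and c: "\<And>\<gamma>. \<gamma> \<in> indices q J \<Longrightarrow> c \<gamma> \<noteq> 0 \<Longrightarrow> card (sp J \<gamma>) = n"
  shows "(\<Sum>\<gamma>\<in>indices q J. (norm (c \<gamma>))\<^sup>2)
    \<le> hc_const q s ^ n * ((\<Sum>x\<in>points q J. norm (trig q J c x) powr BH_exponent s) / q ^ card J) powr (1 + 1 / s)"
proof -
  define N where "N = (\<Sum>\<gamma>\<in>indices q J. (norm (c \<gamma>))\<^sup>2)"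
  have N: "N \<ge> 0" by (simp add: N_def sum_nonneg)
  have hc: "hc_ratio q k ^ n * N
      \<le> ((\<Sum>x\<in>points q J. norm (trig q J c x) powr BH_exponent k) / q ^ card J) powr (1 + 1 / k)"
    if "k \<ge> 2" for k
  proof -
    have "hc_ratio q k ^ n * N = (\<Sum>\<gamma>\<in>indices q J. hc_ratio q k ^ card (sp J \<gamma>) * (norm (c \<gamma>))\<^sup>2)"
      unfolding N_def sum_distrib_left
    proof (intro sum.cong refl)
      fix \<gamma> assume "\<gamma> \<in> indices q J"
      then show "hc_ratio q k ^ n * (norm (c \<gamma>))\<^sup>2 = hc_ratio q k ^ card (sp J \<gamma>) * (norm (c \<gamma>))\<^sup>2"
        using c[of \<gamma>] by (cases "c \<gamma> = 0") auto
    qed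
    then show ?thesis using hypercontractive[OF J q that, of c] by simp
  qed
  show ?thesis
  proof (cases "s = 1")
    case False
    then have s2: "s \<ge> 2" using s by simp
    have "hc_const q s * hc_ratio q s = 1"
      using s2 q by (simp add: hc_const_def hc_ratio_def divide_simps)
    then have "N = hc_const q s ^ n * (hc_ratio q s ^ n * N)"
      by (simp flip: mult.assoc power_mult_distrib)
    also have "\<dots> \<le> hc_const q s ^ n * ((\<Sum>x\<in>points q J. norm (trig q J c x) powr BH_exponent s) / q ^ card J) powr (1 + 1 / s)"
      using hc_const_ge_1[OF s, of q] by (intro mult_left_mono hc s2) auto
    finally show ?thesis by (simp add: N_def)
  next
    case True
    define M where "M = real q ^ card J"
    define E1 where "E1 = (\<Sum>x\<in>points q J. norm (trig q J c x)) / M"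
    define K where "K = 1 + 2 * real q"
    have M: "M > 0" using q by (simp add: M_def)
    have K: "K > 0" by (simp add: K_def)
    have E1: "E1 \<ge> 0" using M by (simp add: E1_def sum_nonneg)
    have E2: "(\<Sum>x\<in>points q J. (norm (trig q J c x))\<^sup>2) / M = N"
      using parseval[OF J, of q c] M by (simp add: N_def M_def)
    \<comment> \<open>The exponent 4/3 is the convex combination of 1 and 2 with weights 2/3 and
      1/3.\<close>
    have "(\<Sum>x\<in>points q J. norm (trig q J c x) powr (4/3))
        = (\<Sum>x\<in>points q J. norm (trig q J c x) powr (2/3) * ((norm (trig q J c x))\<^sup>2) powr (1 - 2/3))"
    proof (intro sum.cong refl)
      fix x
      show "norm (trig q J c x) powr (4/3) = norm (trig q J c x) powr (2/3) * ((norm (trig q J c x))\<^sup>2) powr (1 - 2/3)"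
        by (cases "trig q J c x = 0") (simp_all add: powr_powr flip: powr_numeral powr_add)
    qed
    also have "\<dots> \<le> (\<Sum>x\<in>points q J. norm (trig q J c x)) powr (2/3) * (\<Sum>x\<in>points q J. (norm (trig q J c x))\<^sup>2) powr (1 - 2/3)"
      using J by (intro holder_sum) auto
    also have "\<dots> = (M * E1) powr (2/3) * (M * N) powr (1 - 2/3)"
      using M by (simp add: E1_def flip: E2)
    also have "\<dots> = M * (E1 powr (2/3) * N powr (1/3))"
    proof -
      have "M powr (2/3) * M powr (1/3) = M" using M by (simp flip: powr_add)
      moreover have "(M * E1) powr (2/3) * (M * N) powr (1 - 2/3)
          = (M powr (2/3) * M powr (1/3)) * (E1 powr (2/3) * N powr (1/3))"
        using M E1 N by (simp add: powr_mult mult_ac)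
      ultimately show ?thesis by simp
    qed
    finally have "(\<Sum>x\<in>points q J. norm (trig q J c x) powr (4/3)) / M \<le> E1 powr (2/3) * N powr (1/3)"
      using M by (simp add: pos_divide_le_eq mult.commute)
    then have "((\<Sum>x\<in>points q J. norm (trig q J c x) powr (4/3)) / M) powr (3/2) \<le> (E1 powr (2/3) * N powr (1/3)) powr (3/2)"
      using M by (intro powr_mono2) (auto simp: sum_nonneg)
    also have "\<dots> = E1 * sqrt N"
      using E1 N by (simp add: powr_mult powr_powr powr_half_sqrt)
    finally have "((\<Sum>x\<in>points q J. norm (trig q J c x) powr (4/3)) / M) powr (3/2) \<le> E1 * sqrt N" .
    moreover have h2: "hc_ratio q 2 = 1 / K" by (simp add: hc_ratio_def K_def)
    moreover have b2: "BH_exponent 2 = 4/3" by (simp add: BH_exponent_def)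
    ultimately have "(1 / K) ^ n * N \<le> E1 * sqrt N"
      using hc[of 2, unfolded b2 h2] by (simp add: M_def)
    \<comment> \<open>A factor \<open>sqrt N\<close> cancels and leaves the L^2 norm below K^n times
      the L^1 norm; squaring this accounts for the square in \<open>hc_const q 1\<close>.\<close>
    then have "N / K ^ n \<le> E1 * sqrt N" by (simp add: power_one_over)
    then have le: "sqrt N * sqrt N \<le> (K ^ n * E1) * sqrt N"
      using N K by (simp add: pos_divide_le_eq mult_ac)
    have "sqrt N \<le> K ^ n * E1"
    proof (cases "N = 0")
      case False
      then show ?thesis using N by (intro mult_right_le_imp_le[OF le]) simp
    qed (use K E1 in simp)
    then have "(sqrt N)\<^sup>2 \<le> (K ^ n * E1)\<^sup>2"
      by (intro power_mono) (use N in auto)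
    then have "N \<le> (K\<^sup>2) ^ n * E1\<^sup>2"
      using N by (simp add: power_mult_distrib power2_eq_square mult_ac)
    then show ?thesis
      using True E1 by (simp add: N_def hc_const_def K_def E1_def M_def BH_exponent_def)
  qed
qed

section \<open>Polarization\<close>

text \<open>The sum is the expectation of the polynomial at a random point of the cube whose
  coordinates are, independently, z j with probability t and y j with probability 1 - t. Expanding
  the product over subsets T of J lists the outcomes.\<close>

lemma trig_mixture_le:
  assumes J: "finite J" and x: "y \<in> points q J" "z \<in> points q J" and t: "0 \<le> t" "t \<le> 1"
    and B: "\<And>x. x \<in> points q J \<Longrightarrow> norm (trig q J a x) \<le> B"
  shows "norm (\<Sum>\<alpha>\<in>indices q J. a \<alpha> * (\<Prod>j\<in>J. of_real t * z j ^ \<alpha> j + of_real (1 - t) * y j ^ \<alpha> j)) \<le> B"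
proof -
  define w where "w = (\<lambda>T j. if j \<in> T then z j else y j)"
  have w: "w T \<in> points q J" if "T \<subseteq> J" for T
    using x that by (auto simp: w_def PiE_iff extensional_def)
  have "(\<Prod>j\<in>J. of_real t * z j ^ \<alpha> j + of_real (1 - t) * y j ^ \<alpha> j)
      = (\<Sum>T\<in>Pow J. of_real (t ^ card T * (1 - t) ^ card (J - T)) * mon J \<alpha> (w T))" for \<alpha>
    unfolding prod_add[OF J]
  proof (intro sum.cong refl)
    fix T assume "T \<in> Pow J"
    then have T: "T \<subseteq> J" by simp
    have "mon J \<alpha> (w T) = (\<Prod>j\<in>T. w T j ^ \<alpha> j) * (\<Prod>j\<in>J - T. w T j ^ \<alpha> j)"
      unfolding mon_def by (metis J T mult.commute prod.subset_diff)
    also have "\<dots> = (\<Prod>j\<in>T. z j ^ \<alpha> j) * (\<Prod>j\<in>J - T. y j ^ \<alpha> j)"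
      by (simp add: w_def)
    finally show "(\<Prod>j\<in>T. of_real t * z j ^ \<alpha> j) * (\<Prod>j\<in>J - T. of_real (1 - t) * y j ^ \<alpha> j)
        = of_real (t ^ card T * (1 - t) ^ card (J - T)) * mon J \<alpha> (w T)"
      by (simp add: prod.distrib)
  qed
  then have "(\<Sum>\<alpha>\<in>indices q J. a \<alpha> * (\<Prod>j\<in>J. of_real t * z j ^ \<alpha> j + of_real (1 - t) * y j ^ \<alpha> j))
      = (\<Sum>T\<in>Pow J. of_real (t ^ card T * (1 - t) ^ card (J - T)) * trig q J a (w T))"
    unfolding trig_def by (simp only: sum_distrib_left) (subst sum.swap, simp add: mult_ac)
  also have "norm \<dots> \<le> (\<Sum>T\<in>Pow J. (t ^ card T * (1 - t) ^ card (J - T)) * B)"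
  proof (rule sum_norm_le)
    fix T assume "T \<in> Pow J"
    then show "norm (of_real (t ^ card T * (1 - t) ^ card (J - T)) * trig q J a (w T)) \<le> t ^ card T * (1 - t) ^ card (J - T) * B"
      using t w[of T] unfolding norm_mult norm_of_real by (intro mult_mono B) auto
  qed
  also have "\<dots> = (\<Prod>j\<in>J. t + (1 - t)) * B"
    unfolding prod_add[OF J] sum_distrib_right[symmetric] by simp
  finally show ?thesis by simp
qed

lemma prod_sp: "finite J \<Longrightarrow> (\<And>j. j \<in> J \<Longrightarrow> \<alpha> j = 0 \<Longrightarrow> h j = 1) \<Longrightarrow> (\<Prod>j\<in>J. h j) = (\<Prod>j\<in>sp J \<alpha>. h j)"
  by (rule prod.mono_neutral_right) (auto simp: sp_def)

text \<open>Averaging the mixture over y removes every \<open>y j ^ \<alpha> j\<close> with \<alpha>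
  j nonzero, so each coordinate of the support keeps a factor t. This noise operator serves to
  separate the layers of a polynomial of mixed degree.\<close>

lemma trig_noise_le:
  assumes J: "finite J" and q: "q \<ge> 1" and z: "z \<in> points q J" and t: "0 \<le> t" "t \<le> 1"
    and B: "\<And>x. x \<in> points q J \<Longrightarrow> norm (trig q J a x) \<le> B"
  shows "norm (\<Sum>\<alpha>\<in>indices q J. a \<alpha> * of_real t ^ card (sp J \<alpha>) * mon J \<alpha> z) \<le> B"
proof -
  have avg: "(\<Sum>y\<in>points q J. \<Prod>j\<in>J. of_real t * z j ^ \<alpha> j + of_real (1 - t) * y j ^ \<alpha> j)
      = of_nat (q ^ card J) * (of_real t ^ card (sp J \<alpha>) * mon J \<alpha> z)" if \<alpha>: "\<alpha> \<in> indices q J" for \<alpha>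
  proof -
    have "(\<Sum>y\<in>points q J. \<Prod>j\<in>J. of_real t * z j ^ \<alpha> j + of_real (1 - t) * y j ^ \<alpha> j)
        = (\<Prod>j\<in>J. \<Sum>v\<in>roots_C q. of_real t * z j ^ \<alpha> j + of_real (1 - t) * v ^ \<alpha> j)"
      by (rule sum_prod_PiE[OF J])
    also have "\<dots> = (\<Prod>j\<in>J. of_nat q * (if \<alpha> j = 0 then 1 else of_real t * z j ^ \<alpha> j))"
    proof (intro prod.cong refl)
      fix j assume j: "j \<in> J"
      then have "(\<Sum>v\<in>roots_C q. v ^ \<alpha> j) = (if \<alpha> j = 0 then of_nat q else 0)"
        using sum_roots_power[of "\<alpha> j" q 0] \<alpha> q by (auto simp: PiE_iff)
      then show "(\<Sum>v\<in>roots_C q. of_real t * z j ^ \<alpha> j + of_real (1 - t) * v ^ \<alpha> j)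
          = of_nat q * (if \<alpha> j = 0 then 1 else of_real t * z j ^ \<alpha> j)"
        unfolding sum.distrib sum_distrib_left[symmetric] using q by (auto simp: card_roots algebra_simps)
    qed
    also have "\<dots> = of_nat (q ^ card J) * (\<Prod>j\<in>sp J \<alpha>. of_real t * z j ^ \<alpha> j)"
    proof -
      have "(\<Prod>j\<in>J. if \<alpha> j = 0 then 1 else of_real t * z j ^ \<alpha> j) = (\<Prod>j\<in>sp J \<alpha>. of_real t * z j ^ \<alpha> j)"
        by (subst prod_sp[OF J, of \<alpha>]) (auto simp: sp_def intro: prod.cong)
      then show ?thesis by (simp add: prod.distrib)
    qed
    also have "\<dots> = of_nat (q ^ card J) * (of_real t ^ card (sp J \<alpha>) * mon J \<alpha> z)"
      using J by (simp add: mon_def prod.distrib prod_sp[OF J, of \<alpha>])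
    finally show ?thesis .
  qed
  have "of_nat (q ^ card J) * (\<Sum>\<alpha>\<in>indices q J. a \<alpha> * of_real t ^ card (sp J \<alpha>) * mon J \<alpha> z)
      = (\<Sum>\<alpha>\<in>indices q J. a \<alpha> * (\<Sum>y\<in>points q J. \<Prod>j\<in>J. of_real t * z j ^ \<alpha> j + of_real (1 - t) * y j ^ \<alpha> j))"
    by (subst sum_distrib_left, intro sum.cong refl) (simp add: avg mult_ac del: of_real_diff)
  also have "\<dots> = (\<Sum>y\<in>points q J. \<Sum>\<alpha>\<in>indices q J. a \<alpha> * (\<Prod>j\<in>J. of_real t * z j ^ \<alpha> j + of_real (1 - t) * y j ^ \<alpha> j))"
    unfolding sum_distrib_left by (rule sum.swap)
  also have "norm \<dots> \<le> (\<Sum>y\<in>points q J. B)"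
    using J z t B by (intro sum_norm_le trig_mixture_le) auto
  finally show ?thesis using q J by (simp add: norm_mult norm_power card_points)
qed

text \<open>With interval length and radius both 1/m, dividing by their powers costs m^k and m^(2k).
  The factor exp 5 is the product of the bounds exp 1 for (1 + s)^m on [0, 1/m] and exp 4 for (1 +
  2/m)^(2m).\<close>

definition pol_const :: "nat \<Rightarrow> nat \<Rightarrow> real" where
  "pol_const m k = exp 5 * (4 * real m + 1) * real m ^ (3 * k)"

text \<open>The coefficient of s^k after each factor \<open>x j ^ \<alpha> j\<close> over the
  support has been replaced by \<open>s * z j ^ \<alpha> j + y j ^ \<alpha> j\<close>; the set T
  records where z was taken.\<close>

definition polar :: "nat \<Rightarrow> nat set \<Rightarrow> ((nat \<Rightarrow> nat) \<Rightarrow> complex) \<Rightarrow> nat \<Rightarrow> (nat \<Rightarrow> complex) \<Rightarrow> (nat \<Rightarrow> complex) \<Rightarrow> complex" where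
  "polar q J a k y z = (\<Sum>\<alpha>\<in>indices q J. a \<alpha> *
     (\<Sum>T | T \<subseteq> sp J \<alpha> \<and> card T = k. (\<Prod>j\<in>T. z j ^ \<alpha> j) * (\<Prod>j\<in>sp J \<alpha> - T. y j ^ \<alpha> j)))"

lemma norm_polar_le:
  assumes J: "finite J" and x: "y \<in> points q J" "z \<in> points q J" and k: "k \<le> m" and m: "m \<ge> 1"
    and a: "\<And>\<alpha>. \<alpha> \<in> indices q J \<Longrightarrow> card (sp J \<alpha>) \<noteq> m \<Longrightarrow> a \<alpha> = 0"
    and B: "\<And>x. x \<in> points q J \<Longrightarrow> norm (trig q J a x) \<le> B"
  shows "norm (polar q J a k y z) \<le> pol_const m k * B"
proof -
  have B0: "B \<ge> 0" using order_trans[OF norm_ge_zero B[OF x(1)]] .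
  have Q: "norm (\<Sum>i\<le>m. polar q J a i y z * of_real s ^ i) \<le> (1 + s) ^ m * B" if s: "s \<ge> 0" for s :: real
  proof -
    \<comment> \<open>For this t a factor t u + (1 - t) v equals (1 - t)(s u + v). The supports that
      matter all have m elements, so the mixture is (1 - t)^m times the generating polynomial of the
      \<open>polar\<close> terms.\<close>
    define t where "t = s / (1 + s)"
    have t: "0 \<le> t" "t \<le> 1" "1 - t = 1 / (1 + s)" "t = (1 - t) * s" "1 - t > 0"
      using s by (auto simp: t_def field_simps)
    have expand: "(\<Prod>j\<in>sp J \<alpha>. of_real s * z j ^ \<alpha> j + y j ^ \<alpha> j)
        = (\<Sum>i\<le>m. of_real s ^ i * (\<Sum>T | T \<subseteq> sp J \<alpha> \<and> card T = i. (\<Prod>j\<in>T. z j ^ \<alpha> j) * (\<Prod>j\<in>sp J \<alpha> - T. y j ^ \<alpha> j)))"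
      if "card (sp J \<alpha>) = m" for \<alpha>
    proof -
      have "(\<Prod>j\<in>sp J \<alpha>. of_real s * z j ^ \<alpha> j + y j ^ \<alpha> j)
          = (\<Sum>T\<in>Pow (sp J \<alpha>). of_real s ^ card T * ((\<Prod>j\<in>T. z j ^ \<alpha> j) * (\<Prod>j\<in>sp J \<alpha> - T. y j ^ \<alpha> j)))"
        using J by (simp add: prod_add prod.distrib mult.assoc)
      also have "\<dots> = (\<Sum>i\<le>m. \<Sum>T | T \<in> Pow (sp J \<alpha>) \<and> card T = i. of_real s ^ card T * ((\<Prod>j\<in>T. z j ^ \<alpha> j) * (\<Prod>j\<in>sp J \<alpha> - T. y j ^ \<alpha> j)))"
        using J that by (intro sum.group[symmetric]) (auto intro!: card_mono)
      finally show ?thesis by (simp add: sum_distrib_left)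
    qed
    have "(\<Sum>i\<le>m. polar q J a i y z * of_real s ^ i)
        = (\<Sum>\<alpha>\<in>indices q J. a \<alpha> * (\<Sum>i\<le>m. of_real s ^ i * (\<Sum>T | T \<subseteq> sp J \<alpha> \<and> card T = i. (\<Prod>j\<in>T. z j ^ \<alpha> j) * (\<Prod>j\<in>sp J \<alpha> - T. y j ^ \<alpha> j))))"
      unfolding polar_def sum_distrib_left sum_distrib_right
      by (subst sum.swap) (simp add: mult_ac)
    also have "\<dots> = (\<Sum>\<alpha>\<in>indices q J. a \<alpha> * (\<Prod>j\<in>sp J \<alpha>. of_real s * z j ^ \<alpha> j + y j ^ \<alpha> j))"
    proof (intro sum.cong refl)
      fix \<alpha> assume "\<alpha> \<in> indices q J"
      then show "a \<alpha> * (\<Sum>i\<le>m. of_real s ^ i * (\<Sum>T | T \<subseteq> sp J \<alpha> \<and> card T = i. (\<Prod>j\<in>T. z j ^ \<alpha> j) * (\<Prod>j\<in>sp J \<alpha> - T. y j ^ \<alpha> j)))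
          = a \<alpha> * (\<Prod>j\<in>sp J \<alpha>. of_real s * z j ^ \<alpha> j + y j ^ \<alpha> j)"
        using a[of \<alpha>] expand[of \<alpha>] by (cases "card (sp J \<alpha>) = m") auto
    qed
    also have "of_real ((1 - t) ^ m) * \<dots>
        = (\<Sum>\<alpha>\<in>indices q J. a \<alpha> * (\<Prod>j\<in>J. of_real t * z j ^ \<alpha> j + of_real (1 - t) * y j ^ \<alpha> j))"
      unfolding sum_distrib_left
    proof (intro sum.cong refl)
      fix \<alpha> assume \<alpha>: "\<alpha> \<in> indices q J"
      show "of_real ((1 - t) ^ m) * (a \<alpha> * (\<Prod>j\<in>sp J \<alpha>. of_real s * z j ^ \<alpha> j + y j ^ \<alpha> j))
        = a \<alpha> * (\<Prod>j\<in>J. of_real t * z j ^ \<alpha> j + of_real (1 - t) * y j ^ \<alpha> j)"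
      proof (cases "card (sp J \<alpha>) = m")
        case True
        have "(\<Prod>j\<in>J. of_real t * z j ^ \<alpha> j + of_real (1 - t) * y j ^ \<alpha> j)
            = (\<Prod>j\<in>sp J \<alpha>. of_real t * z j ^ \<alpha> j + of_real (1 - t) * y j ^ \<alpha> j)"
          by (rule prod_sp[OF J]) simp
        also have "\<dots> = (\<Prod>j\<in>sp J \<alpha>. of_real (1 - t) * (of_real s * z j ^ \<alpha> j + y j ^ \<alpha> j))"
          by (subst (1) t(4)) (simp add: distrib_left mult.assoc)
        also have "\<dots> = of_real ((1 - t) ^ m) * (\<Prod>j\<in>sp J \<alpha>. of_real s * z j ^ \<alpha> j + y j ^ \<alpha> j)"
          using True by (simp add: prod.distrib)
        finally show ?thesis by (simp add: mult_ac)
      next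
        case False
        then show ?thesis using a[OF \<alpha>] by simp
      qed
    qed
    finally have "norm (of_real ((1 - t) ^ m) * (\<Sum>i\<le>m. polar q J a i y z * of_real s ^ i)) \<le> B"
      using trig_mixture_le[OF J x t(1,2) B] by simp
    then have "(1 - t) ^ m * norm (\<Sum>i\<le>m. polar q J a i y z * of_real s ^ i) \<le> B"
      using t(5) unfolding norm_mult norm_of_real by simp
    then show ?thesis
      using s by (simp add: t(3) power_one_over divide_le_eq mult.commute)
  qed
  \<comment> \<open>On [0, 1/m] the factor (1 + s)^m stays below exp 1; the short interval costs
    only a power of m that is fixed with k.\<close>
  have "norm (polar q J a k y z) * (1 / m) ^ k * (1 / m) ^ (2 * k)
      \<le> (exp 1 * B) * (4 * m + 1) * (1 + 2 * (1 / m)) ^ (2 * m)"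
  proof (rule coeff_le_of_interval_bound[where m = m and c = "\<lambda>i. polar q J a i y z"])
    fix s :: real assume s: "0 \<le> s" "s \<le> 1 / m"
    have "(1 + s) ^ m \<le> exp s ^ m"
      using s by (intro power_mono) auto
    also have "\<dots> = exp (m * s)" by (simp add: exp_of_nat_mult)
    also have "\<dots> \<le> exp 1" using s m by (simp add: field_simps)
    finally have "(1 + s) ^ m * B \<le> exp 1 * B" using B0 by (intro mult_right_mono)
    then show "norm (\<Sum>i\<le>m. polar q J a i y z * of_real s ^ i) \<le> exp 1 * B"
      using Q[OF s(1)] by linarith
  qed (use k in auto)
  also have "\<dots> \<le> (exp 1 * B) * (4 * m + 1) * exp 4"
  proof (intro mult_left_mono)
    have "(1 + 2 * (1 / real m)) ^ (2 * m) \<le> exp (2 * (1 / real m)) ^ (2 * m)"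
      by (intro power_mono) auto
    also have "\<dots> = exp 4" using m by (simp flip: exp_of_nat_mult)
    finally show "(1 + 2 * (1 / real m)) ^ (2 * m) \<le> exp 4" .
  qed (use B0 in auto)
  also have "\<dots> = exp (1 + 4) * (4 * m + 1) * B" by (simp only: exp_add mult_ac)
  finally have "norm (polar q J a k y z) * (1 / real m ^ (3 * k)) \<le> exp 5 * (4 * m + 1) * B"
    by (simp add: power_one_over mult.assoc flip: power_add) 
  then show ?thesis
    using m by (simp add: pol_const_def divide_le_eq mult_ac add.commute)
qed

section \<open>The Bohnenblust--Hille inequality on a layer\<close>

definition level :: "nat \<Rightarrow> nat set \<Rightarrow> nat \<Rightarrow> (nat \<Rightarrow> nat) set" where
  "level q J m = {\<alpha>\<in>indices q J. card (sp J \<alpha>) = m}"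

lemma finite_level [simp]: "finite J \<Longrightarrow> finite (level q J m)"
  by (simp add: level_def)

text \<open>B is any bound on the cube and both sides are p-th powers: in this form the inequality
  applies to polynomials whose coefficients depend on a parameter y and can be summed over
  y.\<close>

definition BH_hom :: "nat \<Rightarrow> nat \<Rightarrow> real \<Rightarrow> bool" where
  "BH_hom q m C \<longleftrightarrow> (\<forall>J a B. finite J \<longrightarrow> (\<forall>x\<in>points q J. norm (trig q J a x) \<le> B) \<longrightarrow>
     (\<forall>\<alpha>\<in>indices q J. card (sp J \<alpha>) \<noteq> m \<longrightarrow> a \<alpha> = 0) \<longrightarrow>
     (\<Sum>\<alpha>\<in>level q J m. norm (a \<alpha>) powr BH_exponent m) \<le> (C * B) powr BH_exponent m)"

lemma BH_homD:
  assumes "BH_hom q m C" "finite J" "\<And>x. x \<in> points q J \<Longrightarrow> norm (trig q J a x) \<le> B"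
    "\<And>\<alpha>. \<alpha> \<in> indices q J \<Longrightarrow> card (sp J \<alpha>) \<noteq> m \<Longrightarrow> a \<alpha> = 0"
  shows "(\<Sum>\<alpha>\<in>level q J m. norm (a \<alpha>) powr BH_exponent m) \<le> (C * B) powr BH_exponent m"
  using assms unfolding BH_hom_def by blast

section \<open>Splitting a multi-index along a subset of its support\<close>

definition join :: "nat set \<Rightarrow> (nat \<Rightarrow> nat) \<Rightarrow> (nat \<Rightarrow> nat) \<Rightarrow> nat \<Rightarrow> nat" where
  "join J \<beta> \<gamma> = (\<lambda>j\<in>J. \<beta> j + \<gamma> j)"

definition part :: "nat set \<Rightarrow> nat set \<Rightarrow> (nat \<Rightarrow> nat) \<Rightarrow> nat \<Rightarrow> nat" where
  "part J T \<alpha> = (\<lambda>j\<in>J. if j \<in> T then \<alpha> j else 0)"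

lemma sp_join: "sp J (join J \<beta> \<gamma>) = sp J \<beta> \<union> sp J \<gamma>"
  by (auto simp: sp_def join_def)

lemma sp_part: "sp J (part J T \<alpha>) = sp J \<alpha> \<inter> T"
  by (auto simp: sp_def part_def)

lemma part_indices: "\<alpha> \<in> indices q J \<Longrightarrow> part J T \<alpha> \<in> indices q J"
  by (fastforce simp: part_def PiE_iff)

lemma join_indices:
  assumes "\<beta> \<in> indices q J" "\<gamma> \<in> indices q J" "sp J \<beta> \<inter> sp J \<gamma> = {}"
  shows "join J \<beta> \<gamma> \<in> indices q J"
proof -
  have "\<beta> j + \<gamma> j < q" if "j \<in> J" for j
  proof -
    have "\<beta> j = 0 \<or> \<gamma> j = 0" using assms(3) that by (auto simp: sp_def)
    then show ?thesis using assms(1,2) that by (auto simp: PiE_iff)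
  qed
  then show ?thesis by (auto simp: join_def PiE_iff)
qed

lemma join_parts:
  assumes "\<alpha> \<in> indices q J"
  shows "join J (part J T \<alpha>) (part J (sp J \<alpha> - T) \<alpha>) = \<alpha>"
proof (rule PiE_ext)
  show "join J (part J T \<alpha>) (part J (sp J \<alpha> - T) \<alpha>) \<in> PiE J (\<lambda>_. UNIV)"
    by (auto simp: join_def)
  show "\<alpha> \<in> PiE J (\<lambda>_. UNIV)" using assms by (auto simp: PiE_iff)
qed (auto simp: join_def part_def sp_def)

lemma part_join:
  assumes "\<beta> \<in> indices q J" "sp J \<beta> \<inter> sp J \<gamma> = {}"
  shows "part J (sp J \<beta>) (join J \<beta> \<gamma>) = \<beta>"
proof (rule PiE_ext)
  show "part J (sp J \<beta>) (join J \<beta> \<gamma>) \<in> PiE J (\<lambda>_. UNIV)" by (auto simp: part_def)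
  show "\<beta> \<in> PiE J (\<lambda>_. UNIV)" using assms by (auto simp: PiE_iff)
qed (use assms in \<open>auto simp: join_def part_def sp_def\<close>)

lemma join_commute: "join J \<beta> \<gamma> = join J \<gamma> \<beta>"
  by (simp add: join_def add.commute)

text \<open>As \<gamma> varies, these are the coefficients of the polynomial in y that multiplies
  \<open>mon J \<beta> z\<close> in \<open>polar\<close>. The value 0 elsewhere lets sums run over
  all of \<open>indices q J\<close>.\<close>

definition slice :: "nat set \<Rightarrow> ((nat \<Rightarrow> nat) \<Rightarrow> complex) \<Rightarrow> nat \<Rightarrow> (nat \<Rightarrow> nat) \<Rightarrow> (nat \<Rightarrow> nat) \<Rightarrow> complex" where
  "slice J a n \<beta> \<gamma> = (if sp J \<beta> \<inter> sp J \<gamma> = {} \<and> card (sp J \<gamma>) = n then a (join J \<beta> \<gamma>) else 0)"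

text \<open>Restricting \<alpha> to T and to the rest of its support matches the pairs (\<alpha>, T)
  with the pairs (\<beta>, \<gamma>) of disjoint supports of sizes k and m - k. Hence
  \<open>polar\<close> is k-homogeneous in z, with coefficients that are (m - k)-homogeneous in
  y.\<close>

lemma polar_eq_trig:
  assumes J: "finite J" and k: "k \<le> m"
    and a: "\<And>\<alpha>. \<alpha> \<in> indices q J \<Longrightarrow> card (sp J \<alpha>) \<noteq> m \<Longrightarrow> a \<alpha> = 0"
  shows "polar q J a k y z
    = trig q J (\<lambda>\<beta>. if card (sp J \<beta>) = k then trig q J (slice J a (m - k) \<beta>) y else 0) z"
proof -
  define h where "h = (\<lambda>\<alpha> T. a \<alpha> * ((\<Prod>j\<in>T. z j ^ \<alpha> j) * (\<Prod>j\<in>sp J \<alpha> - T. y j ^ \<alpha> j)))"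
  define X where "X = (SIGMA \<alpha>:level q J m. {T. T \<subseteq> sp J \<alpha> \<and> card T = k})"
  define Y where "Y = (SIGMA \<beta>:level q J k. {\<gamma>\<in>level q J (m - k). sp J \<beta> \<inter> sp J \<gamma> = {}})"
  have "polar q J a k y z = (\<Sum>\<alpha>\<in>level q J m. \<Sum>T | T \<subseteq> sp J \<alpha> \<and> card T = k. h \<alpha> T)"
    unfolding polar_def sum_distrib_left h_def
    by (rule sum.mono_neutral_right) (use J a in \<open>auto simp: level_def\<close>)
  also have "\<dots> = (\<Sum>(\<alpha>, T)\<in>X. h \<alpha> T)"
    unfolding X_def using J by (intro sum.Sigma) (auto intro: finite_subset[OF _ finite_Pow_iff[THEN iffD2]])
  also have "\<dots> = (\<Sum>(\<beta>, \<gamma>)\<in>Y. a (join J \<beta> \<gamma>) * (mon J \<beta> z * mon J \<gamma> y))"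
  proof (rule sum.reindex_bij_witness[where
        i = "\<lambda>(\<beta>, \<gamma>). (join J \<beta> \<gamma>, sp J \<beta>)" and
        j = "\<lambda>(\<alpha>, T). (part J T \<alpha>, part J (sp J \<alpha> - T) \<alpha>)"])
    fix u assume "u \<in> X"
    then obtain \<alpha> T where u: "u = (\<alpha>, T)" "\<alpha> \<in> indices q J" "card (sp J \<alpha>) = m" "T \<subseteq> sp J \<alpha>" "card T = k"
      by (auto simp: X_def level_def)
    have T: "sp J \<alpha> \<inter> T = T" "sp J \<alpha> \<inter> (sp J \<alpha> - T) = sp J \<alpha> - T" "finite T"
      using u J by (auto intro: finite_subset)
    show "(case (case u of (\<alpha>, T) \<Rightarrow> (part J T \<alpha>, part J (sp J \<alpha> - T) \<alpha>)) of (\<beta>, \<gamma>) \<Rightarrow> (join J \<beta> \<gamma>, sp J \<beta>)) = u"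
      using u by (simp add: join_parts sp_part T)
    show "(case u of (\<alpha>, T) \<Rightarrow> (part J T \<alpha>, part J (sp J \<alpha> - T) \<alpha>)) \<in> Y"
      using u T by (auto simp: Y_def level_def part_indices sp_part card_Diff_subset)
    have "mon J (part J T \<alpha>) z = (\<Prod>j\<in>T. z j ^ \<alpha> j)" if "T \<subseteq> J" for T and z :: "nat \<Rightarrow> complex"
      unfolding mon_def by (rule prod.mono_neutral_cong_right) (use J that in \<open>auto simp: part_def\<close>)
    moreover have "T \<subseteq> J" "sp J \<alpha> - T \<subseteq> J" using u by (auto simp: sp_def)
    ultimately show "(case (case u of (\<alpha>, T) \<Rightarrow> (part J T \<alpha>, part J (sp J \<alpha> - T) \<alpha>)) of (\<beta>, \<gamma>) \<Rightarrow> a (join J \<beta> \<gamma>) * (mon J \<beta> z * mon J \<gamma> y))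
        = (case u of (\<alpha>, T) \<Rightarrow> h \<alpha> T)"
      using u by (auto simp: join_parts h_def)
  next
    fix v assume "v \<in> Y"
    then obtain \<beta> \<gamma> where v: "v = (\<beta>, \<gamma>)" "\<beta> \<in> indices q J" "\<gamma> \<in> indices q J"
      "card (sp J \<beta>) = k" "card (sp J \<gamma>) = m - k" "sp J \<beta> \<inter> sp J \<gamma> = {}"
      by (auto simp: Y_def level_def)
    have "sp J \<gamma> \<union> sp J \<beta> - sp J \<beta> = sp J \<gamma>" using v by auto
    then have "part J (sp J (join J \<beta> \<gamma>) - sp J \<beta>) (join J \<beta> \<gamma>) = \<gamma>"
      using part_join[of \<gamma> J q \<beta>] v by (simp add: sp_join join_commute[of J \<beta>] Int_commute)
    then show "(case (case v of (\<beta>, \<gamma>) \<Rightarrow> (join J \<beta> \<gamma>, sp J \<beta>)) of (\<alpha>, T) \<Rightarrow> (part J T \<alpha>, part J (sp J \<alpha> - T) \<alpha>)) = v"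
      using v by (simp add: part_join)
    show "(case v of (\<beta>, \<gamma>) \<Rightarrow> (join J \<beta> \<gamma>, sp J \<beta>)) \<in> X"
      using v J k by (auto simp: X_def level_def join_indices sp_join card_Un_disjoint)
  qed
  also have "\<dots> = (\<Sum>\<beta>\<in>level q J k. \<Sum>\<gamma> | \<gamma> \<in> level q J (m - k) \<and> sp J \<beta> \<inter> sp J \<gamma> = {}.
      a (join J \<beta> \<gamma>) * (mon J \<beta> z * mon J \<gamma> y))"
    unfolding Y_def using J by (intro sum.Sigma[symmetric]) auto
  also have "\<dots> = (\<Sum>\<beta>\<in>level q J k. trig q J (slice J a (m - k) \<beta>) y * mon J \<beta> z)"
  proof (intro sum.cong refl)
    fix \<beta>
    have "trig q J (slice J a (m - k) \<beta>) y * mon J \<beta> z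
        = (\<Sum>\<gamma>\<in>indices q J. slice J a (m - k) \<beta> \<gamma> * mon J \<gamma> y * mon J \<beta> z)"
      by (simp add: trig_def sum_distrib_right)
    also have "\<dots> = (\<Sum>\<gamma> | \<gamma> \<in> level q J (m - k) \<and> sp J \<beta> \<inter> sp J \<gamma> = {}. a (join J \<beta> \<gamma>) * (mon J \<beta> z * mon J \<gamma> y))"
      by (rule sum.mono_neutral_cong_right) (use J in \<open>auto simp: level_def slice_def\<close>)
    finally show "(\<Sum>\<gamma> | \<gamma> \<in> level q J (m - k) \<and> sp J \<beta> \<inter> sp J \<gamma> = {}. a (join J \<beta> \<gamma>) * (mon J \<beta> z * mon J \<gamma> y))
        = trig q J (slice J a (m - k) \<beta>) y * mon J \<beta> z" ..
  qed
  also have "\<dots> = trig q J (\<lambda>\<beta>. if card (sp J \<beta>) = k then trig q J (slice J a (m - k) \<beta>) y else 0) z"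
    unfolding trig_def[of q J "\<lambda>\<beta>. if _ \<beta> then _ \<beta> else _"]
    by (rule sum.mono_neutral_cong_left) (use J in \<open>auto simp: level_def\<close>)
  finally show ?thesis .
qed

text \<open>For each y the degree-s inequality in z bounds the p-norm over \<beta> of the values f
  \<beta> y, uniformly in y. Averaging over y and exchanging the sums leaves the L^p norms of the f
  \<beta>, which control the l^2 norms of their coefficients by hypercontractivity.\<close>

lemma BH_mixed_norm:
  assumes q: "q \<ge> 1" and s: "1 \<le> s" "s \<le> m" and C: "BH_hom q s C"  "C \<ge> 0"
    and J: "finite J"
    and a: "\<And>\<alpha>. \<alpha> \<in> indices q J \<Longrightarrow> card (sp J \<alpha>) \<noteq> m \<Longrightarrow> a \<alpha> = 0"
    and B: "\<And>x. x \<in> points q J \<Longrightarrow> norm (trig q J a x) \<le> B"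
  shows "(\<Sum>\<beta>\<in>level q J s. (\<Sum>\<gamma>\<in>indices q J. (norm (slice J a (m - s) \<beta> \<gamma>))\<^sup>2) powr (BH_exponent s / 2))
    \<le> (sqrt (hc_const q s) ^ (m - s) * C * pol_const m s * B) powr BH_exponent s"
proof -
  define p where "p = BH_exponent s"
  define M where "M = real q ^ card J"
  define K where "K = hc_const q s ^ (m - s)"
  define f where "f = (\<lambda>\<beta>. trig q J (slice J a (m - s) \<beta>))"
  have p: "p > 0" "(1 + 1 / s) * (p / 2) = 1"
    using s BH_exponent_mult[of s] by (simp_all add: p_def BH_exponent_pos mult.commute)
  have M: "M > 0" using q by (simp add: M_def)
  have K: "K \<ge> 0" using hc_const_ge_1[OF s(1), of q] by (simp add: K_def)
  obtain x where "x \<in> points q J" using points_nonempty[of q J] q by auto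
  then have B0: "B \<ge> 0" using order_trans[OF norm_ge_zero B] by blast
  have pc: "pol_const m s \<ge> 0" by (simp add: pol_const_def)
  have "(\<Sum>\<beta>\<in>level q J s. (\<Sum>\<gamma>\<in>indices q J. (norm (slice J a (m - s) \<beta> \<gamma>))\<^sup>2) powr (p / 2))
      \<le> (\<Sum>\<beta>\<in>level q J s. K powr (p / 2) * ((\<Sum>y\<in>points q J. norm (f \<beta> y) powr p) / M))"
  proof (rule sum_mono)
    fix \<beta>
    have "(\<Sum>\<gamma>\<in>indices q J. (norm (slice J a (m - s) \<beta> \<gamma>))\<^sup>2)
        \<le> K * ((\<Sum>y\<in>points q J. norm (f \<beta> y) powr p) / M) powr (1 + 1 / s)"
      unfolding K_def f_def p_def M_def
      by (intro hypercontractive_level J q s) (auto simp: slice_def split: if_splits)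
    then have "(\<Sum>\<gamma>\<in>indices q J. (norm (slice J a (m - s) \<beta> \<gamma>))\<^sup>2) powr (p / 2)
        \<le> (K * ((\<Sum>y\<in>points q J. norm (f \<beta> y) powr p) / M) powr (1 + 1 / s)) powr (p / 2)"
      using p by (intro powr_mono2) (auto simp: sum_nonneg)
    also have "\<dots> = K powr (p / 2) * ((\<Sum>y\<in>points q J. norm (f \<beta> y) powr p) / M)"
    proof -
      have "(K * X powr (1 + 1 / s)) powr (p / 2) = K powr (p / 2) * X" if "X \<ge> 0" for X
        unfolding powr_mult powr_powr p(2) using that by simp
      then show ?thesis using M by (simp add: sum_nonneg)
    qed
    finally show "(\<Sum>\<gamma>\<in>indices q J. (norm (slice J a (m - s) \<beta> \<gamma>))\<^sup>2) powr (p / 2) \<le> \<dots>" .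
  qed
  also have "\<dots> = K powr (p / 2) * ((\<Sum>y\<in>points q J. \<Sum>\<beta>\<in>level q J s. norm (f \<beta> y) powr p) / M)"
    by (subst sum.swap) (simp add: sum_divide_distrib sum_distrib_left)
  also have "\<dots> \<le> K powr (p / 2) * ((\<Sum>y\<in>points q J. (C * (pol_const m s * B)) powr p) / M)"
  proof (intro mult_left_mono divide_right_mono sum_mono)
    fix y assume y: "y \<in> points q J"
    have "(\<Sum>\<beta>\<in>level q J s. norm (f \<beta> y) powr p)
        = (\<Sum>\<beta>\<in>level q J s. norm (if card (sp J \<beta>) = s then f \<beta> y else 0) powr p)"
      by (intro sum.cong) (auto simp: level_def)
    also have "\<dots> \<le> (C * (pol_const m s * B)) powr p"
      unfolding p_def
    proof (rule BH_homD[OF C(1) J])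
      fix z assume z: "z \<in> points q J"
      have "trig q J (\<lambda>\<beta>. if card (sp J \<beta>) = s then f \<beta> y else 0) z = polar q J a s y z"
        unfolding f_def by (rule polar_eq_trig[OF J s(2) a, symmetric])
      then show "norm (trig q J (\<lambda>\<beta>. if card (sp J \<beta>) = s then f \<beta> y else 0) z) \<le> pol_const m s * B"
        using s norm_polar_le[OF J y z s(2) _ a B] by simp
    qed auto
    finally show "(\<Sum>\<beta>\<in>level q J s. norm (f \<beta> y) powr p) \<le> (C * (pol_const m s * B)) powr p" .
  qed (use M in auto)
  also have "\<dots> = K powr (p / 2) * (C * (pol_const m s * B)) powr p"
    using q J by (simp add: card_points M_def)
  also have "K powr (p / 2) = (sqrt (hc_const q s) ^ (m - s)) powr p"
  proof -
    have "sqrt (hc_const q s) ^ (m - s) = K powr (1 / 2)"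
      using K by (simp add: K_def real_sqrt_power powr_half_sqrt)
    then show ?thesis by (simp add: powr_powr)
  qed
  also have "(sqrt (hc_const q s) ^ (m - s)) powr p * (C * (pol_const m s * B)) powr p
      = (sqrt (hc_const q s) ^ (m - s) * (C * (pol_const m s * B))) powr p"
    using hc_const_ge_1[OF s(1), of q] C pc B0 by (simp add: powr_mult)
  finally show ?thesis by (simp add: p_def mult.assoc)
qed

lemma ex_partition_card:
  fixes s :: "nat \<Rightarrow> nat"
  assumes "finite S" "(\<Sum>i<r. s i) = card S"
  shows "\<exists>b. (\<forall>j\<in>S. b j < r) \<and> (\<forall>i<r. card {j\<in>S. b j = i} = s i)"
  using assms
proof (induction r arbitrary: S)
  case 0
  then show ?case by simp
next
  case (Suc r)
  then have "s r \<le> card S" by simp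
  then obtain T where T: "T \<subseteq> S" "card T = s r" "finite T"
    using obtain_subset_with_card_n by metis
  have "(\<Sum>i<r. s i) = card (S - T)"
    using Suc.prems T by (simp add: card_Diff_subset)
  then obtain b where b: "\<forall>j\<in>S - T. b j < r" "\<forall>i<r. card {j \<in> S - T. b j = i} = s i"
    using Suc.IH[of "S - T"] Suc.prems by auto
  define b' where "b' = (\<lambda>j. if j \<in> T then r else b j)"
  have "{j\<in>S. b' j = r} = T" using T b(1) by (auto simp: b'_def)
  moreover have "{j\<in>S. b' j = i} = {j\<in>S - T. b j = i}" if "i < r" for i
    using that by (auto simp: b'_def)
  moreover have "\<forall>j\<in>S. b' j < Suc r" using b(1) by (force simp: b'_def)
  ultimately show ?case using T b(2) by (intro exI[of _ b']) (auto simp: less_Suc_eq)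
qed

text \<open>Blei's inequality combines the mixed norms of the blocks without loss, so D only has to
  dominate the worst block and the number r of blocks does not enter.\<close>

lemma BH_hom_blocks:
  fixes s :: "nat \<Rightarrow> nat"
  assumes q: "q \<ge> 1" and s: "\<And>i. i < r \<Longrightarrow> s i \<ge> 1" "(\<Sum>i<r. s i) = m" and m: "m \<ge> 1"
    and C: "\<And>i. i < r \<Longrightarrow> BH_hom q (s i) (C i)" "\<And>i. i < r \<Longrightarrow> C i \<ge> 0" and D: "D > 0"
    and le: "\<And>i. i < r \<Longrightarrow> sqrt (hc_const q (s i)) ^ (m - s i) * C i * pol_const m (s i) \<le> D"
  shows "BH_hom q m D"
  unfolding BH_hom_def
proof (intro allI impI)
  fix J a B
  assume J: "finite J" and B': "\<forall>x\<in>points q J. norm (trig q J a x) \<le> B"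
    and a': "\<forall>\<alpha>\<in>indices q J. card (sp J \<alpha>) \<noteq> m \<longrightarrow> a \<alpha> = 0"
  have B: "\<And>x. x \<in> points q J \<Longrightarrow> norm (trig q J a x) \<le> B" using B' by blast
  have a: "\<And>\<alpha>. \<alpha> \<in> indices q J \<Longrightarrow> card (sp J \<alpha>) \<noteq> m \<Longrightarrow> a \<alpha> = 0" using a' by blast
  have coeff: "norm (a \<alpha>) \<le> B" if "\<alpha> \<in> indices q J" for \<alpha>
    using norm_coeff_le[OF J _ that B] q by simp
  obtain x where "x \<in> points q J" using points_nonempty[of q J] q by auto
  then have B0: "B \<ge> 0" using order_trans[OF norm_ge_zero B] by blast
  have p: "BH_exponent m > 0" using m by (simp add: BH_exponent_pos)
  show "(\<Sum>\<alpha>\<in>level q J m. norm (a \<alpha>) powr BH_exponent m) \<le> (D * B) powr BH_exponent m"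
  proof (cases "B = 0")
    case True
    then have "(\<Sum>\<alpha>\<in>level q J m. norm (a \<alpha>) powr BH_exponent m) = 0"
      using coeff by (intro sum.neutral) (auto simp: level_def)
    then show ?thesis by simp
  next
    case False
    then have DB: "D * B > 0" using B0 D by simp
    \<comment> \<open>Blei's inequality asks for strictly positive entries, hence the restriction to
      nonzero coefficients; dividing them by D B normalises every mixed norm to at most 1.\<close>
    define U where "U = {\<alpha>\<in>level q J m. a \<alpha> \<noteq> 0}"
    define b where "b = (\<lambda>\<alpha>. norm (a \<alpha>) / (D * B))"
    have sle: "s i \<le> m" if "i < r" for i
      unfolding s(2)[symmetric] by (rule member_le_sum) (use that in auto)
    \<comment> \<open>An arbitrary partition is chosen for each support. Partitions of different
      supports may be unrelated, since what matters is that the pieces jointly determine the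
      index.\<close>
    define blk where "blk = (\<lambda>S::nat set. SOME h. (\<forall>j\<in>S. h j < r) \<and> (\<forall>i<r. card {j\<in>S. h j = i} = s i))"
    have blk: "\<forall>j\<in>sp J \<alpha>. blk (sp J \<alpha>) j < r" "\<And>i. i < r \<Longrightarrow> card {j\<in>sp J \<alpha>. blk (sp J \<alpha>) j = i} = s i"
      if "\<alpha> \<in> level q J m" for \<alpha>
    proof -
      have "(\<Sum>i<r. s i) = card (sp J \<alpha>)" using that s(2) by (simp add: level_def)
      from someI_ex[OF ex_partition_card[OF finite_sp[OF J] this]]
      show "\<forall>j\<in>sp J \<alpha>. blk (sp J \<alpha>) j < r" "\<And>i. i < r \<Longrightarrow> card {j\<in>sp J \<alpha>. blk (sp J \<alpha>) j = i} = s i"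
        unfolding blk_def by blast+
    qed
    define T where "T = (\<lambda>i \<alpha>. {j\<in>sp J \<alpha>. blk (sp J \<alpha>) j = i})"
    define P where "P = (\<lambda>i \<alpha>. part J (T i \<alpha>) \<alpha>)"
    have spP: "sp J (P i \<alpha>) = T i \<alpha>" for i \<alpha>
      by (auto simp: P_def sp_part T_def)
    have cardT: "card (T i \<alpha>) = s i" if "i < r" "\<alpha> \<in> level q J m" for i \<alpha>
      using blk(2)[OF that(2,1)] by (simp add: T_def)
    have "(\<Sum>\<alpha>\<in>U. b \<alpha> powr BH_exponent m) \<le> 1"
    proof (rule blei_blocks[where r = r and s = s and P = P and V = "\<lambda>i. level q J (s i)"])
      show "finite U" using J by (simp add: U_def)
      show "b \<alpha> > 0" if "\<alpha> \<in> U" for \<alpha> using that DB by (simp add: U_def b_def)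
      show "s i > 0" if "i < r" for i using s(1)[OF that] by simp
      show "(\<Sum>i<r. s i) = m" by fact
      show "m > 0" using m by simp
      show "finite (level q J (s i))" for i using J by simp
      show "P i \<alpha> \<in> level q J (s i)" if "i < r" "\<alpha> \<in> U" for i \<alpha>
      proof -
        have "P i \<alpha> \<in> indices q J"
          unfolding P_def by (rule part_indices) (use that in \<open>simp add: U_def level_def\<close>)
        then show ?thesis using that cardT[of i \<alpha>] by (simp add: level_def spP U_def)
      qed
      show "\<alpha> = \<alpha>'" if U: "\<alpha> \<in> U" "\<alpha>' \<in> U" and eq: "\<And>i. i < r \<Longrightarrow> P i \<alpha> = P i \<alpha>'" for \<alpha> \<alpha>'
      proof -
        \<comment> \<open>Each coordinate of the support lies in exactly one block, so an index is
          the sum of its pieces.\<close>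
        have sum: "\<alpha> j = (\<Sum>i<r. P i \<alpha> j)" if "\<alpha> \<in> U" "j \<in> J" for \<alpha> j
        proof (cases "\<alpha> j = 0")
          case True
          then show ?thesis using that by (simp add: P_def part_def)
        next
          case False
          then have j: "j \<in> sp J \<alpha>" using that by (simp add: sp_def)
          then have "blk (sp J \<alpha>) j < r" using blk(1)[of \<alpha>] that by (auto simp: U_def)
          moreover have "P i \<alpha> j = (if i = blk (sp J \<alpha>) j then \<alpha> j else 0)" for i
            using j that by (auto simp: P_def part_def T_def)
          ultimately show ?thesis by simp
        qed
        have "\<alpha> j = \<alpha>' j" if "j \<in> J" for j
          using sum[OF U(1) that] sum[OF U(2) that] eq by simp
        then show ?thesis
          using U by (intro PiE_ext[of \<alpha> J "\<lambda>_. {0..<q}" \<alpha>']) (auto simp: U_def level_def)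
      qed
      show "(\<Sum>\<beta>\<in>level q J (s i). (\<Sum>\<alpha> | \<alpha> \<in> U \<and> P i \<alpha> = \<beta>. (b \<alpha>)\<^sup>2) powr (BH_exponent (s i) / 2)) \<le> 1"
        if i: "i < r" for i
      proof -
        define p where "p = BH_exponent (s i)"
        have p: "p > 0" using s(1)[OF i] by (simp add: p_def BH_exponent_pos)
        define S where "S = (\<lambda>\<beta>. \<Sum>\<gamma>\<in>indices q J. (norm (slice J a (m - s i) \<beta> \<gamma>))\<^sup>2)"
        \<comment> \<open>Within a fibre the index is determined by its part outside the block. The
          slice may also contain indices for which \<beta> is not the chosen i-th piece, so this is
          only an inequality.\<close>
        have fibre: "(\<Sum>\<alpha> | \<alpha> \<in> U \<and> P i \<alpha> = \<beta>. (b \<alpha>)\<^sup>2) \<le> S \<beta> / (D * B)\<^sup>2" for \<beta>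
        proof -
          define R where "R = (\<lambda>\<alpha>. part J (sp J \<alpha> - T i \<alpha>) \<alpha>)"
          define F where "F = {\<alpha>. \<alpha> \<in> U \<and> P i \<alpha> = \<beta>}"
          have F: "join J \<beta> (R \<alpha>) = \<alpha>" "slice J a (m - s i) \<beta> (R \<alpha>) = a \<alpha>" "R \<alpha> \<in> indices q J"
            if "\<alpha> \<in> F" for \<alpha>
          proof -
            have \<alpha>: "\<alpha> \<in> level q J m" "\<alpha> \<in> indices q J" "P i \<alpha> = \<beta>" "card (sp J \<alpha>) = m"
              using that by (auto simp: F_def U_def level_def)
            show j: "join J \<beta> (R \<alpha>) = \<alpha>"
              using join_parts[OF \<alpha>(2), of "T i \<alpha>"] \<alpha>(3) by (simp add: P_def R_def)
            show "R \<alpha> \<in> indices q J" using \<alpha>(2) by (simp add: R_def part_indices)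
            have "sp J \<beta> = T i \<alpha>" using spP[of i \<alpha>] \<alpha>(3) by simp
            moreover have "sp J (R \<alpha>) = sp J \<alpha> - T i \<alpha>" by (auto simp: R_def sp_part)
            moreover have "card (sp J \<alpha> - T i \<alpha>) = m - s i"
              using cardT[OF i \<alpha>(1)] \<alpha>(4) J by (subst card_Diff_subset) (auto simp: T_def)
            ultimately show "slice J a (m - s i) \<beta> (R \<alpha>) = a \<alpha>"
              using j by (simp add: slice_def Diff_disjoint)
          qed
          have "(\<Sum>\<alpha>\<in>F. (norm (a \<alpha>))\<^sup>2) = (\<Sum>\<alpha>\<in>F. (norm (slice J a (m - s i) \<beta> (R \<alpha>)))\<^sup>2)"
            by (intro sum.cong refl) (simp add: F(2))
          also have "\<dots> = (\<Sum>\<gamma>\<in>R ` F. (norm (slice J a (m - s i) \<beta> \<gamma>))\<^sup>2)"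
            by (rule sum.reindex[symmetric, unfolded comp_def]) (metis F(1) inj_onI)
          also have "\<dots> \<le> S \<beta>"
            unfolding S_def using J F(3) by (intro sum_mono2) auto
          finally have "(\<Sum>\<alpha>\<in>F. (norm (a \<alpha>))\<^sup>2) / (D * B)\<^sup>2 \<le> S \<beta> / (D * B)\<^sup>2"
            by (intro divide_right_mono) auto
          then show ?thesis by (simp add: F_def b_def power_divide sum_divide_distrib)
        qed
        have S0: "S \<beta> \<ge> 0" for \<beta> by (simp add: S_def sum_nonneg)
        have "(\<Sum>\<beta>\<in>level q J (s i). (\<Sum>\<alpha> | \<alpha> \<in> U \<and> P i \<alpha> = \<beta>. (b \<alpha>)\<^sup>2) powr (p / 2))
            \<le> (\<Sum>\<beta>\<in>level q J (s i). (S \<beta> / (D * B)\<^sup>2) powr (p / 2))"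
          using p by (intro sum_mono powr_mono2 fibre) (auto simp: sum_nonneg)
        also have "\<dots> = (\<Sum>\<beta>\<in>level q J (s i). S \<beta> powr (p / 2) / (D * B) powr p)"
          using S0 DB by (intro sum.cong refl) (simp add: powr_divide powr_powr flip: powr_numeral)
        also have "\<dots> = (\<Sum>\<beta>\<in>level q J (s i). S \<beta> powr (p / 2)) / (D * B) powr p"
          by (simp add: sum_divide_distrib)
        also have "\<dots> \<le> 1"
        proof -
          have "(\<Sum>\<beta>\<in>level q J (s i). S \<beta> powr (p / 2))
              \<le> (sqrt (hc_const q (s i)) ^ (m - s i) * C i * pol_const m (s i) * B) powr p"
            unfolding S_def p_def
            by (rule BH_mixed_norm[OF q s(1)[OF i] sle[OF i] C(1)[OF i] C(2)[OF i] J a B])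
          also have "\<dots> \<le> (D * B) powr p"
            using p le[OF i] B0 C(2)[OF i] hc_const_ge_1[OF s(1)[OF i], of q]
            by (intro powr_mono2 mult_right_mono) (auto simp: pol_const_def)
          finally show ?thesis using DB by (simp add: divide_le_eq)
        qed
        finally show ?thesis by (simp add: p_def)
      qed
    qed
    then have "(\<Sum>\<alpha>\<in>U. norm (a \<alpha>) powr BH_exponent m) / (D * B) powr BH_exponent m \<le> 1"
      using DB by (simp add: b_def powr_divide sum_divide_distrib)
    then have "(\<Sum>\<alpha>\<in>U. norm (a \<alpha>) powr BH_exponent m) \<le> (D * B) powr BH_exponent m"
      using DB by (subst (asm) pos_divide_le_eq) auto
    moreover have "(\<Sum>\<alpha>\<in>level q J m. norm (a \<alpha>) powr BH_exponent m) = (\<Sum>\<alpha>\<in>U. norm (a \<alpha>) powr BH_exponent m)"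
      using J by (intro sum.mono_neutral_right) (auto simp: U_def)
    ultimately show ?thesis by simp
  qed
qed

text \<open>On the first layer a polynomial is a sum of functions g j of single variables, so one
  point of the cube maximises Re (c g j) in every coordinate at once. The directions c = 1, -1, i,
  -i control the modulus and give the factor 4; the number q - 1 of nonzero exponents is bounded by
  q.\<close>

lemma BH_hom_1:
  assumes q: "q \<ge> 1"
  shows "BH_hom q 1 (4 * q)"
  unfolding BH_hom_def
proof (intro allI impI)
  fix J a B
  assume J: "finite J" and B': "\<forall>x\<in>points q J. norm (trig q J a x) \<le> B"
    and a': "\<forall>\<alpha>\<in>indices q J. card (sp J \<alpha>) \<noteq> 1 \<longrightarrow> a \<alpha> = 0"
  define e where "e = (\<lambda>j b. \<lambda>i\<in>J. if i = j then b else 0::nat)"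
  define g where "g = (\<lambda>j t. \<Sum>b\<in>{1..<q}. a (e j b) * t ^ b)"
  have level: "(\<Sum>\<alpha>\<in>level q J 1. h \<alpha>) = (\<Sum>j\<in>J. \<Sum>b\<in>{1..<q}. h (e j b))" for h :: "_ \<Rightarrow> 'c::comm_monoid_add"
  proof -
    have spe: "sp J (e j b) = {j}" if "j \<in> J" "b \<ge> 1" for j b
      using that by (auto simp: sp_def e_def)
    have e_idx: "e j b \<in> indices q J" if "b < q" for j b
      using that by (auto simp: e_def PiE_iff)
    have "(\<Sum>\<alpha>\<in>level q J 1. h \<alpha>) = (\<Sum>(j, b)\<in>J \<times> {1..<q}. h (e j b))"
    proof (rule sum.reindex_bij_witness[where
        i = "\<lambda>(j, b). e j b" and j = "\<lambda>\<alpha>. (the_elem (sp J \<alpha>), \<alpha> (the_elem (sp J \<alpha>)))"])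
      fix \<alpha> assume \<alpha>: "\<alpha> \<in> level q J 1"
      then obtain j where j: "sp J \<alpha> = {j}" by (auto simp: level_def card_1_singleton_iff)
      have idx: "\<alpha> \<in> indices q J" using \<alpha> by (simp add: level_def)
      have jJ: "j \<in> J" "\<alpha> j \<noteq> 0" and j0: "\<And>i. i \<in> J \<Longrightarrow> i \<noteq> j \<Longrightarrow> \<alpha> i = 0"
        using j unfolding sp_def by blast+
      have "e j (\<alpha> j) = \<alpha>"
      proof (rule PiE_ext[OF e_idx idx])
        show "\<alpha> j < q" using idx jJ by (auto simp: PiE_iff)
      next
        fix i assume "i \<in> J"
        then show "e j (\<alpha> j) i = \<alpha> i" using j0 by (simp add: e_def)
      qed
      then show "(case (the_elem (sp J \<alpha>), \<alpha> (the_elem (sp J \<alpha>))) of (j, b) \<Rightarrow> e j b) = \<alpha>"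
        and "(case (the_elem (sp J \<alpha>), \<alpha> (the_elem (sp J \<alpha>))) of (j, b) \<Rightarrow> h (e j b)) = h \<alpha>"
        by (simp_all add: j)
      show "(the_elem (sp J \<alpha>), \<alpha> (the_elem (sp J \<alpha>))) \<in> J \<times> {1..<q}"
        using j jJ idx by (auto simp: PiE_iff)
    next
      fix v assume "v \<in> J \<times> {1..<q}"
      then obtain j b where v: "v = (j, b)" "j \<in> J" "1 \<le> b" "b < q" by auto
      show "(the_elem (sp J (case v of (j, b) \<Rightarrow> e j b)), (case v of (j, b) \<Rightarrow> e j b) (the_elem (sp J (case v of (j, b) \<Rightarrow> e j b)))) = v"
        using v by (simp add: spe) (simp add: e_def)
      show "(case v of (j, b) \<Rightarrow> e j b) \<in> level q J 1"
        using v e_idx[of b j] by (simp add: level_def spe)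
    qed
    then show ?thesis by (simp add: sum.cartesian_product)
  qed
  have trig: "trig q J a x = (\<Sum>j\<in>J. g j (x j))" for x
  proof -
    have "trig q J a x = (\<Sum>\<alpha>\<in>level q J 1. a \<alpha> * mon J \<alpha> x)"
      unfolding trig_def by (rule sum.mono_neutral_right) (use J a' in \<open>auto simp: level_def\<close>)
    also have "\<dots> = (\<Sum>j\<in>J. \<Sum>b\<in>{1..<q}. a (e j b) * mon J (e j b) x)" by (rule level)
    also have "\<dots> = (\<Sum>j\<in>J. g j (x j))"
    proof -
      have "mon J (e j b) x = x j ^ b" if "j \<in> J" for j b
      proof -
        have "mon J (e j b) x = (\<Prod>i\<in>J. if i = j then x j ^ b else 1)"
          unfolding mon_def by (intro prod.cong) (auto simp: e_def)
        then show ?thesis using J that by simp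
      qed
      then show ?thesis by (simp add: g_def)
    qed
    finally show ?thesis .
  qed
  have rne: "roots_C q \<noteq> {}" using card_roots[of q] q by auto
  have "\<exists>t\<in>roots_C q. \<forall>s\<in>roots_C q. Re (c * g j s) \<le> Re (c * g j t)" for c j
  proof -
    let ?F = "(\<lambda>s. Re (c * g j s)) ` roots_C q"
    have "Max ?F \<in> ?F" using rne by (intro Max_in) auto
    then obtain t where t: "t \<in> roots_C q" "Max ?F = Re (c * g j t)" by blast
    have "Re (c * g j s) \<le> Re (c * g j t)" if "s \<in> roots_C q" for s
      unfolding t(2)[symmetric] using that by (intro Max_ge) auto
    then show ?thesis using t(1) by blast
  qed
  then obtain t where t: "\<And>c j. t c j \<in> roots_C q"
    "\<And>c j s. s \<in> roots_C q \<Longrightarrow> Re (c * g j s) \<le> Re (c * g j (t c j))"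
    by metis
  define M where "M = (\<lambda>c j. Re (c * g j (t c j)))"
  \<comment> \<open>The exponent 0 is absent from g j. Mean zero makes the maxima M c j nonnegative,
    so the larger of two opposite maxima may be replaced by their sum.\<close>
  have mean: "(\<Sum>s\<in>roots_C q. g j s) = 0" for j
  proof -
    have "(\<Sum>s\<in>roots_C q. s ^ b) = 0" if "b \<in> {1..<q}" for b
      using sum_roots_power[of b q 0] that by auto
    then show ?thesis
      unfolding g_def by (subst sum.swap) (simp flip: sum_distrib_left)
  qed
  have M0: "M c j \<ge> 0" for c j
  proof -
    have "0 = Re (c * (\<Sum>s\<in>roots_C q. g j s))" by (simp add: mean)
    also have "\<dots> = (\<Sum>s\<in>roots_C q. Re (c * g j s))" by (simp only: sum_distrib_left Re_sum)
    also have "\<dots> \<le> (\<Sum>s\<in>roots_C q. M c j)" unfolding M_def by (intro sum_mono t)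
    finally show ?thesis using q by (simp add: card_roots zero_le_mult_iff)
  qed
  have MB: "(\<Sum>j\<in>J. M c j) \<le> B" if "norm c = 1" for c
  proof -
    define x where "x = (\<lambda>j\<in>J. t c j)"
    have x: "x \<in> points q J" using t(1) by (auto simp: x_def)
    have "(\<Sum>j\<in>J. M c j) = Re (c * trig q J a x)"
      unfolding trig sum_distrib_left Re_sum M_def by (intro sum.cong) (auto simp: x_def)
    also have "\<dots> \<le> norm (c * trig q J a x)" by (rule complex_Re_le_cmod)
    also have "\<dots> \<le> B" using B' x that by (simp add: norm_mult)
    finally show ?thesis .
  qed
  define N where "N = (\<lambda>j. M 1 j + M (-1) j + M \<i> j + M (-\<i>) j)"
  have gN: "norm (g j s) \<le> N j" if "s \<in> roots_C q" for j s
  proof -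
    have "\<bar>Re (g j s)\<bar> \<le> M 1 j + M (-1) j"
      using t(2)[OF that, of 1 j] t(2)[OF that, of "-1" j] M0[of 1 j] M0[of "-1" j] by (simp add: M_def)
    moreover have "\<bar>Im (g j s)\<bar> \<le> M \<i> j + M (-\<i>) j"
      using t(2)[OF that, of \<i> j] t(2)[OF that, of "-\<i>" j] M0[of \<i> j] M0[of "-\<i>" j] by (simp add: M_def)
    ultimately show ?thesis using cmod_le[of "g j s"] by (simp add: N_def)
  qed
  have aN: "norm (a (e j b)) \<le> N j" if b: "b \<in> {1..<q}" for j b
  proof -
    have "(\<Sum>s\<in>roots_C q. g j s * cnj s ^ b) = (\<Sum>b'\<in>{1..<q}. a (e j b') * (\<Sum>s\<in>roots_C q. s ^ b' * cnj s ^ b))"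
      unfolding g_def sum_distrib_right sum_distrib_left by (subst sum.swap) (simp add: mult.assoc)
    also have "\<dots> = (\<Sum>b'\<in>{1..<q}. if b' = b then a (e j b') * of_nat q else 0)"
      using b by (intro sum.cong refl) (auto simp: sum_roots_power)
    also have "\<dots> = a (e j b) * of_nat q" using b by simp
    finally have "q * norm (a (e j b)) = norm (\<Sum>s\<in>roots_C q. g j s * cnj s ^ b)"
      by (simp add: norm_mult)
    also have "\<dots> \<le> (\<Sum>s\<in>roots_C q. N j)"
      using gN by (intro sum_norm_le) (simp add: norm_mult norm_power norm_roots)
    finally show ?thesis using q by (simp add: card_roots)
  qed
  have N: "(\<Sum>j\<in>J. N j) \<le> 4 * B"
    using MB[of 1] MB[of "-1"] MB[of \<i>] MB[of "-\<i>"] by (simp add: N_def sum.distrib)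
  have N0: "N j \<ge> 0" for j using M0 by (simp add: N_def)
  have "(\<Sum>\<alpha>\<in>level q J 1. norm (a \<alpha>)) = (\<Sum>j\<in>J. \<Sum>b\<in>{1..<q}. norm (a (e j b)))"
    by (rule level)
  also have "\<dots> \<le> (\<Sum>j\<in>J. \<Sum>b\<in>{1..<q}. N j)"
    by (intro sum_mono aN)
  also have "\<dots> \<le> (\<Sum>j\<in>J. q * N j)"
    using N0 by (intro sum_mono) (auto intro!: mult_right_mono)
  also have "\<dots> = q * (\<Sum>j\<in>J. N j)" by (simp add: sum_distrib_left)
  also have "\<dots> \<le> q * (4 * B)" using N by (intro mult_left_mono) auto
  finally have main: "(\<Sum>\<alpha>\<in>level q J 1. norm (a \<alpha>)) \<le> 4 * q * B" by (simp add: mult_ac)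
  have "(\<Sum>\<alpha>\<in>level q J 1. norm (a \<alpha>)) \<ge> 0" by (simp add: sum_nonneg)
  with main show "(\<Sum>\<alpha>\<in>level q J 1. norm (a \<alpha>) powr BH_exponent 1) \<le> (4 * q * B) powr BH_exponent 1"
    by (simp add: BH_exponent_def)
qed

lemma BH_hom_exists:
  assumes q: "q \<ge> 1" and m: "m \<ge> 1"
  shows "\<exists>C>0. BH_hom q m C"
proof -
  define D where "D = sqrt (hc_const q 1) ^ (m - 1) * (4 * q) * pol_const m 1"
  have "hc_const q 1 > 0" using hc_const_ge_1[of 1 q] by simp
  moreover have "pol_const m 1 > 0" using m by (simp add: pol_const_def add_pos_pos)
  ultimately have "D > 0" using q by (simp add: D_def)
  moreover have "BH_hom q m D"
    by (rule BH_hom_blocks[where r = m and s = "\<lambda>_. 1" and C = "\<lambda>_. real (4 * q)"])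
      (use q m BH_hom_1[OF q] \<open>D > 0\<close> in \<open>auto simp: D_def\<close>)
  ultimately show ?thesis by blast
qed

lemma exp_beats_poly:
  fixes x C :: real
  assumes "x > 1"
  shows "eventually (\<lambda>m. C * ((4 * real m + 1) * real m ^ n) \<le> x ^ m) at_top"
proof -
  have "ln x > 0" using assms by simp
  then have "((\<lambda>m. C * ((4 * m + 1) * m ^ n) / exp (m * ln x)) \<longlongrightarrow> 0) at_top"
    by real_asymp
  then have "eventually (\<lambda>m. C * ((4 * m + 1) * m ^ n) / exp (m * ln x) < 1) at_top"
    by (rule order_tendstoD) simp
  then have "eventually (\<lambda>m. C * ((4 * real m + 1) * real m ^ n) / exp (real m * ln x) < 1) at_top"
    using filterlim_real_sequentially by (rule eventually_compose_filterlim)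
  then show ?thesis
  proof eventually_elim
    case (elim m)
    moreover have "exp (real m * ln x) = x ^ m" using assms by (simp add: exp_of_nat_mult)
    ultimately show ?case using assms by (simp add: divide_less_eq)
  qed
qed

lemma BH_hom_subexponential:
  assumes q: "q \<ge> 1" and \<epsilon>: "\<epsilon> > 0"
  shows "eventually (\<lambda>m. BH_hom q m ((1 + \<epsilon>) ^ m)) at_top"
proof -
  \<comment> \<open>For s \<ge> k this makes \<open>hc_const q s\<close> at most 1 + \<epsilon>,
    whose square root is at most 1 + \<epsilon>/2. The gap between 1 + \<epsilon>/2 and 1 +
    \<epsilon> absorbs the polynomial factor.\<close>
  obtain k :: nat where k: "real k \<ge> 2 + 2 * q / \<epsilon>"
    using real_arch_simple by blast
  have "2 * q / \<epsilon> \<ge> 0" using \<epsilon> by simp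
  then have k2: "k \<ge> 2" using k by linarith
  have hc: "sqrt (hc_const q s) \<le> 1 + \<epsilon> / 2" if "s \<ge> k" for s
  proof -
    have "2 * q / \<epsilon> \<le> real s - 1" using k that by linarith
    then have "2 * q \<le> \<epsilon> * (real s - 1)" using \<epsilon> by (simp add: divide_le_eq mult.commute)
    then have "2 * q / (real s - 1) \<le> \<epsilon>"
      using k2 that by (simp add: divide_le_eq)
    then have "hc_const q s \<le> 1 + \<epsilon>" using k2 that by (simp add: hc_const_def)
    also have "\<dots> \<le> (1 + \<epsilon> / 2)\<^sup>2" by (simp add: power2_eq_square algebra_simps)
    finally show ?thesis using \<epsilon> real_le_lsqrt by simp
  qed
  have "\<forall>s. \<exists>C>0. s \<ge> 1 \<longrightarrow> BH_hom q s C" using BH_hom_exists[OF q] by (metis zero_less_one)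
  then obtain Cf where Cf: "\<And>s. Cf s > 0" "\<And>s. s \<ge> 1 \<Longrightarrow> BH_hom q s (Cf s)" by metis
  \<comment> \<open>Once k is fixed only finitely many block sizes occur, so their constants are
    bounded independently of m.\<close>
  define Cm where "Cm = (\<Sum>s\<in>{k..<2*k}. Cf s)"
  have Cm: "Cf s \<le> Cm" if "s \<in> {k..<2*k}" for s
    unfolding Cm_def using that Cf(1) by (intro member_le_sum) (auto simp: less_imp_le)
  define x where "x = (1 + \<epsilon>) / (1 + \<epsilon> / 2)"
  have "x > 1" using \<epsilon> by (simp add: x_def)
  have "eventually (\<lambda>m. (Cm * exp 5) * ((4 * real m + 1) * real m ^ (6 * k)) \<le> x ^ m) at_top"
    by (rule exp_beats_poly) fact
  then show ?thesis
    using eventually_ge_at_top[of k]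
  proof eventually_elim
    case (elim m)
    define r where "r = m div k"
    \<comment> \<open>There are r - 1 blocks of size k and a last one with the remainder, which lies
      in [k, 2k). The default for larger i is the same value, so s stays in this range
      everywhere.\<close>
    define s where "s = (\<lambda>i. if i < r - 1 then k else m - (r - 1) * k)"
    have r: "r \<ge> 1" using elim(2) k2 by (simp add: r_def div_greater_zero_iff Suc_le_eq)
    have rk: "r * k \<le> m" "m < r * k + k"
      using k2 by (auto simp: r_def) (metis add.commute div_mult_mod_eq mod_less_divisor nat_add_left_cancel_less not_less_eq_eq numeral_2_eq_2 le_trans le0 zero_less_Suc less_le_trans)
    have rk': "(r - 1) * k + k = r * k" using r by (metis Suc_diff_1 add.commute less_eq_Suc_le mult_Suc One_nat_def)
    have s: "s i \<in> {k..<2*k}" for i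
      using rk rk' k2 by (auto simp: s_def)
    have m1: "m \<ge> 1" using elim(2) k2 by simp
    show ?case
    proof (rule BH_hom_blocks[OF q, where r = r and s = s and C = "\<lambda>i. Cf (s i)"])
      show "s i \<ge> 1" for i using s[of i] k2 by simp
      then show "BH_hom q (s i) (Cf (s i))" for i using Cf(2) by blast
      show "Cf (s i) \<ge> 0" for i using Cf(1) less_imp_le by blast
      have "(\<Sum>i<r. s i) = (\<Sum>i<Suc (r - 1). s i)" using r by simp
      also have "\<dots> = (r - 1) * k + (m - (r - 1) * k)" by (simp add: s_def)
      also have "\<dots> = m" using rk rk' by simp
      finally show "(\<Sum>i<r. s i) = m" .
      show "m \<ge> 1" by fact
      show "(1 + \<epsilon>) ^ m > 0" using \<epsilon> by simp
      fix i
      have h0: "0 \<le> sqrt (hc_const q (s i))" using hc_const_ge_1[of "s i" q] s[of i] k2 by simp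
      have "sqrt (hc_const q (s i)) ^ (m - s i) \<le> (1 + \<epsilon> / 2) ^ (m - s i)"
        using hc[of "s i"] s[of i] h0 by (intro power_mono) auto
      also have "\<dots> \<le> (1 + \<epsilon> / 2) ^ m" using \<epsilon> by (intro power_increasing) auto
      finally have 1: "sqrt (hc_const q (s i)) ^ (m - s i) \<le> (1 + \<epsilon> / 2) ^ m" .
      have 2: "pol_const m (s i) \<le> exp 5 * (4 * real m + 1) * real m ^ (6 * k)"
        unfolding pol_const_def using m1 s[of i] by (intro mult_left_mono power_increasing) auto
      have "sqrt (hc_const q (s i)) ^ (m - s i) * Cf (s i) * pol_const m (s i)
          \<le> (1 + \<epsilon> / 2) ^ m * Cm * (exp 5 * (4 * real m + 1) * real m ^ (6 * k))"
        using 1 2 Cm[OF s] Cf(1)[of "s i"] h0 \<epsilon>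
        by (intro mult_mono mult_nonneg_nonneg) (auto simp: pol_const_def Cm_def intro!: sum_nonneg less_imp_le[OF Cf(1)])
      also have "\<dots> = (1 + \<epsilon> / 2) ^ m * ((Cm * exp 5) * ((4 * real m + 1) * real m ^ (6 * k)))"
        by (simp add: mult_ac)
      also have "\<dots> \<le> (1 + \<epsilon> / 2) ^ m * x ^ m"
        using elim(1) \<epsilon> by (intro mult_left_mono) auto
      also have "\<dots> = (1 + \<epsilon>) ^ m"
        using \<epsilon> by (simp add: x_def flip: power_mult_distrib)
      finally show "sqrt (hc_const q (s i)) ^ (m - s i) * Cf (s i) * pol_const m (s i) \<le> (1 + \<epsilon>) ^ m" .
    qed
  qed
qed

section \<open>Layers and random signs\<close>

lemma card_level:
  assumes J: "finite J" and q: "q \<ge> 1"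
  shows "card (level q J d) = (card J choose d) * (q - 1) ^ d"
proof -
  define F where "F = (\<lambda>S. PiE J (\<lambda>j. if j \<in> S then {1..<q} else {0}))"
  have "level q J d = (\<Union>S\<in>{S. S \<subseteq> J \<and> card S = d}. F S)"
  proof (intro equalityI subsetI)
    fix \<alpha> assume \<alpha>: "\<alpha> \<in> level q J d"
    then have "\<alpha> \<in> F (sp J \<alpha>)"
      by (auto simp: F_def sp_def level_def PiE_iff Suc_le_eq)
    moreover have "sp J \<alpha> \<subseteq> J" "card (sp J \<alpha>) = d" using \<alpha> by (auto simp: sp_def level_def)
    ultimately show "\<alpha> \<in> (\<Union>S\<in>{S. S \<subseteq> J \<and> card S = d}. F S)" by blast
  next
    fix \<alpha> assume "\<alpha> \<in> (\<Union>S\<in>{S. S \<subseteq> J \<and> card S = d}. F S)"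
    then obtain S where S: "S \<subseteq> J" "card S = d" "\<alpha> \<in> F S" by blast
    have "\<alpha> j \<in> (if j \<in> S then {1..<q} else {0})" if "j \<in> J" for j
      using S(3) that by (auto simp: F_def PiE_iff)
    then have *: "(j \<in> S \<longrightarrow> 1 \<le> \<alpha> j \<and> \<alpha> j < q) \<and> (j \<notin> S \<longrightarrow> \<alpha> j = 0)" if "j \<in> J" for j
      using that by (metis atLeastLessThan_iff singletonD)
    have "j \<in> S \<longleftrightarrow> \<alpha> j \<noteq> 0" if "j \<in> J" for j using *[OF that] by (cases "j \<in> S") auto
    then have "sp J \<alpha> = S" using S(1) by (auto simp: sp_def)
    moreover have "\<alpha> \<in> indices q J"
    proof -
      have "\<alpha> j < q" if "j \<in> J" for j using *[OF that] q by (cases "j \<in> S") auto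
      then show ?thesis using S(3) by (simp add: F_def PiE_iff)
    qed
    ultimately show "\<alpha> \<in> level q J d" using S(2) by (simp add: level_def)
  qed
  also have "card \<dots> = (\<Sum>S | S \<subseteq> J \<and> card S = d. card (F S))"
  proof (rule card_UN_disjoint)
    show "finite {S. S \<subseteq> J \<and> card S = d}" using J by simp
    show "\<forall>S\<in>{S. S \<subseteq> J \<and> card S = d}. finite (F S)"
      using J by (auto simp: F_def intro!: finite_PiE)
    have "S = {j\<in>J. \<alpha> j \<noteq> 0}" if "\<alpha> \<in> F S" "S \<subseteq> J" for \<alpha> S
      using that by (fastforce simp: F_def PiE_iff split: if_splits)
    then show "\<forall>S\<in>{S. S \<subseteq> J \<and> card S = d}. \<forall>T\<in>{S. S \<subseteq> J \<and> card S = d}. S \<noteq> T \<longrightarrow> F S \<inter> F T = {}"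
      by blast
  qed
  also have "\<dots> = (\<Sum>S | S \<subseteq> J \<and> card S = d. (q - 1) ^ d)"
  proof (intro sum.cong refl)
    fix S assume "S \<in> {S. S \<subseteq> J \<and> card S = d}"
    then have S: "S \<subseteq> J" "card S = d" by auto
    have "card (F S) = (\<Prod>j\<in>J. if j \<in> S then q - 1 else 1)"
      unfolding F_def using J by (subst card_PiE) (auto intro!: prod.cong)
    also have "\<dots> = (\<Prod>j\<in>S. q - 1)"
      using J S by (intro prod.mono_neutral_cong_right) auto
    finally show "card (F S) = (q - 1) ^ d" using S by simp
  qed
  finally show ?thesis using n_subsets[OF J, of d] by simp
qed

section \<open>Exponential moments of sums of random signs\<close>

lemma cosh_le_exp_square: "(exp u + exp (- u)) / 2 \<le> exp (u\<^sup>2 / 2)" for u :: real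
proof -
  have "(\<lambda>n. (\<lambda>n. if even n then u ^ n /\<^sub>R fact n else 0) (2 * n)) sums cosh u"
    by (subst sums_mono_reindex) (auto simp: strict_mono_def cosh_converges elim!: evenE)
  then have "(\<lambda>n. u ^ (2 * n) / fact (2 * n)) sums cosh u"
    by (simp add: divide_inverse mult.commute)
  moreover have "(\<lambda>n. (u\<^sup>2 / 2) ^ n / fact n) sums exp (u\<^sup>2 / 2)"
  proof -
    have "(\<lambda>n. v ^ n / fact n) sums exp v" for v :: real
      using exp_converges[of v] by (simp add: divide_inverse mult.commute)
    then show ?thesis .
  qed
  moreover have "u ^ (2 * n) / fact (2 * n) \<le> (u\<^sup>2 / 2) ^ n / fact n" for n
  proof -
    \<comment> \<open>Termwise comparison of the two power series comes down to this
      inequality.\<close>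
    have "(2::real) ^ n * fact n \<le> fact (2 * n)"
    proof (induction n)
      case (Suc n)
      have "(2::real) ^ Suc n * fact (Suc n) = (2 * real n + 2) * (2 ^ n * fact n)"
        by (simp add: algebra_simps)
      also have "\<dots> \<le> (2 * real n + 2) * ((2 * real n + 1) * fact (2 * n))"
      proof (intro mult_left_mono)
        have "(2::real) ^ n * fact n \<le> 1 * fact (2 * n)" using Suc by simp
        also have "\<dots> \<le> (2 * real n + 1) * fact (2 * n)" by (intro mult_right_mono) auto
        finally show "(2::real) ^ n * fact n \<le> (2 * real n + 1) * fact (2 * n)" .
      qed simp
      also have "\<dots> = fact (2 * Suc n)" by (simp add: algebra_simps)
      finally show ?case .
    qed simp
    then have "u ^ (2 * n) / fact (2 * n) \<le> u ^ (2 * n) / (2 ^ n * fact n)"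
      by (intro divide_left_mono) auto
    also have "\<dots> = (u\<^sup>2 / 2) ^ n / fact n"
      unfolding power_divide power_mult by simp
    finally show ?thesis .
  qed
  ultimately have "cosh u \<le> exp (u\<^sup>2 / 2)" by (rule sums_le[rotated])
  then show ?thesis by (simp add: cosh_def)
qed

lemma sum_exp_signs:
  fixes c :: "'a \<Rightarrow> real"
  assumes "finite U"
  shows "(\<Sum>\<epsilon>\<in>PiE U (\<lambda>_. {-1, 1}). exp (\<Sum>\<alpha>\<in>U. \<epsilon> \<alpha> * c \<alpha>)) \<le> 2 ^ card U * exp ((\<Sum>\<alpha>\<in>U. (c \<alpha>)\<^sup>2) / 2)"
proof -
  have "(\<Sum>\<epsilon>\<in>PiE U (\<lambda>_. {-1, 1::real}). exp (\<Sum>\<alpha>\<in>U. \<epsilon> \<alpha> * c \<alpha>))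
      = (\<Sum>\<epsilon>\<in>PiE U (\<lambda>_. {-1, 1}). \<Prod>\<alpha>\<in>U. exp (\<epsilon> \<alpha> * c \<alpha>))"
    using assms by (simp add: exp_sum)
  also have "\<dots> = (\<Prod>\<alpha>\<in>U. \<Sum>e\<in>{-1, 1}. exp (e * c \<alpha>))"
    by (rule sum_prod_PiE[OF assms])
  also have "\<dots> \<le> (\<Prod>\<alpha>\<in>U. 2 * exp ((c \<alpha>)\<^sup>2 / 2))"
  proof (intro prod_mono conjI)
    fix \<alpha>
    show "0 \<le> (\<Sum>e\<in>{-1, 1}. exp (e * c \<alpha>))" by (intro sum_nonneg) simp
    show "(\<Sum>e\<in>{-1, 1}. exp (e * c \<alpha>)) \<le> 2 * exp ((c \<alpha>)\<^sup>2 / 2)"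
      using cosh_le_exp_square[of "c \<alpha>"] by simp
  qed
  also have "\<dots> = 2 ^ card U * exp ((\<Sum>\<alpha>\<in>U. (c \<alpha>)\<^sup>2) / 2)"
    using assms by (simp add: prod.distrib exp_sum sum_divide_distrib)
  finally show ?thesis .
qed

text \<open>A union bound through exponential moments: Z adds exponentials over the n points and the
  four functionals Re, -Re, Im, -Im, which accounts for 4 n in the logarithm, and some choice of
  signs keeps Z at most its mean.\<close>

lemma random_signs:
  assumes U: "finite U" "U \<noteq> {}" and X: "finite X" "card X = n" "n \<ge> 1"
    and v: "\<And>x \<alpha>. x \<in> X \<Longrightarrow> \<alpha> \<in> U \<Longrightarrow> norm (v x \<alpha> :: complex) \<le> 1"
  obtains \<epsilon> :: "'a \<Rightarrow> real" where "\<And>\<alpha>. \<alpha> \<in> U \<Longrightarrow> \<bar>\<epsilon> \<alpha>\<bar> = 1"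
    "\<And>x. x \<in> X \<Longrightarrow> norm (\<Sum>\<alpha>\<in>U. of_real (\<epsilon> \<alpha>) * v x \<alpha>) \<le> 2 * sqrt (real (card U) * ln (4 * real n))"
proof -
  define M where "M = real (card U)"
  define L where "L = ln (4 * real n)"
  have M: "M > 0" using U by (simp add: M_def card_gt_0_iff)
  have L: "L > 0" using X by (simp add: L_def)
  \<comment> \<open>The minimiser of L/lam + lam M/2, which is the bound for the signed sums after
    taking logarithms.\<close>
  define lam where "lam = sqrt (2 * L / M)"
  have lam: "lam > 0" "lam\<^sup>2 = 2 * L / M" using M L by (simp_all add: lam_def)
  define E where "E = PiE U (\<lambda>_. {-1, 1::real})"
  have E: "finite E" "card E = 2 ^ card U" "E \<noteq> {}"
    using U by (auto simp: E_def card_PiE PiE_eq_empty_iff numeral_2_eq_2 intro: finite_PiE)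
  define c where "c = (\<lambda>(i::nat) x \<alpha>. if i = 0 then Re (v x \<alpha>) else if i = 1 then - Re (v x \<alpha>)
     else if i = 2 then Im (v x \<alpha>) else - Im (v x \<alpha>))"
  have c1: "\<bar>c i x \<alpha>\<bar> \<le> 1" if "x \<in> X" "\<alpha> \<in> U" for i x \<alpha>
    using v[OF that] abs_Re_le_cmod[of "v x \<alpha>"] abs_Im_le_cmod[of "v x \<alpha>"] by (auto simp: c_def)
  define Z where "Z = (\<lambda>\<epsilon>. \<Sum>x\<in>X. \<Sum>i<4. exp (lam * (\<Sum>\<alpha>\<in>U. \<epsilon> \<alpha> * c i x \<alpha>)))"
  have "(\<Sum>\<epsilon>\<in>E. Z \<epsilon>) = (\<Sum>x\<in>X. \<Sum>i<4. \<Sum>\<epsilon>\<in>E. exp (lam * (\<Sum>\<alpha>\<in>U. \<epsilon> \<alpha> * c i x \<alpha>)))"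
    unfolding Z_def sum.swap[of _ X E] sum.swap[of _ "{..<4}" E] ..
  also have "\<dots> \<le> (\<Sum>x\<in>X. \<Sum>i<4::nat. 2 ^ card U * exp (lam\<^sup>2 * M / 2))"
  proof (intro sum_mono)
    fix x i assume x: "x \<in> X"
    have "(\<Sum>\<epsilon>\<in>E. exp (lam * (\<Sum>\<alpha>\<in>U. \<epsilon> \<alpha> * c i x \<alpha>)))
        = (\<Sum>\<epsilon>\<in>E. exp (\<Sum>\<alpha>\<in>U. \<epsilon> \<alpha> * (lam * c i x \<alpha>)))"
      by (simp add: sum_distrib_left mult_ac)
    also have "\<dots> \<le> 2 ^ card U * exp ((\<Sum>\<alpha>\<in>U. (lam * c i x \<alpha>)\<^sup>2) / 2)"
      unfolding E_def by (rule sum_exp_signs[OF U(1)])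
    also have "\<dots> \<le> 2 ^ card U * exp ((\<Sum>\<alpha>\<in>U. lam\<^sup>2) / 2)"
    proof -
      have "(lam * c i x \<alpha>)\<^sup>2 \<le> lam\<^sup>2" if "\<alpha> \<in> U" for \<alpha>
        using c1[OF x that, of i] lam(1) by (simp add: power_mult_distrib abs_square_le_1 mult_left_le)
      then show ?thesis
        by (intro mult_left_mono iffD2[OF exp_le_cancel_iff] divide_right_mono sum_mono) auto
    qed
    finally show "(\<Sum>\<epsilon>\<in>E. exp (lam * (\<Sum>\<alpha>\<in>U. \<epsilon> \<alpha> * c i x \<alpha>))) \<le> 2 ^ card U * exp (lam\<^sup>2 * M / 2)"
      by (simp add: M_def mult.commute)
  qed
  also have "\<dots> = card E * (4 * n * exp (lam\<^sup>2 * M / 2))"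
    using X E by simp
  also have "\<dots> = (\<Sum>\<epsilon>\<in>E. 4 * n * exp (lam\<^sup>2 * M / 2))" by simp
  finally have "\<exists>\<epsilon>\<in>E. Z \<epsilon> \<le> 4 * n * exp (lam\<^sup>2 * M / 2)"
    using sum_strict_mono[OF E(1,3), of "\<lambda>_. real (4 * n) * exp (lam\<^sup>2 * M / 2)" Z] by (meson not_le)
  then obtain \<epsilon> where \<epsilon>: "\<epsilon> \<in> E" "Z \<epsilon> \<le> 4 * n * exp (lam\<^sup>2 * M / 2)" by blast
  have bound: "(\<Sum>\<alpha>\<in>U. \<epsilon> \<alpha> * c i x \<alpha>) \<le> sqrt (2 * M * L)" if x: "x \<in> X" and i: "i < 4" for x i
  proof -
    have "exp (lam * (\<Sum>\<alpha>\<in>U. \<epsilon> \<alpha> * c i x \<alpha>)) \<le> (\<Sum>i<4. exp (lam * (\<Sum>\<alpha>\<in>U. \<epsilon> \<alpha> * c i x \<alpha>)))"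
      using i by (intro member_le_sum) auto
    also have "\<dots> \<le> Z \<epsilon>"
      unfolding Z_def using X x by (intro member_le_sum[of x]) (auto intro: sum_nonneg)
    also have "\<dots> \<le> exp L * exp (lam\<^sup>2 * M / 2)" using \<epsilon>(2) X by (simp add: L_def)
    also have "lam\<^sup>2 * M / 2 = L" using M by (simp add: lam)
    finally have "lam * (\<Sum>\<alpha>\<in>U. \<epsilon> \<alpha> * c i x \<alpha>) \<le> 2 * L"
      by (simp flip: exp_add)
    then have "(\<Sum>\<alpha>\<in>U. \<epsilon> \<alpha> * c i x \<alpha>) \<le> 2 * L / lam"
      using lam(1) by (simp add: pos_le_divide_eq mult.commute)
    also have "2 * L / lam = sqrt (2 * M * L)"
    proof -
      have "lam * sqrt (2 * M * L) = sqrt ((2 * L)\<^sup>2)"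
        unfolding lam_def using M by (simp add: power2_eq_square mult_ac flip: real_sqrt_mult)
      also have "\<dots> = 2 * L" using L by (subst real_sqrt_abs) simp
      finally show ?thesis using lam(1) L by (simp add: divide_eq_eq mult.commute)
    qed
    finally show ?thesis .
  qed
  show thesis
  proof (rule that[of \<epsilon>])
    show "\<bar>\<epsilon> \<alpha>\<bar> = 1" if "\<alpha> \<in> U" for \<alpha>
      using \<epsilon>(1) that by (auto simp: E_def PiE_iff)
    show "norm (\<Sum>\<alpha>\<in>U. of_real (\<epsilon> \<alpha>) * v x \<alpha>) \<le> 2 * sqrt (real (card U) * ln (4 * real n))" if x: "x \<in> X" for x
    proof -
      define w where "w = (\<Sum>\<alpha>\<in>U. of_real (\<epsilon> \<alpha>) * v x \<alpha>)"
      have ml0: "0 \<le> 2 * M * L" using M L by simp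
      have "\<bar>Re w\<bar> \<le> sqrt (2 * M * L)"
        using bound[OF x, of 0] bound[OF x, of 1] by (simp add: w_def c_def sum_negf)
      then have "(Re w)\<^sup>2 \<le> 2 * M * L"
        using ml0 abs_le_square_iff[of "Re w" "sqrt (2 * M * L)"] by simp
      moreover have "\<bar>Im w\<bar> \<le> sqrt (2 * M * L)"
        using bound[OF x, of 2] bound[OF x, of 3] by (simp add: w_def c_def sum_negf)
      then have "(Im w)\<^sup>2 \<le> 2 * M * L"
        using ml0 abs_le_square_iff[of "Im w" "sqrt (2 * M * L)"] by simp
      ultimately have "norm w \<le> sqrt (4 * (M * L))"
        by (simp add: cmod_def)
      also have "\<dots> = 2 * sqrt (M * L)" by (simp add: real_sqrt_mult)
      finally show ?thesis by (simp add: w_def M_def L_def)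
    qed
  qed
qed

section \<open>The Bohr radius\<close>

lemma multi_indices_eq: "multi_indices q N = indices q {1..N}"
  and cube_eq: "cube q N = points q {1..N}"
  and monomial_eq: "monomial N = mon {1..N}"
  and supp_eq: "supp N = sp {1..N}"
  by (simp_all add: multi_indices_def cube_def monomial_def mon_def supp_def sp_def fun_eq_iff)

lemma level_eq: "{\<alpha>. \<alpha> \<in> multi_indices q N \<and> card (supp N \<alpha>) = d} = level q {1..N} d"
  by (simp add: multi_indices_eq supp_eq level_def)

lemma fourier_coeff_eq:
  "fourier_coeff q N f \<alpha> = (\<Sum>x\<in>points q {1..N}. f x * cnj (mon {1..N} \<alpha> x)) / of_nat (q ^ card {1..N})"
  by (simp add: fourier_coeff_def cube_eq monomial_eq)

lemma trig_fourier_coeff: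
  assumes "q \<ge> 1" "x \<in> points q {1..N}"
  shows "trig q {1..N} (fourier_coeff q N f) x = f x"
  using fourier_inversion[of "{1..N}" q x f] assms by (simp add: fourier_coeff_eq[abs_def])

lemma fourier_coeff_trig:
  assumes "q \<ge> 1" "\<alpha> \<in> indices q {1..N}"
  shows "fourier_coeff q N (trig q {1..N} a) \<alpha> = a \<alpha>"
  using trig_coeff[of "{1..N}" \<alpha> q a] assms by (simp add: fourier_coeff_eq)

lemma norm_le_sup_norm: "x \<in> points q {1..N} \<Longrightarrow> norm (f x) \<le> sup_norm q N f"
  unfolding sup_norm_def cube_eq by (intro Max_ge) auto

lemma sup_norm_le:
  assumes "q \<ge> 1" "\<And>x. x \<in> points q {1..N} \<Longrightarrow> norm (f x) \<le> B"
  shows "sup_norm q N f \<le> B"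
  unfolding sup_norm_def cube_eq using assms points_nonempty[of q "{1..N}"] by (subst Max_le_iff) auto

lemma sup_norm_nonneg:
  assumes "q \<ge> 1"
  shows "sup_norm q N f \<ge> 0"
proof -
  obtain x where "x \<in> points q {1..N}" using points_nonempty[of q "{1..N}"] assms by auto
  from order_trans[OF norm_ge_zero norm_le_sup_norm[OF this]] show ?thesis .
qed

lemma norm_trig_fourier_coeff_le:
  assumes "q \<ge> 1" "x \<in> points q {1..N}"
  shows "norm (trig q {1..N} (fourier_coeff q N f) x) \<le> sup_norm q N f"
  unfolding trig_fourier_coeff[OF assms] using assms(2) by (rule norm_le_sup_norm)

text \<open>The l^p norms decrease as p grows. Layer m \<le> d is controlled with its own, smaller
  critical exponent, whereas \<open>BH_bound\<close> uses the exponent of d for all layers.\<close>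

lemma sum_powr_le_of_smaller_exponent:
  fixes u :: "'a \<Rightarrow> real"
  assumes U: "finite U" and u: "\<And>i. i \<in> U \<Longrightarrow> u i \<ge> 0" and p: "0 < p" "p \<le> r" and L: "L \<ge> 0"
    and le: "(\<Sum>i\<in>U. u i powr p) \<le> L powr p"
  shows "(\<Sum>i\<in>U. u i powr r) \<le> L powr r"
proof -
  have uL: "u i \<le> L" if "i \<in> U" for i
  proof -
    have "u i powr p \<le> L powr p"
      using member_le_sum[OF that, of "\<lambda>i. u i powr p"] U le by simp
    then show ?thesis using p L u[OF that] powr_less_mono2[of p L "u i"] by (simp add: not_less[symmetric]) (meson not_le)
  qed
  have "(\<Sum>i\<in>U. u i powr r) \<le> (\<Sum>i\<in>U. u i powr p * L powr (r - p))"
  proof (rule sum_mono)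
    fix i assume i: "i \<in> U"
    have "u i powr r = u i powr p * u i powr (r - p)" by (simp flip: powr_add)
    also have "\<dots> \<le> u i powr p * L powr (r - p)"
      using p u[OF i] uL[OF i] by (intro mult_left_mono powr_mono2) auto
    finally show "u i powr r \<le> u i powr p * L powr (r - p)" .
  qed
  also have "\<dots> \<le> L powr p * L powr (r - p)"
    unfolding sum_distrib_right[symmetric] using le by (intro mult_right_mono) auto
  also have "\<dots> = L powr r" by (simp flip: powr_add)
  finally show ?thesis .
qed

lemma BH_exponent_mono: "m \<le> d \<Longrightarrow> BH_exponent m \<le> BH_exponent d"
  by (simp add: BH_exponent_def divide_simps algebra_simps)

text \<open>The layers of f are the coefficients in t of the noise polynomial, which the sup norm
  bounds on [0, 1]; the interval estimate separates them at a cost depending on d alone, and each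
  layer obeys its own inequality. Finiteness of the constant is the only aim.\<close>

lemma BH_bound_exists:
  assumes q: "q \<ge> 1" and d: "d \<ge> 1"
  shows "\<exists>C. BH_bound d q C"
proof -
  define p where "p = BH_exponent d"
  have p: "p > 0" using d by (simp add: p_def BH_exponent_pos)
  have "\<forall>s. \<exists>C>0. s \<ge> 1 \<longrightarrow> BH_hom q s C" using BH_hom_exists[OF q] by (metis zero_less_one)
  then obtain Cf where Cf: "\<And>s. Cf s > 0" "\<And>s. s \<ge> 1 \<Longrightarrow> BH_hom q s (Cf s)" by metis
  \<comment> \<open>The interval estimate in degree d with interval length and radius both equal to
    1.\<close>
  define K where "K = (4 * real d + 1) * (1 + 2 * 1) ^ (2 * d)"
  have K: "K \<ge> 0" by (simp add: K_def)
  \<comment> \<open>The summand 1 accounts for the constant coefficient, the only index with empty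
    support.\<close>
  define W where "W = 1 + (\<Sum>m\<in>{1..d}. (Cf m * K) powr p)"
  have W: "W \<ge> 0" by (simp add: W_def sum_nonneg add_nonneg_nonneg)
  have "BH_bound d q (W powr (1 / p))"
    unfolding BH_bound_def p_def[symmetric]
  proof (intro allI impI)
    fix N :: nat and f
    assume "N \<ge> 1" and deg: "\<forall>\<alpha>\<in>multi_indices q N. d < card (supp N \<alpha>) \<longrightarrow> fourier_coeff q N f \<alpha> = 0"
    define J where "J = {1..N}"
    have J: "finite J" by (simp add: J_def)
    define a where "a = fourier_coeff q N f"
    define S where "S = sup_norm q N f"
    have S: "S \<ge> 0" using sup_norm_nonneg[OF q] by (simp add: S_def)
    have B: "norm (trig q J a x) \<le> S" if "x \<in> points q J" for x
      using norm_trig_fourier_coeff_le[OF q] that by (simp add: J_def a_def S_def)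
    define am where "am = (\<lambda>m \<alpha>. if card (sp J \<alpha>) = m then a \<alpha> else 0)"
    have part: "norm (trig q J (am m) z) \<le> K * S" if m: "m \<le> d" and z: "z \<in> points q J" for m z
    proof -
      have "norm (trig q J (am m) z) * 1 ^ m * 1 ^ (2 * m) \<le> S * (4 * d + 1) * (1 + 2 * 1) ^ (2 * d)"
      proof (rule coeff_le_of_interval_bound[where m = d and c = "\<lambda>m. trig q J (am m) z"])
        fix t :: real assume t: "0 \<le> t" "t \<le> 1"
        have "(\<Sum>i\<le>d. trig q J (am i) z * of_real t ^ i)
            = (\<Sum>\<alpha>\<in>indices q J. \<Sum>i\<le>d. if i = card (sp J \<alpha>) then a \<alpha> * of_real t ^ i * mon J \<alpha> z else 0)"
          unfolding trig_def sum_distrib_right am_def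
          by (subst sum.swap) (intro sum.cong refl, auto)
        also have "\<dots> = (\<Sum>\<alpha>\<in>indices q J. a \<alpha> * of_real t ^ card (sp J \<alpha>) * mon J \<alpha> z)"
        proof (intro sum.cong refl)
          fix \<alpha> assume "\<alpha> \<in> indices q J"
          then have "a \<alpha> = 0" if "card (sp J \<alpha>) > d"
            using deg that by (simp add: multi_indices_eq supp_eq J_def a_def)
          then show "(\<Sum>i\<le>d. if i = card (sp J \<alpha>) then a \<alpha> * of_real t ^ i * mon J \<alpha> z else 0)
              = a \<alpha> * of_real t ^ card (sp J \<alpha>) * mon J \<alpha> z"
            by (auto simp: not_le)
        qed
        also have "norm \<dots> \<le> S" by (rule trig_noise_le[OF J q z t B])
        finally show "norm (\<Sum>i\<le>d. trig q J (am i) z * of_real t ^ i) \<le> S" .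
      qed (use m in auto)
      then show ?thesis by (simp add: K_def mult_ac add.commute)
    qed
    have lev: "(\<Sum>\<alpha>\<in>level q J m. norm (a \<alpha>) powr p) \<le> (Cf m * K) powr p * S powr p" if m: "m \<in> {1..d}" for m
    proof -
      have "(\<Sum>\<alpha>\<in>level q J m. norm (a \<alpha>) powr BH_exponent m) = (\<Sum>\<alpha>\<in>level q J m. norm (am m \<alpha>) powr BH_exponent m)"
        by (intro sum.cong) (auto simp: am_def level_def)
      also have "\<dots> \<le> (Cf m * (K * S)) powr BH_exponent m"
        using m part by (intro BH_homD Cf(2) J) (auto simp: am_def)
      finally have le: "(\<Sum>\<alpha>\<in>level q J m. norm (a \<alpha>) powr BH_exponent m) \<le> (Cf m * (K * S)) powr BH_exponent m" .
      have "(\<Sum>\<alpha>\<in>level q J m. norm (a \<alpha>) powr p) \<le> (Cf m * (K * S)) powr p"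
      proof (rule sum_powr_le_of_smaller_exponent[OF _ _ _ _ _ le])
        show "0 < BH_exponent m" "BH_exponent m \<le> p"
          using m by (simp_all add: p_def BH_exponent_pos BH_exponent_mono)
        show "0 \<le> Cf m * (K * S)" using Cf(1)[of m] K S by (intro mult_nonneg_nonneg) auto
      qed (use J in auto)
      then show ?thesis using Cf(1)[of m] K S by (simp add: powr_mult)
    qed
    have lev0: "(\<Sum>\<alpha>\<in>level q J 0. norm (a \<alpha>) powr p) \<le> S powr p"
    proof -
      have "norm (a \<alpha>) powr p \<le> S powr p" if "\<alpha> \<in> level q J 0" for \<alpha>
        using norm_coeff_le[OF J _ _ B, of \<alpha>] q that p by (intro powr_mono2) (auto simp: level_def)
      then have "(\<Sum>\<alpha>\<in>level q J 0. norm (a \<alpha>) powr p) \<le> card (level q J 0) * S powr p"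
        by (rule sum_bounded_above[where K = "S powr p"])
      then show ?thesis using card_level[OF J q, of 0] by simp
    qed
    have "(\<Sum>\<alpha> | \<alpha> \<in> multi_indices q N \<and> card (supp N \<alpha>) \<le> d. norm (fourier_coeff q N f \<alpha>) powr p)
        = (\<Sum>m\<in>{0..d}. \<Sum>\<alpha> | \<alpha> \<in> {\<alpha>. \<alpha> \<in> indices q J \<and> card (sp J \<alpha>) \<le> d} \<and> card (sp J \<alpha>) = m. norm (a \<alpha>) powr p)"
      unfolding multi_indices_eq supp_eq a_def[symmetric] J_def[symmetric]
      using J by (intro sum.group[symmetric]) auto
    also have "\<dots> = (\<Sum>m\<in>{0..d}. \<Sum>\<alpha>\<in>level q J m. norm (a \<alpha>) powr p)"
      by (intro sum.cong refl) (auto simp: level_def)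
    also have "\<dots> = (\<Sum>\<alpha>\<in>level q J 0. norm (a \<alpha>) powr p) + (\<Sum>m\<in>{1..d}. \<Sum>\<alpha>\<in>level q J m. norm (a \<alpha>) powr p)"
      by (simp add: sum.atLeast_Suc_atMost)
    also have "\<dots> \<le> S powr p + (\<Sum>m\<in>{1..d}. (Cf m * K) powr p * S powr p)"
      by (intro add_mono lev0 sum_mono lev)
    also have "\<dots> = W * S powr p" by (simp add: W_def distrib_right sum_distrib_right)
    finally have "(\<Sum>\<alpha> | \<alpha> \<in> multi_indices q N \<and> card (supp N \<alpha>) \<le> d. norm (fourier_coeff q N f \<alpha>) powr p) powr (1 / p)
        \<le> (W * S powr p) powr (1 / p)"
      using p by (intro powr_mono2) (auto simp: sum_nonneg)
    also have "\<dots> = W powr (1 / p) * S"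
      using p W S by (simp add: powr_mult powr_powr)
    finally show "(\<Sum>\<alpha> | \<alpha> \<in> multi_indices q N \<and> card (supp N \<alpha>) \<le> d. norm (fourier_coeff q N f \<alpha>) powr p) powr (1 / p)
        \<le> W powr (1 / p) * sup_norm q N f" by (simp add: S_def)
  qed
  then show ?thesis by blast
qed

text \<open>Tested on the constant function 1 in one variable. The bound gives the admissible
  constants an infimum and keeps the radius built from such a constant at most 1.\<close>

lemma BH_bound_ge_1:
  assumes q: "q \<ge> 1" and d: "d \<ge> 1" and C: "BH_bound d q C"
  shows "C \<ge> 1"
proof -
  define J where "J = {1..1::nat}"
  define z where "z = (\<lambda>j\<in>J. 0::nat)"
  have z: "z \<in> indices q J" "sp J z = {}" using q by (auto simp: z_def sp_def)
  define a where "a = (\<lambda>\<alpha>. if \<alpha> = z then 1 else 0 :: complex)"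
  define f where "f = trig q J a"
  have f1: "f x = 1" for x
  proof -
    have "f x = (\<Sum>\<alpha>\<in>indices q J. if \<alpha> = z then mon J \<alpha> x else 0)"
      by (simp add: f_def trig_def a_def if_distrib if_distribR cong: if_cong)
    also have "\<dots> = mon J z x" using z by (simp add: J_def)
    finally show ?thesis by (simp add: mon_def z_def)
  qed
  have coeff: "fourier_coeff q 1 f \<alpha> = a \<alpha>" if "\<alpha> \<in> indices q J" for \<alpha>
    using fourier_coeff_trig[OF q, of \<alpha> 1 a] that by (simp add: f_def J_def)
  have sup: "sup_norm q 1 f \<le> 1" by (rule sup_norm_le[OF q]) (simp add: f1)
  define p where "p = BH_exponent d"
  have p: "p > 0" using d by (simp add: p_def BH_exponent_pos)
  define X where "X = (\<Sum>\<alpha> | \<alpha> \<in> multi_indices q 1 \<and> card (supp 1 \<alpha>) \<le> d. norm (fourier_coeff q 1 f \<alpha>) powr p)"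
  have "X powr (1 / p) \<le> C * sup_norm q 1 f"
    unfolding X_def p_def
  proof (rule C[unfolded BH_bound_def, rule_format])
    fix \<alpha> assume "\<alpha> \<in> multi_indices q 1" "d < card (supp 1 \<alpha>)"
    then show "fourier_coeff q 1 f \<alpha> = 0"
      using coeff[of \<alpha>] z by (auto simp: multi_indices_eq supp_eq a_def J_def)
  qed simp
  moreover have "1 \<le> X"
  proof -
    have "norm (fourier_coeff q 1 f z) powr p \<le> X"
      unfolding X_def using z J_def by (intro member_le_sum) (auto simp: multi_indices_eq supp_eq)
    then show ?thesis using coeff[OF z(1)] by (simp add: a_def)
  qed
  then have "1 \<le> X powr (1 / p)" using p by (simp add: ge_one_powr_ge_zero)
  ultimately have le: "1 \<le> C * sup_norm q 1 f" by linarith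
  have "C > 0"
  proof (rule ccontr)
    assume "\<not> C > 0"
    then have "C * sup_norm q 1 f \<le> 0"
      using sup_norm_nonneg[OF q, of 1 f] by (intro mult_nonpos_nonneg) auto
    then show False using le by simp
  qed
  then have "C * sup_norm q 1 f \<le> C * 1" using sup by (intro mult_left_mono) auto
  then show ?thesis using le by simp
qed

text \<open>\<open>LEAST\<close> on the reals is informative only when a minimum is attained. For
  each f the condition is a linear inequality in C, so the infimum of the admissible constants is
  itself admissible.\<close>

lemma BH_bound_BH_int:
  assumes q: "q \<ge> 1" and d: "d \<ge> 1"
  shows "BH_bound d q (BH_int d q)"
proof -
  define Y where "Y = {C. BH_bound d q C}"
  have Y: "Y \<noteq> {}" "bdd_below Y" "\<And>C. C \<in> Y \<Longrightarrow> C \<ge> 1"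
    using BH_bound_exists[OF q d] BH_bound_ge_1[OF q d] by (auto simp: Y_def intro!: bdd_belowI[of _ 1])
  have "BH_bound d q (Inf Y)"
    unfolding BH_bound_def
  proof (intro allI impI)
    fix N :: nat and f
    assume N: "N \<ge> 1" and deg: "\<forall>\<alpha>\<in>multi_indices q N. d < card (supp N \<alpha>) \<longrightarrow> fourier_coeff q N f \<alpha> = 0"
    define X where "X = (\<Sum>\<alpha> | \<alpha> \<in> multi_indices q N \<and> card (supp N \<alpha>) \<le> d.
      norm (fourier_coeff q N f \<alpha>) powr BH_exponent d) powr (1 / BH_exponent d)"
    have le: "X \<le> C * sup_norm q N f" if "C \<in> Y" for C
      using that N deg unfolding X_def Y_def BH_bound_def by blast
    have "X \<le> Inf Y * sup_norm q N f"
    proof (cases "sup_norm q N f = 0")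
      case True
      then show ?thesis using le Y(1) by auto
    next
      case False
      then have "sup_norm q N f > 0" using sup_norm_nonneg[OF q, of N f] by simp
      moreover from this have "X / sup_norm q N f \<le> Inf Y"
        using Y(1) le by (intro cInf_greatest) (auto simp: divide_le_eq)
      ultimately show ?thesis by (simp add: divide_le_eq)
    qed
    then show "(\<Sum>\<alpha> | \<alpha> \<in> multi_indices q N \<and> card (supp N \<alpha>) \<le> d.
      norm (fourier_coeff q N f \<alpha>) powr BH_exponent d) powr (1 / BH_exponent d) \<le> Inf Y * sup_norm q N f"
      by (simp add: X_def)
  qed
  moreover have "Inf Y \<le> C" if "BH_bound d q C" for C
    using that Y(2) by (intro cInf_lower) (auto simp: Y_def)
  ultimately have "BH_int d q = Inf Y"
    unfolding BH_int_def by (rule Least_equality)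
  then show ?thesis using \<open>BH_bound d q (Inf Y)\<close> by simp
qed

section \<open>Two-sided bounds for the radius\<close>

definition radii :: "nat \<Rightarrow> nat \<Rightarrow> nat \<Rightarrow> real set" where
  "radii N q d = {r. 0 \<le> r \<and> r \<le> 1 \<and> (\<forall>f\<in>layer N q d.
     r ^ d * (\<Sum>\<alpha>\<in>level q {1..N} d. norm (fourier_coeff q N f \<alpha>)) \<le> sup_norm q N f)}"

lemma bohr_radius_eq: "bohr_radius N q d = Sup (radii N q d)"
  by (simp add: bohr_radius_def radii_def level_eq)

text \<open>Hoelder's inequality over the M indices of the layer, with 1 - 1/p = (d - 1)/(2d). C is
  left open because it is instantiated twice: with \<open>BH_int\<close> for the explicit bound, and
  with a subexponential constant of the layer for the asymptotics.\<close>

lemma bohr_radius_ge: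
  assumes q: "q \<ge> 2" and d: "1 \<le> d" "d \<le> N" and C: "C \<ge> 1"
    and le: "\<And>f. f \<in> layer N q d \<Longrightarrow>
      (\<Sum>\<alpha>\<in>level q {1..N} d. norm (fourier_coeff q N f \<alpha>) powr BH_exponent d) \<le> (C * sup_norm q N f) powr BH_exponent d"
  shows "C powr (- (1 / d)) * real ((N choose d) * (q - 1) ^ d) powr (- ((real d - 1) / (2 * (real d)\<^sup>2))) \<le> bohr_radius N q d"
proof -
  define p where "p = BH_exponent d"
  define M where "M = real ((N choose d) * (q - 1) ^ d)"
  define L where "L = level q {1..N} d"
  have q1: "q \<ge> 1" using q by simp
  have fin: "finite L" by (simp add: L_def)
  have cardL: "real (card L) = M" using card_level[of "{1..N}" q d] q1 by (simp add: L_def M_def)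
  have "(N choose d) * (q - 1) ^ d \<ge> 1" using q d by (simp add: Suc_le_eq)
  then have M: "M \<ge> 1" unfolding M_def by linarith
  have p: "p > 0" "1 - 1 / p = (real d - 1) / (2 * d)"
    using d by (simp_all add: p_def BH_exponent_pos) (simp add: BH_exponent_def field_simps)
  define r where "r = C powr (- (1 / d)) * M powr (- ((real d - 1) / (2 * (real d)\<^sup>2)))"
  have r0: "r \<ge> 0" by (simp add: r_def)
  have r1: "r \<le> 1"
  proof -
    have "C powr (- (1 / d)) \<le> 1" "M powr (- ((real d - 1) / (2 * (real d)\<^sup>2))) \<le> 1"
      using powr_mono[of "- (1 / d)" 0 C] powr_mono[of "- ((real d - 1) / (2 * (real d)\<^sup>2))" 0 M] C M d
      by simp_all
    then show ?thesis unfolding r_def by (intro mult_le_one) auto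
  qed
  have rd: "r ^ d = inverse C * M powr (- (1 - 1 / p))"
  proof -
    have "r ^ d = C powr (- (1 / d) * d) * M powr (- ((real d - 1) / (2 * (real d)\<^sup>2)) * d)"
      using C M by (simp add: r_def power_mult_distrib powr_powr flip: powr_realpow)
    also have "- (1 / d) * d = -1" using d by simp
    also have "- ((real d - 1) / (2 * (real d)\<^sup>2)) * d = - (1 - 1 / p)"
      using d by (simp add: p power2_eq_square)
    finally show ?thesis using C by (simp add: powr_minus)
  qed
  have "r \<in> radii N q d"
    unfolding radii_def
  proof (intro CollectI conjI ballI r0 r1)
    fix f assume f: "f \<in> layer N q d"
    define u where "u = (\<lambda>\<alpha>. norm (fourier_coeff q N f \<alpha>))"
    define S where "S = sup_norm q N f"
    have S: "S \<ge> 0" using sup_norm_nonneg[OF q1] by (simp add: S_def)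
    have "(\<Sum>\<alpha>\<in>L. u \<alpha>) \<le> (\<Sum>\<alpha>\<in>L. u \<alpha> powr p) powr (1 / p) * M powr (1 - 1 / p)"
    proof (cases "d = 1")
      case True
      then have "p = 1" by (simp add: p_def BH_exponent_def)
      then show ?thesis using M by (simp add: u_def sum_nonneg)
    next
      case False
      then have p1: "p > 1" using d by (simp add: p_def BH_exponent_def)
      have "(\<Sum>\<alpha>\<in>L. u \<alpha>) = (\<Sum>\<alpha>\<in>L. (u \<alpha> powr p) powr (1 / p) * 1 powr (1 - 1 / p))"
        using p1 by (simp add: u_def powr_powr)
      also have "\<dots> \<le> (\<Sum>\<alpha>\<in>L. u \<alpha> powr p) powr (1 / p) * (\<Sum>\<alpha>\<in>L. 1) powr (1 - 1 / p)"
        using p1 fin by (intro holder_sum) auto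
      finally show ?thesis by (simp add: cardL)
    qed
    also have "\<dots> \<le> ((C * S) powr p) powr (1 / p) * M powr (1 - 1 / p)"
      using le[OF f] p by (intro mult_right_mono powr_mono2) (auto simp: u_def S_def L_def p_def sum_nonneg)
    also have "\<dots> = C * S * M powr (1 - 1 / p)"
      using p C S by (simp add: powr_powr)
    finally have "r ^ d * (\<Sum>\<alpha>\<in>L. u \<alpha>) \<le> r ^ d * (C * S * M powr (1 - 1 / p))"
      using r0 by (intro mult_left_mono) auto
    also have "\<dots> = (inverse C * C) * (M powr (- (1 - 1 / p)) * M powr (1 - 1 / p)) * S"
      unfolding rd by (simp only: mult_ac)
    also have "\<dots> = S" using C M by (simp flip: powr_add)
    finally show "r ^ d * (\<Sum>\<alpha>\<in>level q {1..N} d. norm (fourier_coeff q N f \<alpha>)) \<le> sup_norm q N f"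
      by (simp add: u_def S_def L_def)
  qed
  then show ?thesis
    unfolding bohr_radius_eq r_def[symmetric, unfolded M_def]
    by (intro cSup_upper bdd_aboveI[of _ 1]) (auto simp: radii_def)
qed

lemma bohr_radius_ge_BH_int:
  assumes q: "q \<ge> 2" and d: "1 \<le> d" "d \<le> N"
  shows "BH_int d q powr (- (1 / d)) * real ((N choose d) * (q - 1) ^ d) powr (- ((real d - 1) / (2 * (real d)\<^sup>2)))
    \<le> bohr_radius N q d"
proof (rule bohr_radius_ge[OF q d])
  have q1: "q \<ge> 1" using q by simp
  define C where "C = BH_int d q"
  have C: "BH_bound d q C" using BH_bound_BH_int[OF q1 d(1)] by (simp add: C_def)
  then have C1: "C \<ge> 1" using BH_bound_ge_1[OF q1 d(1)] by simp
  then show "BH_int d q \<ge> 1" by (simp add: C_def)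
  define p where "p = BH_exponent d"
  have p: "p > 0" using d by (simp add: p_def BH_exponent_pos)
  fix f assume f: "f \<in> layer N q d"
  define u where "u = (\<lambda>\<alpha>. norm (fourier_coeff q N f \<alpha>))"
  define S where "S = sup_norm q N f"
  define X where "X = (\<Sum>\<alpha> | \<alpha> \<in> multi_indices q N \<and> card (supp N \<alpha>) \<le> d. u \<alpha> powr p)"
  have S: "S \<ge> 0" using sup_norm_nonneg[OF q1] by (simp add: S_def)
  have X0: "X \<ge> 0" by (simp add: X_def sum_nonneg)
  have "X powr (1 / p) \<le> C * S"
    unfolding X_def p_def u_def S_def using d f
    by (intro C[unfolded BH_bound_def, rule_format]) (auto simp: layer_def)
  then have "(X powr (1 / p)) powr p \<le> (C * S) powr p" using p by (intro powr_mono2) auto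
  then have "X \<le> (C * S) powr p" using p X0 by (simp add: powr_powr)
  moreover have "(\<Sum>\<alpha>\<in>level q {1..N} d. u \<alpha> powr p) \<le> X"
    unfolding X_def by (intro sum_mono2) (auto simp: level_def multi_indices_eq supp_eq)
  ultimately show "(\<Sum>\<alpha>\<in>level q {1..N} d. norm (fourier_coeff q N f \<alpha>) powr BH_exponent d)
      \<le> (BH_int d q * sup_norm q N f) powr BH_exponent d"
    by (simp add: u_def S_def p_def C_def)
qed

lemma bohr_radius_ge_BH_hom:
  assumes q: "q \<ge> 2" and d: "1 \<le> d" "d \<le> N" and C: "C \<ge> 1" "BH_hom q d C"
  shows "C powr (- (1 / d)) * real ((N choose d) * (q - 1) ^ d) powr (- ((real d - 1) / (2 * (real d)\<^sup>2)))
    \<le> bohr_radius N q d"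
proof (rule bohr_radius_ge[OF q d C(1)])
  fix f assume f: "f \<in> layer N q d"
  show "(\<Sum>\<alpha>\<in>level q {1..N} d. norm (fourier_coeff q N f \<alpha>) powr BH_exponent d)
      \<le> (C * sup_norm q N f) powr BH_exponent d"
    using q f by (intro BH_homD[OF C(2)] norm_trig_fourier_coeff_le)
      (auto simp: layer_def multi_indices_eq supp_eq)
qed

lemma bohr_radius_le:
  assumes q: "q \<ge> 2" and d: "1 \<le> d" "d \<le> N"
  shows "bohr_radius N q d \<le> (2 * sqrt (real N * ln (real q) + ln 8)) powr (1 / real d)
    * real ((N choose d) * (q - 1) ^ d) powr (- (1 / (2 * real d)))"
  unfolding bohr_radius_eq
proof (rule cSup_least)
  have q1: "q \<ge> 1" using q by simp
  have "0 \<in> radii N q d" using d sup_norm_nonneg[OF q1] by (auto simp: radii_def power_0_left)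
  then show "radii N q d \<noteq> {}" by blast
  fix r assume r: "r \<in> radii N q d"
  define J where "J = {1..N}"
  define U where "U = level q J d"
  define M where "M = real ((N choose d) * (q - 1) ^ d)"
  have cardU: "real (card U) = M" using card_level[of J q d] q1 by (simp add: U_def M_def J_def)
  have "(N choose d) * (q - 1) ^ d \<ge> 1" using q d by (simp add: Suc_le_eq)
  then have M: "M \<ge> 1" unfolding M_def by linarith
  have U: "finite U" "U \<noteq> {}" using cardU M by (auto simp: U_def J_def)
  have X: "finite (points q J)" "card (points q J) = q ^ N" "q ^ N \<ge> 1"
    using q1 by (simp_all add: J_def card_points)
  obtain \<epsilon> :: "(nat \<Rightarrow> nat) \<Rightarrow> real" where \<epsilon>: "\<And>\<alpha>. \<alpha> \<in> U \<Longrightarrow> \<bar>\<epsilon> \<alpha>\<bar> = 1"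
    "\<And>x. x \<in> points q J \<Longrightarrow> norm (\<Sum>\<alpha>\<in>U. of_real (\<epsilon> \<alpha>) * mon J \<alpha> x) \<le> 2 * sqrt (real (card U) * ln (4 * real (q ^ N)))"
    by (rule random_signs[OF U X, of "\<lambda>x \<alpha>. mon J \<alpha> x"]) (use norm_mon in auto)
  define a where "a = (\<lambda>\<alpha>. if \<alpha> \<in> U then complex_of_real (\<epsilon> \<alpha>) else 0)"
  define f where "f = trig q J a"
  define L where "L = real N * ln (real q) + ln 8"
  have "ln (4 * real (q ^ N)) = ln 4 + N * ln q"
    using q by (simp add: ln_mult ln_realpow)
  also have "\<dots> \<le> L" by (simp add: L_def)
  finally have L4: "ln (4 * real (q ^ N)) \<le> L" .
  have L: "L > 0" using q by (simp add: L_def add_nonneg_pos)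
  have f: "f x = (\<Sum>\<alpha>\<in>U. of_real (\<epsilon> \<alpha>) * mon J \<alpha> x)" for x
    unfolding f_def trig_def
    by (rule sum.mono_neutral_cong_right) (auto simp: a_def U_def level_def J_def)
  have sup: "sup_norm q N f \<le> 2 * sqrt (M * L)"
  proof (rule sup_norm_le[OF q1])
    fix x assume "x \<in> points q {1..N}"
    then have "norm (f x) \<le> 2 * sqrt (M * ln (4 * real (q ^ N)))"
      using \<epsilon>(2)[of x] unfolding f cardU by (simp add: J_def)
    also have "\<dots> \<le> 2 * sqrt (M * L)" using L4 M by (intro mult_left_mono real_sqrt_le_mono) auto
    finally show "norm (f x) \<le> 2 * sqrt (M * L)" .
  qed
  have coeff: "fourier_coeff q N f \<alpha> = a \<alpha>" if "\<alpha> \<in> indices q J" for \<alpha>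
    using fourier_coeff_trig[OF q1, of \<alpha> N a] that by (simp add: f_def J_def)
  have "f \<in> layer N q d"
    using coeff by (auto simp: layer_def multi_indices_eq supp_eq a_def U_def level_def J_def)
  then have "r ^ d * (\<Sum>\<alpha>\<in>U. norm (fourier_coeff q N f \<alpha>)) \<le> sup_norm q N f"
    using r by (auto simp: radii_def U_def J_def)
  also have "(\<Sum>\<alpha>\<in>U. norm (fourier_coeff q N f \<alpha>)) = (\<Sum>\<alpha>\<in>U. 1)"
  proof (intro sum.cong refl)
    fix \<alpha> assume "\<alpha> \<in> U"
    then show "norm (fourier_coeff q N f \<alpha>) = 1"
      using coeff[of \<alpha>] \<epsilon>(1)[of \<alpha>] by (simp add: a_def U_def level_def)
  qed
  \<comment> \<open>All M coefficients have modulus 1 while the sup norm is of order sqrt(M L);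
    cancelling sqrt M leaves M with exponent -1/2.\<close>
  finally have "r ^ d * M \<le> 2 * sqrt L * sqrt M"
    using sup by (simp add: cardU real_sqrt_mult mult_ac)
  moreover have "r ^ d * M = (r ^ d * sqrt M) * sqrt M" using M by simp
  ultimately have "(r ^ d * sqrt M) * sqrt M \<le> 2 * sqrt L * sqrt M" by (simp only:)
  then have "r ^ d * sqrt M \<le> 2 * sqrt L"
    by (rule mult_right_le_imp_le) (use M in simp)
  then have rd: "r ^ d \<le> 2 * sqrt L * M powr (- (1 / 2))"
    using M by (simp add: powr_minus powr_half_sqrt divide_inverse[symmetric] le_divide_eq)
  have r0: "r \<ge> 0" using r by (simp add: radii_def)
  have "r = (r ^ d) powr (1 / d)"
    using r0 d by (cases "r = 0") (simp_all add: powr_powr flip: powr_realpow)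
  also have "\<dots> \<le> (2 * sqrt L * M powr (- (1 / 2))) powr (1 / d)"
    using rd r0 by (intro powr_mono2) auto
  also have "\<dots> = (2 * sqrt L) powr (1 / d) * M powr (- (1 / (2 * real d)))"
    using L M by (simp add: powr_mult powr_powr)
  finally show "r \<le> (2 * sqrt (real N * ln (real q) + ln 8)) powr (1 / real d)
    * real ((N choose d) * (q - 1) ^ d) powr (- (1 / (2 * real d)))"
    by (simp add: L_def M_def)
qed

section \<open>Asymptotics\<close>

lemma exp_1_le_power:
  assumes "d \<ge> 1"
  shows "exp 1 * real d ^ Suc d \<le> (real d + 1) ^ Suc d"
proof -
  define y where "y = 1 + 1 / real d"
  have y: "y > 0" using assms by (simp add: y_def add_pos_nonneg)
  have "ln (1 / y) \<le> 1 / y - 1" using y by (intro ln_le_minus_one) simp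
  moreover have "ln (1 / y) = - ln y" using y by (simp add: ln_div)
  moreover have "1 / y = 1 - 1 / (real d + 1)" using assms by (simp add: y_def divide_simps)
  ultimately have "1 / (real d + 1) \<le> ln y" by linarith
  then have "1 \<le> real (Suc d) * ln y" by (simp add: divide_le_eq mult.commute add.commute)
  then have "exp 1 \<le> exp (real (Suc d) * ln y)" by (simp only: exp_le_cancel_iff)
  also have "\<dots> = y ^ Suc d" using y by (simp only: exp_of_nat_mult exp_ln)
  finally have "exp 1 * real d ^ Suc d \<le> y ^ Suc d * real d ^ Suc d"
    by (intro mult_right_mono) auto
  also have "\<dots> = (real d + 1) ^ Suc d"
    unfolding power_mult_distrib[symmetric] using assms by (simp add: y_def distrib_right)
  finally show ?thesis .
qed

text \<open>The induction step is (1 + 1/d)^(d + 1) \<ge> e. The polynomial factor e d is harmless,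
  as it will be raised to the power 1/(2d).\<close>

lemma fact_le_power:
  assumes "d \<ge> 1"
  shows "fact d \<le> exp 1 * real d * (real d / exp 1) ^ d"
  using assms
proof (induction d rule: dec_induct)
  case (step d)
  have "exp 1 * real d ^ Suc d \<le> (real d + 1) ^ Suc d"
    using step by (intro exp_1_le_power) simp
  then have "(real d + 1) * (exp 1 * real d ^ Suc d) \<le> (real d + 1) * (real d + 1) ^ Suc d"
    by (intro mult_left_mono) auto
  then have *: "(real d + 1) * (exp 1 * real d ^ Suc d) / exp 1 ^ d \<le> (real d + 1) * (real d + 1) ^ Suc d / exp 1 ^ d"
    by (intro divide_right_mono) auto
  have "fact (Suc d) = (real d + 1) * fact d" by simp
  also have "\<dots> \<le> (real d + 1) * (exp 1 * real d * (real d / exp 1) ^ d)"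
    using step by (intro mult_left_mono) auto
  also have "\<dots> = (real d + 1) * (exp 1 * real d ^ Suc d) / exp 1 ^ d"
    by (simp add: power_divide)
  also note *
  also have "(real d + 1) * (real d + 1) ^ Suc d / exp 1 ^ d = exp 1 * real (Suc d) * (real (Suc d) / exp 1) ^ Suc d"
    by (simp add: power_divide add.commute)
  finally show ?case .
qed simp

lemma power_le_exp_fact: "real d ^ d \<le> exp (real d) * fact d"
proof -
  have "(\<Sum>n\<in>{d}. real d ^ n /\<^sub>R fact n) \<le> exp (real d)"
    unfolding exp_def by (intro sum_le_suminf summable_exp_generic) auto
  then have "real d ^ d / fact d \<le> exp (real d)" by (simp add: divide_inverse mult.commute)
  then show ?thesis by (simp add: divide_le_eq mult.commute)
qed

lemma binomial_upper:
  assumes "1 \<le> d"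
  shows "real (N choose d) \<le> (exp 1 * real N / real d) ^ d"
proof -
  have "real (N choose d) * fact d \<le> real N ^ d"
    using binomial_fact_pow[of N d] by (metis of_nat_fact of_nat_le_iff of_nat_mult of_nat_power)
  then have "real (N choose d) * fact d * real d ^ d \<le> real N ^ d * (exp (real d) * fact d)"
    by (intro mult_mono power_le_exp_fact) auto
  then have "(real (N choose d) * real d ^ d) * fact d \<le> (real N ^ d * exp (real d)) * fact d"
    by (simp add: mult_ac)
  then have "real (N choose d) * real d ^ d \<le> real N ^ d * exp (real d)"
    by (rule mult_right_le_imp_le) simp
  also have "exp (real d) = exp 1 ^ d" by (simp flip: exp_of_nat_mult)
  finally show ?thesis using assms by (simp add: power_divide power_mult_distrib le_divide_eq mult.commute)
qed

lemma fact_add_ge: "fact m * m ^ d \<le> (fact (m + d) :: nat)"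
proof (induction d)
  case (Suc d)
  have "fact m * m ^ Suc d = m * (fact m * m ^ d)" by simp
  also have "\<dots> \<le> Suc (m + d) * fact (m + d)" using Suc by (intro mult_mono) auto
  finally show ?case by simp
qed simp

text \<open>Combines (N - d)^d \<le> N!/(N - d)! with the factorial bound; N - d in place of N is
  acceptable because d/N tends to 0 in the application.\<close>

lemma binomial_lower:
  assumes "1 \<le> d" "d \<le> N"
  shows "(exp 1 * real (N - d) / real d) ^ d / (exp 1 * real d) \<le> real (N choose d)"
proof -
  have "fact (N - d) * (N - d) ^ d \<le> (fact (N - d + d) :: nat)" by (rule fact_add_ge)
  also have "\<dots> = fact (N - d) * (fact d * (N choose d))"
    using binomial_fact_lemma[OF assms(2)] assms by (simp add: mult_ac)
  finally have "(N - d) ^ d \<le> fact d * (N choose d)" by simp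
  then have "real (N - d) ^ d \<le> fact d * real (N choose d)"
    by (metis of_nat_fact of_nat_le_iff of_nat_mult of_nat_power)
  also have "\<dots> \<le> (exp 1 * real d * (real d / exp 1) ^ d) * real (N choose d)"
    using assms by (intro mult_right_mono fact_le_power) auto
  finally have "real (N - d) ^ d * (exp 1 / real d) ^ d
      \<le> (exp 1 * real d * (real d / exp 1) ^ d) * real (N choose d) * (exp 1 / real d) ^ d"
    by (intro mult_right_mono) auto
  also have "\<dots> = (exp 1 * real d) * real (N choose d) * ((real d / exp 1) * (exp 1 / real d)) ^ d"
    by (simp only: power_mult_distrib mult_ac)
  also have "(real d / exp 1) * (exp 1 / real d) = 1" using assms by simp
  finally have "(real (N - d) * (exp 1 / real d)) ^ d \<le> (exp 1 * real d) * real (N choose d)"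
    by (simp only: power_mult_distrib power_one mult_1_right)
  then show ?thesis using assms by (simp add: divide_le_eq mult_ac)
qed

lemma binomial_lower_crude:
  assumes "1 \<le> d" "d \<le> N"
  shows "(real N / real d) ^ d \<le> real (N choose d)"
  using binomial_ge_n_over_k_pow_k[OF assms(2), where 'a = real] by simp

definition bohr_asymp :: "nat \<Rightarrow> nat \<Rightarrow> nat \<Rightarrow> real" where
  "bohr_asymp q N d = real N powr (1 / (2 * real d)) * sqrt (real d / (exp 1 * (real q - 1) * real N))"

lemma power_powr_inverse: "x \<ge> 0 \<Longrightarrow> d \<ge> 1 \<Longrightarrow> (x ^ d) powr (c / real d) = x powr c"
  by (cases "x = 0") (simp_all add: powr_powr flip: powr_realpow)

lemma bohr_asymp_eq:
  assumes "q \<ge> 2" "1 \<le> d" "1 \<le> N"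
  shows "bohr_asymp q N d = real N powr (1 / (2 * real d)) * (exp 1 * real N / real d) powr (- (1 / 2))
    * (real q - 1) powr (- (1 / 2))"
proof -
  have "sqrt (real d / (exp 1 * (real q - 1) * real N)) = ((exp 1 * real N / real d) * (real q - 1)) powr (- (1 / 2))"
    using assms by (simp add: powr_minus powr_half_sqrt real_sqrt_divide real_sqrt_mult divide_simps)
  then show ?thesis by (simp only: bohr_asymp_def powr_mult mult.assoc)
qed

text \<open>The correction factors stem from the constant in the union bound, from N - d in place of
  N, and from the factor e d in the factorial bound. Each tends to 1 when d tends to infinity and
  d/N to 0.\<close>

lemma bohr_radius_asymp_upper:
  assumes q: "q \<ge> 2" and d: "1 \<le> d" "d < N"
  shows "bohr_radius N q d \<le> bohr_asymp q N d * ((2 * sqrt (ln (real q) + ln 8)) powr (1 / real d)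
    * (1 - real d / real N) powr (- (1 / 2)) * (exp 1 * real d) powr (1 / (2 * real d)))"
proof -
  define b where "b = real (N choose d)"
  define c where "c = ln (real q) + ln 8"
  have c: "c > 0" using q by (simp add: c_def add_pos_pos)
  have N: "N > 0" using d by simp
  have b: "b > 0" using d by (simp add: b_def)
  have "real N * ln (real q) + ln 8 \<le> real N * ln (real q) + real N * ln 8"
    using N by (intro add_left_mono) simp
  then have "2 * sqrt (real N * ln (real q) + ln 8) \<le> 2 * sqrt (real N * c)"
    by (simp add: c_def distrib_left)
  then have "(2 * sqrt (real N * ln (real q) + ln 8)) powr (1 / real d) \<le> (2 * sqrt (real N * c)) powr (1 / real d)"
    using q by (intro powr_mono2) (auto intro!: add_nonneg_nonneg)
  also have "\<dots> = (2 * sqrt c) powr (1 / real d) * real N powr (1 / (2 * real d))"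
    using c N by (simp add: real_sqrt_mult powr_mult powr_powr mult_ac flip: powr_half_sqrt)
  finally have 1: "(2 * sqrt (real N * ln (real q) + ln 8)) powr (1 / real d)
      \<le> (2 * sqrt c) powr (1 / real d) * real N powr (1 / (2 * real d))" .
  define X where "X = exp 1 * real (N - d) / real d"
  have X: "X > 0" using d by (simp add: X_def)
  have "(X ^ d / (exp 1 * real d)) powr (- (1 / (2 * real d))) \<ge> b powr (- (1 / (2 * real d)))"
    using binomial_lower[of d N] d X unfolding X_def[symmetric] b_def by (intro powr_mono2') auto
  also have "(X ^ d / (exp 1 * real d)) powr (- (1 / (2 * real d)))
      = (X ^ d) powr ((- (1 / 2)) / real d) * (exp 1 * real d) powr (1 / (2 * real d))"
  proof -
    have "(Y / Z) powr (- f) = Y powr (- f) * Z powr f" for Y Z f :: real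
      by (simp add: powr_divide powr_minus_divide)
    moreover have "- (1 / (2 * real d)) = (- (1 / 2)) / real d" by simp
    ultimately show ?thesis by metis
  qed
  also have "(X ^ d) powr ((- (1 / 2)) / real d) = X powr (- (1 / 2))"
    using X d by (intro power_powr_inverse) auto
  also have "X = exp 1 * real N / real d * (1 - real d / real N)"
    using d N by (simp add: X_def of_nat_diff field_simps)
  also have "\<dots> powr (- (1 / 2)) = (exp 1 * real N / real d) powr (- (1 / 2)) * (1 - real d / real N) powr (- (1 / 2))"
    by (rule powr_mult)
  finally have 2: "b powr (- (1 / (2 * real d))) \<le> (exp 1 * real N / real d) powr (- (1 / 2)) * (1 - real d / real N) powr (- (1 / 2))
      * (exp 1 * real d) powr (1 / (2 * real d))" .
  have "real ((N choose d) * (q - 1) ^ d) powr (- (1 / (2 * real d)))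
      = b powr (- (1 / (2 * real d))) * ((real q - 1) ^ d) powr ((- (1 / 2)) / real d)"
    using q by (simp add: b_def powr_mult of_nat_diff)
  also have "((real q - 1) ^ d) powr ((- (1 / 2)) / real d) = (real q - 1) powr (- (1 / 2))"
    using q d by (intro power_powr_inverse) auto
  finally have 3: "real ((N choose d) * (q - 1) ^ d) powr (- (1 / (2 * real d))) = b powr (- (1 / (2 * real d))) * (real q - 1) powr (- (1 / 2))" .
  have "bohr_radius N q d \<le> (2 * sqrt (real N * ln (real q) + ln 8)) powr (1 / real d)
      * (b powr (- (1 / (2 * real d))) * (real q - 1) powr (- (1 / 2)))"
    using bohr_radius_le[OF q d(1) less_imp_le[OF d(2)]] unfolding 3 .
  also have "\<dots> \<le> ((2 * sqrt c) powr (1 / real d) * real N powr (1 / (2 * real d)))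
      * (((exp 1 * real N / real d) powr (- (1 / 2)) * (1 - real d / real N) powr (- (1 / 2))
      * (exp 1 * real d) powr (1 / (2 * real d))) * (real q - 1) powr (- (1 / 2)))"
    by (intro mult_mono 1 mult_right_mono 2) auto
  also have "\<dots> = bohr_asymp q N d * ((2 * sqrt c) powr (1 / real d)
    * (1 - real d / real N) powr (- (1 / 2)) * (exp 1 * real d) powr (1 / (2 * real d)))"
    unfolding bohr_asymp_eq[OF q d(1) Suc_leI[OF N, folded One_nat_def]] by (simp only: mult_ac)
  finally show ?thesis by (simp add: c_def)
qed

text \<open>The exponent of M splits as -1/(2d) + 1/(2 d^2). In the first part the binomial
  coefficient is bounded above by (e N/d)^d, which yields the square root; in the second it is
  bounded below by (N/d)^d, which yields N^(1/(2d)) at the cost of d^(-1/(2d)).\<close>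

lemma bohr_radius_asymp_lower:
  assumes q: "q \<ge> 2" and d: "1 \<le> d" "d \<le> N" and \<epsilon>: "\<epsilon> > 0" and hom: "BH_hom q d ((1 + \<epsilon>) ^ d)"
  shows "bohr_asymp q N d * (inverse (1 + \<epsilon>) * real d powr (- (1 / (2 * real d)))) \<le> bohr_radius N q d"
proof -
  define b where "b = real (N choose d)"
  define M where "M = b * (real q - 1) ^ d"
  define e where "e = 1 / (2 * (real d)\<^sup>2)"
  have N: "N > 0" using d by simp
  have b: "b \<ge> 1" using d by (simp add: b_def Suc_le_eq)
  have q1: "(real q - 1) ^ d \<ge> 1" using q by (intro one_le_power) simp
  have bM: "b \<le> M" using b q1 by (simp add: M_def)
  then have M: "M \<ge> 1" using b by simp
  have "(exp 1 * real N / real d) powr (- (1 / 2)) = ((exp 1 * real N / real d) ^ d) powr (- (1 / 2) / real d)"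
    using d by (intro power_powr_inverse[symmetric]) auto
  also have "\<dots> = ((exp 1 * real N / real d) ^ d) powr (- (1 / (2 * real d)))" by simp
  also have "\<dots> \<le> b powr (- (1 / (2 * real d)))"
    using binomial_upper[OF d(1), of N] b d by (intro powr_mono2') (auto simp: b_def)
  finally have 1: "(exp 1 * real N / real d) powr (- (1 / 2)) \<le> b powr (- (1 / (2 * real d)))" .
  have "(real N / real d) powr (1 / (2 * real d)) = ((real N / real d) ^ d) powr (1 / (2 * real d) / real d)"
    using d by (intro power_powr_inverse[symmetric]) auto
  also have "1 / (2 * real d) / real d = e" by (simp add: e_def power2_eq_square)
  also have "((real N / real d) ^ d) powr e \<le> M powr e"
    using binomial_lower_crude[OF d] bM by (intro powr_mono2) (auto simp: e_def b_def)
  finally have 2: "(real N / real d) powr (1 / (2 * real d)) \<le> M powr e" .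
  have "((real q - 1) ^ d) powr (- (1 / 2) / real d) = (real q - 1) powr (- (1 / 2))"
    using q d by (intro power_powr_inverse) auto
  then have 3: "M powr (- (1 / (2 * real d))) = b powr (- (1 / (2 * real d))) * (real q - 1) powr (- (1 / 2))"
    by (simp add: M_def powr_mult)
  have exps: "- ((real d - 1) / (2 * (real d)\<^sup>2)) = - (1 / (2 * real d)) + e"
    using d by (simp add: e_def power2_eq_square field_simps)
  have "real ((N choose d) * (q - 1) ^ d) = M" using q by (simp add: M_def b_def of_nat_diff)
  moreover have "((1 + \<epsilon>) ^ d) powr (- (1 / real d)) = inverse (1 + \<epsilon>)"
    using power_powr_inverse[of "1 + \<epsilon>" d "-1"] d \<epsilon> by (simp add: powr_minus)
  moreover have "(1 + \<epsilon>) ^ d \<ge> 1" using \<epsilon> by (intro one_le_power) simp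
  ultimately have R: "inverse (1 + \<epsilon>) * M powr (- (1 / (2 * real d)) + e) \<le> bohr_radius N q d"
    using bohr_radius_ge_BH_hom[OF q d _ hom] exps by simp
  have "bohr_asymp q N d * (inverse (1 + \<epsilon>) * real d powr (- (1 / (2 * real d))))
      = inverse (1 + \<epsilon>) * (((exp 1 * real N / real d) powr (- (1 / 2)) * (real q - 1) powr (- (1 / 2)))
        * (real N / real d) powr (1 / (2 * real d)))"
  proof -
    have "(real N / real d) powr (1 / (2 * real d)) = real N powr (1 / (2 * real d)) * real d powr (- (1 / (2 * real d)))"
      by (simp add: powr_divide powr_minus_divide)
    then show ?thesis
      unfolding bohr_asymp_eq[OF q d(1) Suc_leI[OF N, folded One_nat_def]] by (simp only: mult_ac)
  qed
  also have "\<dots> \<le> inverse (1 + \<epsilon>) * ((b powr (- (1 / (2 * real d))) * (real q - 1) powr (- (1 / 2))) * M powr e)"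
    using \<epsilon> by (intro mult_left_mono mult_mono mult_right_mono 1 2) auto
  also have "\<dots> = inverse (1 + \<epsilon>) * M powr (- (1 / (2 * real d)) + e)"
    unfolding powr_add 3 by (simp only: mult_ac)
  also note R
  finally show ?thesis .
qed

lemma bohr_radius_asymp_equiv:
  assumes q: "q \<ge> 2" and d: "filterlim d at_top sequentially" and o: "(\<lambda>N. real (d N)) \<in> o(\<lambda>N. real N)"
  shows "(\<lambda>N. bohr_radius N q (d N)) \<sim>[sequentially] (\<lambda>N. bohr_asymp q N (d N))"
proof (rule asymp_equivI')
  have rd: "filterlim (\<lambda>N. real (d N)) at_top sequentially"
    using filterlim_compose[OF filterlim_real_sequentially d] .
  have quot: "(\<lambda>N. real (d N) / real N) \<longlonglongrightarrow> 0"
    by (rule smalloD_tendsto[OF o])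
  have d1: "eventually (\<lambda>N. d N \<ge> 1) sequentially"
    using d by (simp add: filterlim_at_top)
  have dN: "eventually (\<lambda>N. d N < N) sequentially"
  proof -
    have "eventually (\<lambda>N. real (d N) / real N < 1) sequentially"
      using order_tendstoD(2)[OF quot, of 1] by simp
    then show ?thesis
      using eventually_gt_at_top[of 0] by eventually_elim (auto simp: divide_less_eq)
  qed
  have pos: "bohr_asymp q N (d N) > 0" if "1 \<le> d N" "d N < N" for N
    using that q by (simp add: bohr_asymp_def)
  show "(\<lambda>N. bohr_radius N q (d N) / bohr_asymp q N (d N)) \<longlonglongrightarrow> 1"
  proof (rule order_tendstoI)
    fix a :: real assume a: "a < 1"
    \<comment> \<open>For 0 < a < 1 the choice \<epsilon> = (1 - a)/(2a) gives 1/(1 + \<epsilon>) =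
      2a/(1 + a), which exceeds a.\<close>
    obtain \<epsilon> where \<epsilon>: "\<epsilon> > 0" "a < inverse (1 + \<epsilon>)"
    proof (cases "a \<le> 0")
      case True
      then have "a < inverse (1 + 1)" by simp
      then show ?thesis using that[of 1] by simp
    next
      case False
      then have "inverse (1 + (1 - a) / (2 * a)) = 2 * a / (1 + a)"
        by (simp add: field_simps)
      moreover have "a < 2 * a / (1 + a)" using False a by (simp add: field_simps)
      ultimately show ?thesis using that[of "(1 - a) / (2 * a)"] a False by simp
    qed
    have "((\<lambda>x::real. inverse (1 + \<epsilon>) * x powr (- (1 / (2 * x)))) \<longlongrightarrow> inverse (1 + \<epsilon>)) at_top"
      by real_asymp
    from filterlim_compose[OF this rd]
    have "eventually (\<lambda>N. a < inverse (1 + \<epsilon>) * real (d N) powr (- (1 / (2 * real (d N))))) sequentially"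
      using \<epsilon>(2) by (rule order_tendstoD)
    moreover have "eventually (\<lambda>N. BH_hom q (d N) ((1 + \<epsilon>) ^ d N)) sequentially"
    proof -
      have "eventually (\<lambda>m. BH_hom q m ((1 + \<epsilon>) ^ m)) at_top"
        using BH_hom_subexponential[of q \<epsilon>] q \<epsilon> by simp
      from this d show ?thesis by (rule eventually_compose_filterlim)
    qed
    ultimately show "eventually (\<lambda>N. a < bohr_radius N q (d N) / bohr_asymp q N (d N)) sequentially"
      using d1 dN
    proof eventually_elim
      case (elim N)
      have "inverse (1 + \<epsilon>) * real (d N) powr (- (1 / (2 * real (d N)))) \<le> bohr_radius N q (d N) / bohr_asymp q N (d N)"
        using bohr_radius_asymp_lower[OF q elim(3) less_imp_le[OF elim(4)] \<epsilon>(1) elim(2)] pos[OF elim(3,4)]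
        by (simp add: le_divide_eq mult_ac)
      then show ?case using elim(1) by linarith
    qed
  next
    fix a :: real assume a: "1 < a"
    define c where "c = 2 * sqrt (ln (real q) + ln 8)"
    have c: "c > 0" using q by (simp add: c_def add_pos_pos)
    have "((\<lambda>x::real. c powr (1 / x)) \<longlongrightarrow> 1) at_top" using c by real_asymp
    moreover have "((\<lambda>x::real. (exp 1 * x) powr (1 / (2 * x))) \<longlongrightarrow> 1) at_top" by real_asymp
    moreover have "(\<lambda>N. (1 - real (d N) / real N) powr (- (1 / 2))) \<longlonglongrightarrow> (1 - 0) powr (- (1 / 2))"
      by (intro tendsto_intros quot) simp
    ultimately have "(\<lambda>N. c powr (1 / real (d N)) * (1 - real (d N) / real N) powr (- (1 / 2))
        * (exp 1 * real (d N)) powr (1 / (2 * real (d N)))) \<longlonglongrightarrow> 1 * (1 - 0) powr (- (1 / 2)) * 1"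
      by (intro tendsto_mult filterlim_compose[OF _ rd])
    then have "eventually (\<lambda>N. c powr (1 / real (d N)) * (1 - real (d N) / real N) powr (- (1 / 2))
        * (exp 1 * real (d N)) powr (1 / (2 * real (d N))) < a) sequentially"
      using a by (intro order_tendstoD) auto
    then show "eventually (\<lambda>N. bohr_radius N q (d N) / bohr_asymp q N (d N) < a) sequentially"
      using d1 dN
    proof eventually_elim
      case (elim N)
      have "bohr_radius N q (d N) / bohr_asymp q N (d N) \<le> c powr (1 / real (d N)) * (1 - real (d N) / real N) powr (- (1 / 2))
        * (exp 1 * real (d N)) powr (1 / (2 * real (d N)))"
        using bohr_radius_asymp_upper[OF q elim(2,3)] pos[OF elim(2,3)]
        by (simp add: c_def divide_le_eq mult_ac)
      then show ?case using elim(1) by linarith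
    qed
  qed
qed

theorem theorem6p2:
  fixes q :: nat
  assumes "q \<ge> 2"
  shows
    "(\<forall>d N. 1 \<le> d \<and> d \<le> N \<longrightarrow>
        BH_int d q powr (- (1 / real d))
          * real (N choose d) powr (- ((real d - 1) / (2 * (real d)\<^sup>2)))
          * (real q - 1) powr (- ((real d - 1) / (2 * real d)))
          \<le> bohr_radius N q d
      \<and> bohr_radius N q d
          \<le> (2 * sqrt (real N * ln (real q) + ln 8)) powr (1 / real d)
              * real (N choose d) powr (- (1 / (2 * real d)))
              * (real q - 1) powr (- (1 / 2)))
     \<and> (\<forall>d :: nat \<Rightarrow> nat.
          filterlim d at_top sequentially \<and> (\<lambda>N. real (d N)) \<in> o(\<lambda>N. real N) \<longrightarrow>
          (\<lambda>N. bohr_radius N q (d N)) \<sim>[sequentially]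
          (\<lambda>N. real N powr (1 / (2 * real (d N)))
                 * sqrt (real (d N) / (exp 1 * (real q - 1) * real N))))"
proof (intro conjI allI impI)
  fix d N :: nat
  assume "1 \<le> d \<and> d \<le> N"
  then have d: "1 \<le> d" "d \<le> N" by auto
  \<comment> \<open>The bounds for the radius carry the cardinality of the layer under one power;
    here its two factors are separated.\<close>
  have split: "real ((N choose d) * (q - 1) ^ d) powr (c / real d) = real (N choose d) powr (c / real d) * (real q - 1) powr c" for c
  proof -
    have "real ((N choose d) * (q - 1) ^ d) = real (N choose d) * (real q - 1) ^ d"
      using assms by (simp add: of_nat_diff)
    then show ?thesis
      using power_powr_inverse[of "real q - 1" d c] assms d by (simp add: powr_mult)
  qed
  have "- ((real d - 1) / (2 * (real d)\<^sup>2)) = - ((real d - 1) / (2 * real d)) / real d"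
    by (simp add: power2_eq_square)
  then show "BH_int d q powr (- (1 / real d))
          * real (N choose d) powr (- ((real d - 1) / (2 * (real d)\<^sup>2)))
          * (real q - 1) powr (- ((real d - 1) / (2 * real d)))
          \<le> bohr_radius N q d"
    using bohr_radius_ge_BH_int[OF assms d] by (simp only: split mult.assoc)
  have "- (1 / (2 * real d)) = - (1 / 2) / real d" by simp
  then show "bohr_radius N q d
          \<le> (2 * sqrt (real N * ln (real q) + ln 8)) powr (1 / real d)
              * real (N choose d) powr (- (1 / (2 * real d)))
              * (real q - 1) powr (- (1 / 2))"
    using bohr_radius_le[OF assms d] by (simp only: split mult.assoc)
next
  fix d :: "nat \<Rightarrow> nat"
  assume "filterlim d at_top sequentially \<and> (\<lambda>N. real (d N)) \<in> o(\<lambda>N. real N)"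
  then show "(\<lambda>N. bohr_radius N q (d N)) \<sim>[sequentially]
          (\<lambda>N. real N powr (1 / (2 * real (d N)))
                 * sqrt (real (d N) / (exp 1 * (real q - 1) * real N)))"
    using bohr_radius_asymp_equiv[OF assms, of d] by (simp add: bohr_asymp_def)
qed

end
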